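(* Let $a_i>-1$, $-1<b_i\le 1$, $|b_i|\le 1+a_i$ for $i=1,2$, and let $W=(W_{s,t})_{s,t\ge0}$ be the weighted fractional Brownian sheet with parameters $(a_i,b_i)$, $i=1,2$. Then $W$ has the following properties: (1) Self-similarity: for each $h,k>0$, $(W_{hs,kt})_{s,t\ge 0}\overset{d}{=}h^{(1+a_1+b_1)/2}k^{(1+a_2+b_2)/2}(W_{s,t})_{s,t\ge0}$, where $\overset{d}{=}$ denotes equality in distribution. (2) $W$ has stationary increments only in the case $a_1=a_2=0$. (3) Covariance of increments: for $(0,0)\preceq(s,t)\prec(s',t')\preceq(p,r)\prec(p',r')$, $$K_W((s,t),(s',t');(p,r),(p',r'))=\int_s^{s'}u^{a_1}\left[(p'-u)^{b_1}-(p-u)^{b_1}\right]du\int_t^{t'}v^{a_2}\left[(r'-v)^{b_2}-(r-v)^{b_2}\right]dv,$$ hence $K_W((s,t),(s',t');(p,r),(p',r'))$ is $>0$ if $b_1b_2>0$, $=0$ if $b_1b_2=0$, and $<0$ if $b_1b_2<0$. (4) The one-time processes $(W_{s,t})_{s\ge0}$ ($t$ fixed) and $(W_{s,t})_{t\ge0}$ ($s$ fixed) are weighted fractional Brownian motions (multiplied by constants) with parameters $(a_1,b_1)$ and $(a_2,b_2)$, respectively. (5) For $(0,0)\preceq (s,t)\prec(s',t')$, $$E\left((\Delta_{s,t}W_{s',t'})^2\right)=4\int_s^{s'}u^{a_1}(s'-u)^{b_1}du\int_t^{t'}v^{a_2}(t'-v)^{b_2}dv.$$ (6) For $s,t>0$,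 $$\lim_{\varepsilon,\delta\to0}\varepsilon^{-b_1-1}\delta^{-b_2-1}E\left((\Delta_{s,t}W_{s+\varepsilon,t+\delta})^2\right)=\frac{4}{(1+b_1)(1+b_2)}s^{a_1}t^{a_2}$$ (with $\varepsilon,\delta>0$), and for $s,t\ge0$, $$\lim_{T,S\to\infty}S^{-(1+a_1+b_1)}T^{-(1+a_2+b_2)}E\left((\Delta_{s,t}W_{s+S,t+T})^2\right)=4\int_0^1u^{a_1}(1-u)^{b_1}du\int_0^1v^{a_2}(1-v)^{b_2}dv;$$ hence $W$ has asymptotically stationary increments for long increments in $\mathbb{R}_+^2$, but not for short ones (if $a_1,a_2\ne0$). (7) The finite-dimensional distributions of the process $(S^{-a_1/2}T^{-a_2/2}\Delta_{S,T}W_{s+S,t+T})_{s,t\ge0}$ converge, as $T,S\to\infty$, to those of the fractional Brownian sheet with parameters $(\frac12(1+b_1),\frac12(1+b_2))$ multiplied by $2/[(1+b_1)(1+b_2)]^{1/2}$. (8) Long-range dependence: for $(s,t)\prec(s',t')$ and $(p,u)\prec(p',u')$ in $\mathbb{R}_+^2$, $$\lim_{\tau,\kappa\to\infty}\tau^{1-b_1}\kappa^{1-b_2}K_W((s,t),(s',t');(p+\tau,u+\kappa),(p'+\tau,u'+\kappa))$$ $$=\frac{b_1b_2}{(1+a_1)(1+a_2)}(p'-p)\left((s')^{1+a_1}-s^{1+a_1}\right)(u'-u)\left((t')^{1+a_2}-t^{1+a_2}\right).$$ (9) For $\theta>0$ define the one-time process $(Z_t)_{t\ge0}=(W_{t,\theta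 t})_{t\ge0}$, i.e., the sheet restricted to a ray through the origin. (Note that $Z$ is not a weighted fractional Brownian motion.) Then for $0\le b_i<1$, $i=1,2$, and not both $b_1,b_2$ equal to $0$, this process has the long-range dependence property $$\lim_{\tau\to\infty}\tau^{1-(b_1+b_2)}\mathrm{Cov}(Z_v-Z_u,\,Z_{t+\tau}-Z_{s+\tau})=\frac{\theta^{1+a_2+b_2}(b_1+b_2)}{(1+a_1)(1+a_2)}\left(v^{2+a_1+a_2}-u^{2+a_1+a_2}\right)(t-s),\qquad u<v,\ s<t.$$
   Context: Weighted fractional Brownian motion with parameters $(a,b)$, where $a>-1$, $-1<b\le1$, $|b|\le 1+a$, is the centered Gaussian process $(Y_t)_{t\ge0}$ with covariance $$E(Y_uY_v)=\int_0^{u\wedge v}r^{a}\left[(u-r)^{b}+(v-r)^{b}\right]dr .$$ The weighted fractional Brownian sheet with parameters $(a_i,b_i)$, $i=1,2$, is the centered Gaussian random field $W=(W_{s,t})_{s,t\ge0}$ with covariance $E(W_{s,t}W_{s',t'})=C^{(1)}(s,s')C^{(2)}(t,t')$, where $$C^{(i)}(u,v)=\int_0^{u\wedge v} r^{a_i}\left[(u-r)^{b_i}+(v-r)^{b_i}\right]dr .$$ Partial order on $\mathbb{R}_+^2$: $(s,t)\preceq(s',t')$ iff $s\le s'$ and $t\le t'$; $(s,t)\prec(s',t')$ iff $s<s'$ and $t<t'$. Increment over a rectangle $((s,t),(s',t')]=(s,s']\times(t,t']$: $\Delta_{s,t}X(s',t')=\Delta_{s,t}X_{s',t'}:=X_{s',t'}-X_{s,t'}-X_{s',t}+X_{s,t}$.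 The covariance of increments is $$K_X((s,t),(s',t');(p,r),(p',r'))=\mathrm{Cov}\left(\Delta_{s,t}X(s',t'),\Delta_{p,r}X(p',r')\right).$$ The fractional Brownian sheet with parameters $(H_1,H_2)$ is the centered Gaussian field $B$ with $$E(B_{s,t}B_{s',t'})=\tfrac12\left(s^{2H_1}+s'^{2H_1}-|s-s'|^{2H_1}\right)\cdot\tfrac12\left(t^{2H_2}+t'^{2H_2}-|t-t'|^{2H_2}\right).$$
   Formalization: In (9) the printed limit is off by a factor 2 when exactly one of b_1, b_2 is 0, so the limit proved there is twice the printed one; the remark that Z is not a weighted fractional Brownian motion is proved except for b_1=b_2=0, where Z is a constant multiple of one. *)

theory Defs
  imports "HOL-Probability.Probability"
begin

definition covariance :: "'w measure \<Rightarrow> ('w \<Rightarrow> real) \<Rightarrow> ('w \<Rightarrow> real) \<Rightarrow> real" where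
  "covariance M X Y =
     (\<integral>\<omega>. (X \<omega> - (\<integral>\<eta>. X \<eta> \<partial>M)) * (Y \<omega> - (\<integral>\<eta>. Y \<eta> \<partial>M)) \<partial>M)"

text \<open>Normal random variables, including the degenerate (almost surely constant) ones.\<close>

definition gaussian_rv :: "'w measure \<Rightarrow> ('w \<Rightarrow> real) \<Rightarrow> bool" where
  "gaussian_rv M X \<longleftrightarrow>
     X \<in> borel_measurable M \<and>
     ((\<exists>\<mu> \<sigma>. 0 < \<sigma> \<and> distributed M lborel X (\<lambda>x. ennreal (normal_density \<mu> \<sigma> x))) \<or>
      (\<exists>\<mu>. AE \<omega> in M. X \<omega> = \<mu>))"

text \<open>A process is Gaussian if every finite linear combination of its values is a normal variable.
  Processes are functions on a whole type, of which only the values on the index set \<open>I\<close> matter.\<close>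

definition centered_gaussian_process :: "'w measure \<Rightarrow> 'i set \<Rightarrow> ('i \<Rightarrow> 'w \<Rightarrow> real) \<Rightarrow> bool" where
  "centered_gaussian_process M I X \<longleftrightarrow>
     prob_space M \<and>
     (\<forall>i\<in>I. X i \<in> borel_measurable M) \<and>
     (\<forall>J c. finite J \<and> J \<subseteq> I \<longrightarrow> gaussian_rv M (\<lambda>\<omega>. \<Sum>j\<in>J. c j * X j \<omega>)) \<and>
     (\<forall>i\<in>I. (\<integral>\<omega>. X i \<omega> \<partial>M) = 0)"

text \<open>The law of a process on the product \<open>\<sigma>\<close>-algebra; two processes are equal in distribution
  if their laws agree.\<close>

definition process_law :: "'w measure \<Rightarrow> 'i set \<Rightarrow> ('i \<Rightarrow> 'w \<Rightarrow> real) \<Rightarrow> ('i \<Rightarrow> real) measure" where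
  "process_law M I X = distr M (Pi\<^sub>M I (\<lambda>_. borel)) (\<lambda>\<omega>. \<lambda>i\<in>I. X i \<omega>)"

text \<open>Weak convergence of all finite-dimensional distributions along a filter, by means of bounded
  continuous test functions on the finite powers of the real line.\<close>

definition fdd_converges ::
  "'w measure \<Rightarrow> 'i set \<Rightarrow> ('z \<Rightarrow> 'i \<Rightarrow> 'w \<Rightarrow> real) \<Rightarrow> 'v measure \<Rightarrow> ('i \<Rightarrow> 'v \<Rightarrow> real) \<Rightarrow> 'z filter \<Rightarrow> bool" where
  "fdd_converges M I X N Y F \<longleftrightarrow>
     (\<forall>J f. finite J \<and> J \<subseteq> I \<and> continuous_map (powertop_real J) euclideanreal f \<and>
            bounded (f ` (J \<rightarrow>\<^sub>E UNIV)) \<longrightarrow>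
        ((\<lambda>z. \<integral>\<omega>. f (\<lambda>j\<in>J. X z j \<omega>) \<partial>M) \<longlongrightarrow> (\<integral>\<omega>. f (\<lambda>j\<in>J. Y j \<omega>) \<partial>N)) F)"

definition quadrant :: "(real \<times> real) set" where
  "quadrant = {0..} \<times> {0..}"

fun rect_incr :: "(real \<times> real \<Rightarrow> 'w \<Rightarrow> real) \<Rightarrow> real \<times> real \<Rightarrow> real \<times> real \<Rightarrow> 'w \<Rightarrow> real" where
  "rect_incr X (s, t) (s', t') = (\<lambda>\<omega>. X (s', t') \<omega> - X (s, t') \<omega> - X (s', t) \<omega> + X (s, t) \<omega>)"

definition incr_cov ::
  "'w measure \<Rightarrow> (real \<times> real \<Rightarrow> 'w \<Rightarrow> real) \<Rightarrow>
     real \<times> real \<Rightarrow> real \<times> real \<Rightarrow> real \<times> real \<Rightarrow> real \<times> real \<Rightarrow> real" where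
  "incr_cov M X z z' w w' = covariance M (rect_incr X z z') (rect_incr X w w')"

definition stationary_increments :: "'w measure \<Rightarrow> (real \<times> real \<Rightarrow> 'w \<Rightarrow> real) \<Rightarrow> bool" where
  "stationary_increments M X \<longleftrightarrow>
     (\<forall>h\<ge>0. \<forall>k\<ge>0.
        process_law M quadrant (\<lambda>(s, t). rect_incr X (h, k) (h + s, k + t)) =
        process_law M quadrant (\<lambda>(s, t). rect_incr X (0, 0) (s, t)))"

text \<open>Asymptotic stationarity of the increments with side lengths \<open>(x, y)\<close> along the filter \<open>F\<close>:
  the mean square of the increment is asymptotically the same at all base points in \<open>P\<close>.\<close>

definition asymp_stationary_increments ::
  "'w measure \<Rightarrow> (real \<times> real \<Rightarrow> 'w \<Rightarrow> real) \<Rightarrow> (real \<times> real) set \<Rightarrow> (real \<times> real) filter \<Rightarrow> bool" where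
  "asymp_stationary_increments M X P F \<longleftrightarrow>
     (\<forall>(s, t)\<in>P. \<forall>(p, r)\<in>P.
        ((\<lambda>(x, y). (\<integral>\<omega>. (rect_incr X (s, t) (s + x, t + y) \<omega>)\<^sup>2 \<partial>M) /
                   (\<integral>\<omega>. (rect_incr X (p, r) (p + x, r + y) \<omega>)\<^sup>2 \<partial>M)) \<longlongrightarrow> 1) F)"

definition wfbm_params :: "real \<Rightarrow> real \<Rightarrow> bool" where
  "wfbm_params a b \<longleftrightarrow> -1 < a \<and> -1 < b \<and> b \<le> 1 \<and> \<bar>b\<bar> \<le> 1 + a"

text \<open>Note that \<open>0 powr x = 0\<close> for all \<open>x\<close>; in the integrals below this convention only concerns
  the null set of endpoints.\<close>

definition wfbm_cov :: "real \<Rightarrow> real \<Rightarrow> real \<Rightarrow> real \<Rightarrow> real" where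
  "wfbm_cov a b u v = (LBINT r:{0..min u v}. r powr a * ((u - r) powr b + (v - r) powr b))"

definition weighted_fBm :: "'w measure \<Rightarrow> real \<Rightarrow> real \<Rightarrow> (real \<Rightarrow> 'w \<Rightarrow> real) \<Rightarrow> bool" where
  "weighted_fBm M a b Y \<longleftrightarrow>
     wfbm_params a b \<and> centered_gaussian_process M {0..} Y \<and>
     (\<forall>u\<ge>0. \<forall>v\<ge>0. (\<integral>\<omega>. Y u \<omega> * Y v \<omega> \<partial>M) = wfbm_cov a b u v)"

definition weighted_fB_sheet ::
  "'w measure \<Rightarrow> real \<Rightarrow> real \<Rightarrow> real \<Rightarrow> real \<Rightarrow> (real \<times> real \<Rightarrow> 'w \<Rightarrow> real) \<Rightarrow> bool" where
  "weighted_fB_sheet M a1 b1 a2 b2 W \<longleftrightarrow>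
     wfbm_params a1 b1 \<and> wfbm_params a2 b2 \<and> centered_gaussian_process M quadrant W \<and>
     (\<forall>s\<ge>0. \<forall>t\<ge>0. \<forall>s'\<ge>0. \<forall>t'\<ge>0.
        (\<integral>\<omega>. W (s, t) \<omega> * W (s', t') \<omega> \<partial>M) = wfbm_cov a1 b1 s s' * wfbm_cov a2 b2 t t')"

definition fBm_cov :: "real \<Rightarrow> real \<Rightarrow> real \<Rightarrow> real" where
  "fBm_cov H u v = (u powr (2 * H) + v powr (2 * H) - \<bar>u - v\<bar> powr (2 * H)) / 2"

definition fB_sheet :: "'w measure \<Rightarrow> real \<Rightarrow> real \<Rightarrow> (real \<times> real \<Rightarrow> 'w \<Rightarrow> real) \<Rightarrow> bool" where
  "fB_sheet M H1 H2 B \<longleftrightarrow>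
     centered_gaussian_process M quadrant B \<and>
     (\<forall>s\<ge>0. \<forall>t\<ge>0. \<forall>s'\<ge>0. \<forall>t'\<ge>0.
        (\<integral>\<omega>. B (s, t) \<omega> * B (s', t') \<omega> \<partial>M) = fBm_cov H1 s s' * fBm_cov H2 t t')"

end

theory Submission
  imports Defs
begin

text \<open>
  Everything about a centered Gaussian field is read off its covariance, and rectangular increments
  of the sheet have covariance \<open>cov_incr a1 b1 _ _ _ _ * cov_incr a2 b2 _ _ _ _\<close>, so each claim reduces to
  the one-dimensional integrals \<open>kint a b s s' x\<close> of \<open>r powr a * (x - r) powr b\<close> over \<open>[s, s']\<close>: their
  additivity, their homogeneity of degree \<open>1 + a + b\<close> and a few limits obtained by freezing the slowly
  varying factor.

  Equality of laws and convergence of finite-dimensional distributions follow from (convergence of)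
  covariances: the Gaussian property determines the expectation of \<open>cos (\<Sum>j. t j * X j + \<phi>)\<close>, every bounded
  continuous \<open>f\<close> is approximated on large cubes by globally bounded sums of such functions, and the
  variances control what happens outside the cube.

  That the restriction \<open>Z\<close> to a ray is no weighted fractional Brownian motion means that
  \<open>K * C1 (1, t) * C2 (1, t) = C (1, t)\<close> is impossible. Writing each covariance as
  \<open>C (1, t) = B + g t\<close> with \<open>g 1 = B\<close> and \<open>g t\<close> asymptotic to \<open>t powr b / (1 + a)\<close>, one compares both sides at \<open>t = 1\<close>, as
  \<open>t\<close> tends to infinity and, if \<open>b1\<close> and \<open>b2\<close> have opposite signs, as \<open>t\<close> decreases to \<open>1\<close>.
\<close>

section \<open>Integrals of products of powers\<close>

text \<open>The exponents may be negative, so an integrand can be unbounded at both ends of its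
  interval. The limits therefore keep the possibly singular factor as an integrable weight and show
  that the other factor is uniformly close to a constant; the error is at most that distance times
  the mass of the weight. The weight is \<open>(x - r) powr b\<close> when the base point moves to
  infinity, and \<open>r powr a\<close> when \<open>x\<close> does.

  The factor 2 in the limit along the ray and the exclusion of \<open>b1 = b2 = 0\<close> have one
  source. For \<open>u \<le> v\<close> the covariance is
  \<open>kint a b 0 u u + kint a b 0 u v\<close>. For \<open>b > 0\<close> the first term is
  negligible as \<open>v\<close> grows, but for \<open>b = 0\<close> the two terms are equal, which
  doubles the coefficient. If both exponents vanish, the covariance on the ray is a constant
  multiple of \<open>min s t powr (2 + a1 + a2)\<close>, and for one value of
  \<open>\<theta>\<close> it is exactly that of a weighted fractional Brownian motion with
  parameters \<open>(1 + a1 + a2, 0)\<close>.\<close>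

definition kint :: "real \<Rightarrow> real \<Rightarrow> real \<Rightarrow> real \<Rightarrow> real \<Rightarrow> real" where
  "kint a b s s' x = (LBINT r:{s..s'}. r powr a * (x - r) powr b)"

text \<open>For \<open>x > 0\<close> the substitution \<open>r = x * q\<close> reduces the interval
  \<open>[0, x]\<close> to the Beta integral with parameters \<open>a + 1\<close> and
  \<open>b + 1\<close>. For \<open>x \<le> 0\<close> at most the point \<open>r = 0\<close> is left,
  where \<open>0 powr a = 0\<close>.\<close>

lemma set_integrable_kint:
  fixes a b :: real
  assumes "-1 < a" "-1 < b" "0 \<le> s" "s' \<le> x"
  shows "set_integrable lborel {s..s'} (\<lambda>r. r powr a * (x - r) powr b)"
proof -
  have *: "set_integrable lborel {0..x} (\<lambda>r. r powr a * (x - r) powr b)"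
  proof (cases "x > 0")
    case True
    have "set_integrable lborel {0..1} (\<lambda>r. r powr a * (1 - r) powr b)"
      using integrable_Beta[of "a + 1" "b + 1"] assms by simp
    then have "integrable lborel (\<lambda>r. indicator {0..1} (0 + (1/x) * r) *\<^sub>R
        ((0 + (1/x) * r) powr a * (1 - (0 + (1/x) * r)) powr b))"
      unfolding set_integrable_def using True by (intro lborel_integrable_real_affine) auto
    then have "integrable lborel (\<lambda>r. x powr (a + b) * (indicator {0..1} (0 + (1/x) * r) *\<^sub>R
        ((0 + (1/x) * r) powr a * (1 - (0 + (1/x) * r)) powr b)))"
      by (rule integrable_mult_right)
    also have "(\<lambda>r. x powr (a + b) * (indicator {0..1} (0 + (1/x) * r) *\<^sub>R
        ((0 + (1/x) * r) powr a * (1 - (0 + (1/x) * r)) powr b))) =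
        (\<lambda>r. indicator {0..x} r *\<^sub>R (r powr a * (x - r) powr b))"
    proof
      fix r
      show "x powr (a + b) * (indicator {0..1} (0 + (1/x) * r) *\<^sub>R
        ((0 + (1/x) * r) powr a * (1 - (0 + (1/x) * r)) powr b)) =
         indicator {0..x} r *\<^sub>R (r powr a * (x - r) powr b)"
      proof (cases "r \<in> {0..x}")
        case True
        then have "1 - r / x = (x - r) / x" using \<open>x > 0\<close> by (simp add: field_simps)
        with True \<open>x > 0\<close> show ?thesis by (simp add: powr_divide powr_add indicator_def)
      qed (use \<open>x > 0\<close> in \<open>auto simp: indicator_def field_simps\<close>)
    qed
    finally show ?thesis unfolding set_integrable_def .
  next
    case False
    then have "(\<lambda>r. indicator {0..x} r *\<^sub>R (r powr a * (x - r) powr b)) = (\<lambda>r. 0)"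
      by (auto simp: indicator_def fun_eq_iff)
    then show ?thesis unfolding set_integrable_def by simp
  qed
  show ?thesis by (rule set_integrable_subset[OF *]) (use assms in auto)
qed

lemma kint_nonneg: "0 \<le> kint a b s s' x"
  unfolding kint_def set_lebesgue_integral_def by (intro integral_nonneg_AE) auto

lemma kint_combine:
  assumes "-1 < a" "-1 < b" "0 \<le> s" "s \<le> m" "m \<le> s'" "s' \<le> x"
  shows "kint a b s s' x = kint a b s m x + kint a b m s' x"
proof -
  have "{s..s'} = {s..m} \<union> {m..s'}" using assms by auto
  moreover have "AE r in lborel. \<not> (r \<in> {s..m} \<and> r \<in> {m..s'})"
    by (rule AE_mp[OF AE_lborel_singleton[of m]]) auto
  ultimately show ?thesis
    unfolding kint_def using assms by (simp add: set_integral_Un_AE set_integrable_kint)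
qed

lemma kint_scale:
  assumes "h > 0" "0 \<le> s" "s' \<le> x"
  shows "kint a b (h * s) (h * s') (h * x) = h powr (1 + a + b) * kint a b s s' x"
proof -
  have "kint a b (h * s) (h * s') (h * x) = \<bar>h\<bar> *\<^sub>R (LBINT r. indicator {h * s .. h * s'} (0 + h * r) *\<^sub>R
      ((0 + h * r) powr a * (h * x - (0 + h * r)) powr b))"
    unfolding kint_def set_lebesgue_integral_def
    using assms by (intro lborel_integral_real_affine) auto
  also have "\<dots> = h * (LBINT r. h powr (a + b) * (indicator {s..s'} r *\<^sub>R (r powr a * (x - r) powr b)))"
  proof -
    have "indicator {h * s .. h * s'} (0 + h * r) *\<^sub>R ((0 + h * r) powr a * (h * x - (0 + h * r)) powr b) =
       h powr (a + b) * (indicator {s..s'} r *\<^sub>R (r powr a * (x - r) powr b))" for r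
    proof (cases "r \<in> {s..s'}")
      case True
      have "h * x - h * r = h * (x - r)" by (simp add: algebra_simps)
      then show ?thesis using True assms by (auto simp: powr_mult powr_add indicator_def)
    qed (use assms in \<open>auto simp: indicator_def\<close>)
    then show ?thesis using assms by simp
  qed
  also have "\<dots> = h powr (1 + a + b) * kint a b s s' x"
    using assms by (simp add: kint_def set_lebesgue_integral_def powr_add)
  finally show ?thesis .
qed

text \<open>If the integral were zero, the nonnegative integrand would vanish almost everywhere and
  an open interval would be null. The exceptional point \<open>c\<close> admits integrands with one
  interior zero, as in \<open>kint_normalized_inj\<close>.\<close>

lemma set_integral_pos:
  fixes f :: "real \<Rightarrow> real"
  assumes "set_integrable lborel {s..s'} f" "s < s'"
    and pos: "\<And>r. s < r \<Longrightarrow> r < s' \<Longrightarrow> r \<noteq> c \<Longrightarrow> 0 < f r"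
  shows "0 < (LBINT r:{s..s'}. f r)"
proof -
  have "(LBINT r:{s..s'}. f r) = (LBINT r:{s<..<s'} - {c}. f r)"
    by (rule set_integral_discrete_difference[of "{s,s',c}"]) (use \<open>s < s'\<close> in auto)
  moreover have "0 \<le> (LBINT r:{s<..<s'} - {c}. f r)"
    unfolding set_lebesgue_integral_def
    by (intro integral_nonneg_AE) (use pos in \<open>auto simp: indicator_def less_imp_le\<close>)
  moreover have "(LBINT r:{s<..<s'} - {c}. f r) \<noteq> 0"
  proof
    assume 0: "(LBINT r:{s<..<s'} - {c}. f r) = 0"
    have i: "set_integrable lborel ({s<..<s'} - {c}) f"
      by (rule set_integrable_subset[OF assms(1)]) auto
    have "AE r in lborel. indicator ({s<..<s'} - {c}) r *\<^sub>R f r = 0"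
      using 0 i unfolding set_lebesgue_integral_def set_integrable_def
      by (subst integral_nonneg_eq_0_iff_AE[symmetric])
         (use pos in \<open>auto simp: indicator_def less_imp_le\<close>)
    then have "AE r in lborel. r \<notin> {s<..<s'}"
      using AE_lborel_singleton[of c]
      by eventually_elim (use pos in \<open>fastforce simp: indicator_def split: if_splits\<close>)
    then have "emeasure lborel {s<..<s'} = 0"
      by (subst (asm) AE_iff_measurable[of "{s<..<s'}"]) auto
    then show False using \<open>s < s'\<close> by simp
  qed
  ultimately show ?thesis by linarith
qed

lemma kint_pos:
  assumes "-1 < a" "-1 < b" "0 \<le> s" "s < s'" "s' \<le> x"
  shows "0 < kint a b s s' x"
  unfolding kint_def by (rule set_integral_pos) (use assms set_integrable_kint in auto)

lemma powr_has_integral: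
  fixes a :: real
  assumes "-1 < a" "0 \<le> s" "s \<le> s'"
  shows "((\<lambda>r::real. r powr a) has_integral (s' powr (1 + a) - s powr (1 + a)) / (1 + a)) {s..s'}"
proof -
  have "((\<lambda>r. r powr a) has_integral (s' powr (1 + a) / (1 + a) - s powr (1 + a) / (1 + a))) {s..s'}"
  proof (rule fundamental_theorem_of_calculus_interior)
    show "continuous_on {s..s'} (\<lambda>x. x powr (1 + a) / (1 + a))"
      using assms by (intro continuous_intros continuous_on_powr') auto
    fix x assume "x \<in> {s<..<s'}"
    then have "((\<lambda>x. x powr (1 + a) / (1 + a)) has_real_derivative x powr a) (at x)"
      using assms by (auto intro!: derivative_eq_intros simp: powr_diff)
    then show "((\<lambda>x. x powr (1 + a) / (1 + a)) has_vector_derivative x powr a) (at x)"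
      by (simp add: has_real_derivative_iff_has_vector_derivative)
  qed (use assms in auto)
  then show ?thesis by (simp add: diff_divide_distrib)
qed

lemma set_integrable_powr:
  fixes a :: real
  assumes "-1 < a" "0 \<le> s"
  shows "set_integrable lborel {s..s'} (\<lambda>r::real. r powr a)"
proof -
  have "set_integrable lborel {s..s'} (\<lambda>r. r powr a * (s' + 1 - r) powr 0)"
    using assms by (intro set_integrable_kint) auto
  also have "?this \<longleftrightarrow> ?thesis"
    by (intro set_integrable_cong) auto
  finally show ?thesis .
qed

lemma set_integral_powr:
  fixes a :: real
  assumes "-1 < a" "0 \<le> s" "s \<le> s'"
  shows "(LBINT r:{s..s'}. r powr a) = (s' powr (1 + a) - s powr (1 + a)) / (1 + a)"
  using set_borel_integral_eq_integral(2)[OF set_integrable_powr] powr_has_integral[OF assms] assms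
  by (simp add: integral_unique)

lemma kint_0_right:
  assumes "-1 < a" "0 \<le> s" "s \<le> s'" "s' \<le> x"
  shows "kint a 0 s s' x = (s' powr (1 + a) - s powr (1 + a)) / (1 + a)"
proof -
  have "kint a 0 s s' x = (LBINT r:{s..s'}. r powr a)"
    unfolding kint_def
  proof (rule set_lebesgue_integral_cong_AE)
    \<comment> \<open>Only almost everywhere: at \<open>r = x\<close> the factor is
      \<open>0 powr 0 = 0\<close> and not 1.\<close>
    show "AE r\<in>{s..s'} in lborel. r powr a * (x - r) powr 0 = r powr a"
      using AE_lborel_singleton[of x] by eventually_elim auto
  qed auto
  then show ?thesis using set_integral_powr assms by simp
qed

lemma kint_0_left:
  assumes "-1 < b" "0 \<le> s" "s \<le> s'" "s' \<le> x"
  shows "kint 0 b s s' x = ((x - s) powr (1 + b) - (x - s') powr (1 + b)) / (1 + b)"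
proof -
  \<comment> \<open>The reflection \<open>r \<mapsto> x - r\<close> moves the singular end of the
    interval to the origin.\<close>
  have "kint 0 b s s' x = \<bar>-1\<bar> *\<^sub>R (LBINT r. indicator {s..s'} (x + (-1) * r) *\<^sub>R
      ((x + (-1) * r) powr 0 * (x - (x + (-1) * r)) powr b))"
    unfolding kint_def set_lebesgue_integral_def
    by (intro lborel_integral_real_affine) auto
  also have "\<dots> = (LBINT r:{x - s'..x - s}. r powr b)"
    unfolding set_lebesgue_integral_def
    by (simp, rule integral_cong_AE, simp, simp)
       (use AE_lborel_singleton[of x] in \<open>eventually_elim, auto simp: indicator_def\<close>)
  also have "\<dots> = ((x - s) powr (1 + b) - (x - s') powr (1 + b)) / (1 + b)"
    using assms by (intro set_integral_powr) auto
  finally show ?thesis .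
qed

text \<open>The common tool for the limits below: a uniform estimate of \<open>\<phi>\<close>
  suffices even where the weight \<open>w\<close> is unbounded, because \<open>w\<close> enters only
  through its integral.\<close>

lemma set_integral_weight_approx:
  fixes w \<phi> :: "real \<Rightarrow> real"
  assumes "set_integrable lborel A w" "set_integrable lborel A (\<lambda>r. w r * \<phi> r)"
    and "\<And>r. r \<in> A \<Longrightarrow> 0 \<le> w r" "\<And>r. r \<in> A \<Longrightarrow> \<bar>\<phi> r - c\<bar> \<le> e"
  shows "\<bar>(LBINT r:A. w r * \<phi> r) - c * (LBINT r:A. w r)\<bar> \<le> e * (LBINT r:A. w r)"
proof -
  have i: "set_integrable lborel A (\<lambda>r. k * w r)" for k using assms(1) by simp
  have "(LBINT r:A. w r * \<phi> r) \<le> (LBINT r:A. (c + e) * w r)"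
    by (rule set_integral_mono[OF assms(2) i]) 
       (use assms(3,4) in \<open>force simp: mult.commute[of "w _"] abs_le_iff intro!: mult_right_mono\<close>)
  moreover have "(LBINT r:A. (c - e) * w r) \<le> (LBINT r:A. w r * \<phi> r)"
    by (rule set_integral_mono[OF i assms(2)]) 
       (use assms(3,4) in \<open>force simp: mult.commute[of "w _"] abs_le_iff intro!: mult_right_mono\<close>)
  ultimately show ?thesis unfolding set_integral_mult_right by (simp add: algebra_simps abs_le_iff)
qed

section \<open>Covariance of weighted fractional Brownian motion and of its increments\<close>

lemma wfbm_cov_commute: "wfbm_cov a b u v = wfbm_cov a b v u"
  by (simp add: wfbm_cov_def min.commute add.commute)

lemma wfbm_cov_kint:
  assumes "-1 < a" "-1 < b" "u \<le> v"
  shows "wfbm_cov a b u v = kint a b 0 u u + kint a b 0 u v"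
  using assms
  by (simp add: wfbm_cov_def kint_def distrib_left set_integral_add set_integrable_kint)

lemma wfbm_cov_diag: "-1 < a \<Longrightarrow> -1 < b \<Longrightarrow> wfbm_cov a b u u = 2 * kint a b 0 u u"
  by (simp add: wfbm_cov_kint)

lemma wfbm_cov_0 [simp]: "0 \<le> v \<Longrightarrow> wfbm_cov a b 0 v = 0" "0 \<le> v \<Longrightarrow> wfbm_cov a b v 0 = 0"
proof -
  have "(LBINT r:{0}. f r) = 0" for f :: "real \<Rightarrow> real"
    using set_integral_discrete_difference[of "{0::real}" "{0}" "{}" lborel f]
    by (simp add: set_lebesgue_integral_def)
  then show "0 \<le> v \<Longrightarrow> wfbm_cov a b 0 v = 0" "0 \<le> v \<Longrightarrow> wfbm_cov a b v 0 = 0"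
    by (auto simp: wfbm_cov_def min_def)
qed

lemma wfbm_cov_scale:
  assumes "-1 < a" "-1 < b" "h > 0" "0 \<le> u" "0 \<le> v"
  shows "wfbm_cov a b (h * u) (h * v) = h powr (1 + a + b) * wfbm_cov a b u v"
proof -
  have *: "wfbm_cov a b (h * u) (h * v) = h powr (1 + a + b) * wfbm_cov a b u v"
    if "0 \<le> u" "u \<le> v" for u v
    using that assms kint_scale[of h 0 u u a b] kint_scale[of h 0 u v a b]
    by (simp add: wfbm_cov_kint algebra_simps)
  show ?thesis using *[of u v] *[of v u] assms by (cases "u \<le> v") (auto simp: wfbm_cov_commute)
qed

lemma wfbm_cov_diag_pos:
  assumes "-1 < a" "-1 < b" "0 < u"
  shows "0 < wfbm_cov a b u u"
  using assms kint_pos[of a b 0 u u] by (simp add: wfbm_cov_diag)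

text \<open>The covariance of the increments over \<open>[s, s']\<close> and \<open>[p, p']\<close>
  of a one-parameter process with covariance \<open>wfbm_cov a b\<close>. The increments of the
  sheet have products of two such terms as covariances.\<close>

definition cov_incr :: "real \<Rightarrow> real \<Rightarrow> real \<Rightarrow> real \<Rightarrow> real \<Rightarrow> real \<Rightarrow> real" where
  "cov_incr a b s s' p p' =
     wfbm_cov a b s' p' - wfbm_cov a b s p' - wfbm_cov a b s' p + wfbm_cov a b s p"

lemma cov_incr_commute: "cov_incr a b s s' p p' = cov_incr a b p p' s s'"
  by (simp add: cov_incr_def wfbm_cov_commute)

text \<open>The diagonal terms \<open>kint a b 0 s s\<close> and \<open>kint a b 0 s' s'\<close> do
  not depend on the later time, so they cancel in the difference between \<open>p'\<close> and
  \<open>p\<close>.\<close>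

lemma cov_incr_disjoint:
  assumes "-1 < a" "-1 < b" "0 \<le> s" "s \<le> s'" "s' \<le> p" "p \<le> p'"
  shows "cov_incr a b s s' p p' = kint a b s s' p' - kint a b s s' p"
  using assms kint_combine[of a b 0 s s' p'] kint_combine[of a b 0 s s' p]
  by (simp add: cov_incr_def wfbm_cov_kint)

lemma cov_incr_disjoint_integral:
  assumes "-1 < a" "-1 < b" "0 \<le> s" "s \<le> s'" "s' \<le> p" "p \<le> p'"
  shows "cov_incr a b s s' p p' =
    (LBINT u:{s..s'}. u powr a * ((p' - u) powr b - (p - u) powr b))"
  using assms
  by (simp add: cov_incr_disjoint kint_def right_diff_distrib set_integral_diff set_integrable_kint)

text \<open>The integrals over \<open>[0, S]\<close> cancel. What remains is the formula for the
  covariance with the integration started at \<open>S\<close> instead of 0.\<close>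

lemma cov_incr_overlap:
  assumes "-1 < a" "-1 < b" "0 \<le> S" "0 \<le> s" "s \<le> s'"
  shows "cov_incr a b S (S + s) S (S + s') = kint a b S (S + s) (S + s) + kint a b S (S + s) (S + s')"
  using assms kint_combine[of a b 0 S "S + s" "S + s"] kint_combine[of a b 0 S "S + s" "S + s'"]
  by (simp add: cov_incr_def wfbm_cov_kint wfbm_cov_commute[of a b "S + s" S])

lemma cov_incr_diag:
  assumes "-1 < a" "-1 < b" "0 \<le> s" "s \<le> s'"
  shows "cov_incr a b s s' s s' = 2 * kint a b s s' s'"
  using cov_incr_overlap[of a b s "s' - s" "s' - s"] assms by simp

text \<open>The sign is that of \<open>(p' - u) powr b - (p - u) powr b\<close>, hence decided by
  the strict monotonicity of the power function; for \<open>b = 0\<close> the integral does not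
  depend on its last argument.\<close>

lemma cov_incr_sign:
  assumes "-1 < a" "-1 < b" "0 \<le> s" "s < s'" "s' \<le> p" "p < p'"
  shows "0 < b \<Longrightarrow> 0 < cov_incr a b s s' p p'"
    and "b = 0 \<Longrightarrow> cov_incr a b s s' p p' = 0"
    and "b < 0 \<Longrightarrow> cov_incr a b s s' p p' < 0"
proof -
  have i: "set_integrable lborel {s..s'} (\<lambda>u. u powr a * ((p' - u) powr b - (p - u) powr b))"
    using assms by (simp add: right_diff_distrib set_integrable_kint)
  show "0 < cov_incr a b s s' p p'" if "0 < b"
    using that assms
    by (subst cov_incr_disjoint_integral) (auto intro!: set_integral_pos i mult_pos_pos simp: powr_less_mono2)
  show "cov_incr a b s s' p p' = 0" if "b = 0"
    using that assms by (simp add: cov_incr_disjoint kint_0_right)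
  show "cov_incr a b s s' p p' < 0" if "b < 0"
  proof -
    have "0 < (LBINT u:{s..s'}. u powr a * ((p - u) powr b - (p' - u) powr b))"
      using that assms
      by (intro set_integral_pos)
         (auto simp: right_diff_distrib set_integrable_kint powr_less_mono2_neg)
    then show ?thesis
      using assms
      by (simp add: cov_incr_disjoint kint_def right_diff_distrib set_integral_diff set_integrable_kint)
  qed
qed

section \<open>Limits of the integrals and of the covariances\<close>

lemma powr_minus_one_le:
  fixes b :: real
  assumes "0 < l" "l \<le> y" "y \<le> u"
  shows "\<bar>y powr b - 1\<bar> \<le> \<bar>l powr b - 1\<bar> + \<bar>u powr b - 1\<bar>"
\<comment> \<open>The power is monotone in \<open>y\<close>, so it lies between its values at
  \<open>l\<close> and \<open>u\<close>; adding the two deviations gives one bound for both signs of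
  \<open>b\<close>.\<close>
proof (cases "b \<ge> 0")
  case True
  then have "l powr b \<le> y powr b" "y powr b \<le> u powr b" using assms by (auto intro!: powr_mono2)
  then show ?thesis by linarith
next
  case False
  then have "l powr b \<ge> y powr b" "y powr b \<ge> u powr b" using assms by (auto intro!: powr_mono2')
  then show ?thesis by linarith
qed

lemma tendsto_powr_quotient_minus_one:
  fixes b c :: real
  shows "((\<lambda>x. \<bar>((x + c) / x) powr b - 1\<bar>) \<longlongrightarrow> 0) at_top"
proof -
  have "((\<lambda>x. (x + c) / x) \<longlongrightarrow> 1) at_top" by real_asymp
  then have "((\<lambda>x. \<bar>((x + c) / x) powr b - 1\<bar>) \<longlongrightarrow> \<bar>1 powr b - 1\<bar>) at_top"
    by (intro tendsto_intros) auto
  then show ?thesis by simp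
qed

text \<open>On a window of fixed length starting at \<open>S\<close>, the factor
  \<open>(r / S) powr a\<close> is uniformly close to 1. The mass of the remaining weight
  \<open>(S + s' - r) powr b\<close> does not depend on \<open>S\<close> and is the limit.\<close>

lemma tendsto_kint_shift:
  assumes "-1 < a" "-1 < b" "0 \<le> s" "s \<le> s'"
  shows "((\<lambda>S. S powr (- a) * kint a b S (S + s) (S + s'))
     \<longlongrightarrow> (s' powr (1 + b) - (s' - s) powr (1 + b)) / (1 + b)) at_top" (is "(_ \<longlongrightarrow> ?W) _")
proof (rule LIM_zero_cancel, rule Lim_null_comparison)
  show "((\<lambda>S. (\<bar>((S + 0) / S) powr a - 1\<bar> + \<bar>((S + s) / S) powr a - 1\<bar>) * ?W) \<longlongrightarrow> 0) at_top"
    by (intro tendsto_mult_left_zero tendsto_add_zero tendsto_powr_quotient_minus_one)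
  show "\<forall>\<^sub>F S in at_top. norm (S powr (- a) * kint a b S (S + s) (S + s') - ?W)
      \<le> (\<bar>((S + 0) / S) powr a - 1\<bar> + \<bar>((S + s) / S) powr a - 1\<bar>) * ?W"
    using eventually_gt_at_top[of 0]
  proof eventually_elim
    case (elim S)
    let ?A = "{S..S + s}"
    \<comment> \<open>Since \<open>r > 0\<close> on the window, \<open>r powr 0 = 1\<close>, and the
      weight is an instance of \<open>kint\<close> with first exponent 0.\<close>
    have w: "set_integrable lborel ?A (\<lambda>r. (S + s' - r) powr b)"
      "(LBINT r:?A. (S + s' - r) powr b) = kint 0 b S (S + s) (S + s')"
    proof -
      have "set_integrable lborel ?A (\<lambda>r. r powr 0 * (S + s' - r) powr b)"
        using assms elim by (intro set_integrable_kint) auto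
      also have "?this \<longleftrightarrow> set_integrable lborel ?A (\<lambda>r. (S + s' - r) powr b)"
        using elim by (intro set_integrable_cong) auto
      finally show "set_integrable lborel ?A (\<lambda>r. (S + s' - r) powr b)" .
      show "(LBINT r:?A. (S + s' - r) powr b) = kint 0 b S (S + s) (S + s')"
        unfolding kint_def using elim by (intro set_lebesgue_integral_cong) auto
    qed
    have W: "kint 0 b S (S + s) (S + s') = ?W" using assms elim by (simp add: kint_0_left)
    have p: "(S + s' - r) powr b * (r / S) powr a = S powr (- a) * (r powr a * (S + s' - r) powr b)"
      if "r \<in> ?A" for r
      using elim that by (auto simp: powr_divide powr_minus field_simps)
    have i: "set_integrable lborel ?A (\<lambda>r. S powr (- a) * (r powr a * (S + s' - r) powr b))"
      using assms elim by (intro set_integrable_mult_right) (auto intro!: set_integrable_kint)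
    have "\<bar>(LBINT r:?A. (S + s' - r) powr b * (r / S) powr a) - 1 * (LBINT r:?A. (S + s' - r) powr b)\<bar>
       \<le> (\<bar>((S + 0) / S) powr a - 1\<bar> + \<bar>((S + s) / S) powr a - 1\<bar>) * (LBINT r:?A. (S + s' - r) powr b)"
    proof (rule set_integral_weight_approx[OF w(1)])
      show "set_integrable lborel ?A (\<lambda>r. (S + s' - r) powr b * (r / S) powr a)"
        using i p by (subst set_integrable_cong[OF refl refl p]) auto
      fix r assume "r \<in> ?A"
      then show "\<bar>(r / S) powr a - 1\<bar> \<le> \<bar>((S + 0) / S) powr a - 1\<bar> + \<bar>((S + s) / S) powr a - 1\<bar>"
        using elim by (intro powr_minus_one_le) (auto simp: field_simps)
    qed auto
    moreover have "(LBINT r:?A. (S + s' - r) powr b * (r / S) powr a) =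
        S powr (- a) * kint a b S (S + s) (S + s')"
      unfolding kint_def set_integral_mult_right[symmetric]
      using p by (intro set_lebesgue_integral_cong) auto
    ultimately show ?case using w W by simp
  qed
qed

text \<open>By the mean value theorem the difference of the two powers is
  \<open>(p' - p) * b * z powr (b - 1)\<close> with \<open>z\<close> of the size of
  \<open>\<tau>\<close>; after normalization only the weight \<open>r powr a\<close> is left to
  integrate.\<close>

lemma tendsto_kint_diff:
  assumes "-1 < a" "-1 < b" "b \<le> 1" "0 \<le> s" "s \<le> s'" "p < p'"
  shows "((\<lambda>\<tau>. \<tau> powr (1 - b) * (kint a b s s' (p' + \<tau>) - kint a b s s' (p + \<tau>)))
     \<longlongrightarrow> b * (p' - p) * ((s' powr (1 + a) - s powr (1 + a)) / (1 + a))) at_top" (is "(_ \<longlongrightarrow> ?c * ?W) _")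
proof (rule LIM_zero_cancel, rule Lim_null_comparison)
  \<comment> \<open>For every \<open>r\<close> in \<open>{s..s'}\<close> the intermediate point
    \<open>z\<close> lies between \<open>\<tau> + (p - s')\<close> and \<open>\<tau> + p'\<close>,
    the upper end because \<open>0 \<le> s\<close>. The bound thus does not depend on
    \<open>r\<close>.\<close>
  let ?e = "\<lambda>\<tau>. \<bar>?c\<bar> * (\<bar>((\<tau> + (p - s')) / \<tau>) powr (b - 1) - 1\<bar> + \<bar>((\<tau> + p') / \<tau>) powr (b - 1) - 1\<bar>)"
  show "((\<lambda>\<tau>. ?e \<tau> * ?W) \<longlongrightarrow> 0) at_top"
    by (intro tendsto_mult_left_zero tendsto_mult_right_zero tendsto_add_zero
        tendsto_powr_quotient_minus_one)
  show "\<forall>\<^sub>F \<tau> in at_top. norm (\<tau> powr (1 - b) * (kint a b s s' (p' + \<tau>) - kint a b s s' (p + \<tau>)) - ?c * ?W)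
      \<le> ?e \<tau> * ?W"
    using eventually_gt_at_top[of "max 0 (s' - p)"]
  proof eventually_elim
    case (elim \<tau>)
    let ?A = "{s..s'}"
    let ?\<phi> = "\<lambda>r. \<tau> powr (1 - b) * ((p' + \<tau> - r) powr b - (p + \<tau> - r) powr b)"
    have i: "set_integrable lborel ?A (\<lambda>r. r powr a * (p' + \<tau> - r) powr b)"
      "set_integrable lborel ?A (\<lambda>r. r powr a * (p + \<tau> - r) powr b)"
      using assms elim by (auto intro!: set_integrable_kint)
    have p: "r powr a * ?\<phi> r = \<tau> powr (1 - b) * (r powr a * (p' + \<tau> - r) powr b - r powr a * (p + \<tau> - r) powr b)"
      for r by (simp add: algebra_simps)
    have "\<bar>(LBINT r:?A. r powr a * ?\<phi> r) - ?c * (LBINT r:?A. r powr a)\<bar> \<le> ?e \<tau> * (LBINT r:?A. r powr a)"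
    proof (rule set_integral_weight_approx)
      show "set_integrable lborel ?A (\<lambda>r. r powr a)" using assms by (intro set_integrable_powr)
      show "set_integrable lborel ?A (\<lambda>r. r powr a * ?\<phi> r)"
        unfolding p using i by (intro set_integrable_mult_right set_integral_diff)
      fix r assume r: "r \<in> ?A"
      define y where "y = p + \<tau> - r"
      have "y > 0" using r elim by (simp add: y_def)
      have "\<exists>z>y. z < y + (p' - p) \<and>
          (y + (p' - p)) powr b - y powr b = (y + (p' - p) - y) * (b * z powr (b - 1))"
        using \<open>y > 0\<close> \<open>p < p'\<close>
        by (intro MVT2[of y "y + (p' - p)" "\<lambda>z. z powr b"]) (auto intro!: derivative_eq_intros)
      then obtain z where z: "z > y" "z < y + (p' - p)"
        "(y + (p' - p)) powr b - y powr b = (p' - p) * (b * z powr (b - 1))" by auto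
      have "?\<phi> r = ?c * (z / \<tau>) powr (b - 1)"
        using z(3) elim \<open>y > 0\<close> z(1)
        by (simp add: y_def powr_divide powr_diff algebra_simps) (simp add: field_simps)
      then have "\<bar>?\<phi> r - ?c\<bar> = \<bar>?c\<bar> * \<bar>(z / \<tau>) powr (b - 1) - 1\<bar>"
        by (simp add: abs_mult[symmetric] algebra_simps)
      also have "\<dots> \<le> ?e \<tau>"
        using elim z r \<open>y > 0\<close> assms
        by (intro mult_left_mono powr_minus_one_le) (auto simp: y_def divide_right_mono)
      finally show "\<bar>?\<phi> r - ?c\<bar> \<le> ?e \<tau>" .
    qed auto
    moreover have "(LBINT r:?A. r powr a * ?\<phi> r) =
        \<tau> powr (1 - b) * (kint a b s s' (p' + \<tau>) - kint a b s s' (p + \<tau>))"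
      unfolding p set_integral_mult_right using i by (simp add: kint_def set_integral_diff)
    ultimately show ?case using set_integral_powr[of a s s'] assms by simp
  qed
qed

text \<open>Here \<open>r powr a\<close> is the weight, and \<open>((t + x - r) / x) powr b\<close>
  tends to 1 uniformly for \<open>r\<close> in \<open>{0..v}\<close>.\<close>

lemma tendsto_kint_far:
  assumes "-1 < a" "-1 < b" "0 \<le> v"
  shows "((\<lambda>x. x powr (- b) * kint a b 0 v (t + x)) \<longlongrightarrow> v powr (1 + a) / (1 + a)) at_top"
    (is "(_ \<longlongrightarrow> ?W) _")
proof (rule LIM_zero_cancel, rule Lim_null_comparison)
  let ?e = "\<lambda>x. (\<bar>((x + (t - v)) / x) powr b - 1\<bar> + \<bar>((x + t) / x) powr b - 1\<bar>)"
  show "((\<lambda>x. ?e x * ?W) \<longlongrightarrow> 0) at_top"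
    by (intro tendsto_mult_left_zero tendsto_add_zero tendsto_powr_quotient_minus_one)
  show "\<forall>\<^sub>F x in at_top. norm (x powr (- b) * kint a b 0 v (t + x) - ?W) \<le> ?e x * ?W"
    using eventually_gt_at_top[of "max 0 (v - t)"]
  proof eventually_elim
    case (elim x)
    let ?A = "{0..v}"
    have i: "set_integrable lborel ?A (\<lambda>r. r powr a * (t + x - r) powr b)"
      using assms elim by (auto intro!: set_integrable_kint)
    have p: "r powr a * ((t + x - r) / x) powr b = x powr (- b) * (r powr a * (t + x - r) powr b)"
      if "r \<in> ?A" for r
      using that elim by (auto simp: powr_divide powr_minus field_simps)
    have "\<bar>(LBINT r:?A. r powr a * ((t + x - r) / x) powr b) - 1 * (LBINT r:?A. r powr a)\<bar> \<le> ?e x * (LBINT r:?A. r powr a)"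
    proof (rule set_integral_weight_approx)
      show "set_integrable lborel ?A (\<lambda>r. r powr a)" using assms by (intro set_integrable_powr) auto
      show "set_integrable lborel ?A (\<lambda>r. r powr a * ((t + x - r) / x) powr b)"
        using i by (subst set_integrable_cong[OF refl refl p]) (auto intro!: set_integrable_mult_right)
      fix r assume r: "r \<in> ?A"
      then show "\<bar>((t + x - r) / x) powr b - 1\<bar> \<le> ?e x"
        using elim by (intro powr_minus_one_le) (auto intro!: divide_right_mono)
    qed auto
    moreover have "(LBINT r:?A. r powr a * ((t + x - r) / x) powr b) = x powr (- b) * kint a b 0 v (t + x)"
      unfolding kint_def set_integral_mult_right[symmetric]
      using p by (intro set_lebesgue_integral_cong) auto
    ultimately show ?case using set_integral_powr[of a 0 v] assms by simp
  qed
qed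

text \<open>Scaling by \<open>\<epsilon>\<close> turns the short interval at \<open>s\<close> into a
  unit interval at \<open>s / \<epsilon>\<close>, which tends to infinity. So this is
  \<open>tendsto_kint_shift\<close> with both lengths equal to 1.\<close>

lemma tendsto_kint_short:
  assumes "-1 < a" "-1 < b" "0 < s"
  shows "((\<lambda>\<epsilon>. \<epsilon> powr (- b - 1) * kint a b s (s + \<epsilon>) (s + \<epsilon>)) \<longlongrightarrow> s powr a / (1 + b)) (at_right 0)"
proof -
  have "filterlim (\<lambda>\<epsilon>. s / \<epsilon>) at_top (at_right 0)"
    using assms by real_asymp
  then have "((\<lambda>\<epsilon>. s powr a * ((s / \<epsilon>) powr (- a) * kint a b (s / \<epsilon>) (s / \<epsilon> + 1) (s / \<epsilon> + 1)))
      \<longlongrightarrow> s powr a * ((1 powr (1 + b) - (1 - 1) powr (1 + b)) / (1 + b))) (at_right 0)"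
    using assms by (intro tendsto_mult tendsto_const filterlim_compose[OF tendsto_kint_shift]) auto
  also have "s powr a * ((1 powr (1 + b) - (1 - 1) powr (1 + b)) / (1 + b)) = s powr a / (1 + b)"
    by simp
  finally show ?thesis
  proof (rule Lim_transform_eventually)
    show "\<forall>\<^sub>F \<epsilon> in at_right 0.
      s powr a * ((s / \<epsilon>) powr (- a) * kint a b (s / \<epsilon>) (s / \<epsilon> + 1) (s / \<epsilon> + 1)) =
      \<epsilon> powr (- b - 1) * kint a b s (s + \<epsilon>) (s + \<epsilon>)"
      using eventually_at_right_less[of 0]
    proof eventually_elim
      case (elim \<epsilon>)
      have "\<epsilon> * (s / \<epsilon>) = s" "\<epsilon> * (s / \<epsilon> + 1) = s + \<epsilon>" using elim by (auto simp: field_simps)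
      then have k: "kint a b s (s + \<epsilon>) (s + \<epsilon>) = \<epsilon> powr (1 + a + b) * kint a b (s / \<epsilon>) (s / \<epsilon> + 1) (s / \<epsilon> + 1)"
        using kint_scale[of \<epsilon> "s / \<epsilon>" "s / \<epsilon> + 1" "s / \<epsilon> + 1" a b] elim assms by simp
      have "\<epsilon> powr (- b - 1) * \<epsilon> powr (1 + a + b) = s powr a * (s / \<epsilon>) powr (- a)"
        using elim assms by (simp add: powr_divide powr_minus powr_add[symmetric] field_simps)
      then show ?case unfolding k by (simp add: mult.assoc[symmetric])
    qed
  qed
qed

text \<open>The integral over \<open>[s, s + S]\<close> is the one over \<open>[0, s + S]\<close>,
  known exactly by homogeneity, minus the one over \<open>[0, s]\<close>. The latter is of order
  \<open>S powr b\<close>, smaller than the normalization by the factor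
  \<open>S powr (1 + a)\<close>.\<close>

lemma tendsto_kint_long:
  assumes "-1 < a" "-1 < b" "0 \<le> s"
  shows "((\<lambda>S. S powr (- (1 + a + b)) * kint a b s (s + S) (s + S)) \<longlongrightarrow> kint a b 0 1 1) at_top"
proof -
  have "((\<lambda>S. ((s + S) / S) powr (1 + a + b) * kint a b 0 1 1 - S powr (- (1 + a)) * (S powr (- b) * kint a b 0 s (s + S)))
      \<longlongrightarrow> 1 * kint a b 0 1 1 - 0 * (s powr (1 + a) / (1 + a))) at_top"
  proof (intro tendsto_diff tendsto_mult tendsto_const tendsto_kint_far)
    show "((\<lambda>S. ((s + S) / S) powr (1 + a + b)) \<longlongrightarrow> 1) at_top" by real_asymp
    show "((\<lambda>S. S powr (- (1 + a))) \<longlongrightarrow> 0) at_top"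
      using assms by (intro tendsto_neg_powr filterlim_ident) auto
  qed (use assms in auto)
  then have "((\<lambda>S. ((s + S) / S) powr (1 + a + b) * kint a b 0 1 1 - S powr (- (1 + a)) * (S powr (- b) * kint a b 0 s (s + S)))
      \<longlongrightarrow> kint a b 0 1 1) at_top" by simp
  then show ?thesis
  proof (rule Lim_transform_eventually)
    show "\<forall>\<^sub>F S in at_top. ((s + S) / S) powr (1 + a + b) * kint a b 0 1 1
        - S powr (- (1 + a)) * (S powr (- b) * kint a b 0 s (s + S)) =
        S powr (- (1 + a + b)) * kint a b s (s + S) (s + S)"
      using eventually_gt_at_top[of 0]
    proof eventually_elim
      case (elim S)
      have "kint a b 0 (s + S) (s + S) = (s + S) powr (1 + a + b) * kint a b 0 1 1"
        using kint_scale[of "s + S" 0 1 1 a b] elim assms by simp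
      moreover have "kint a b 0 (s + S) (s + S) = kint a b 0 s (s + S) + kint a b s (s + S) (s + S)"
        using elim assms by (intro kint_combine) auto
      ultimately have k: "kint a b s (s + S) (s + S) = (s + S) powr (1 + a + b) * kint a b 0 1 1 - kint a b 0 s (s + S)"
        by simp
      have 1: "((s + S) / S) powr g = S powr (- g) * (s + S) powr g" for g
        using elim assms by (subst powr_divide) (auto simp: powr_minus field_simps)
      have 2: "S powr (- (1 + a)) * S powr (- b) = S powr (- (1 + a + b))"
        by (simp add: powr_add[symmetric])
      show ?case unfolding k 1 mult.assoc[symmetric] 2 by (simp add: algebra_simps)
    qed
  qed
qed

text \<open>Far from the origin the weight \<open>r powr a\<close> is nearly the constant
  \<open>S powr a\<close> over the window, and an unweighted process has the increments of
  fractional Brownian motion with \<open>2 * H = 1 + b\<close>. The two integrals of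
  \<open>cov_incr_overlap\<close> supply \<open>s powr (1 + b)\<close> and
  \<open>s' powr (1 + b) - (s' - s) powr (1 + b)\<close>.\<close>

lemma tendsto_cov_incr_shift:
  assumes "-1 < a" "-1 < b" "0 \<le> s" "0 \<le> s'"
  shows "((\<lambda>S. S powr (- a) * cov_incr a b S (S + s) S (S + s'))
     \<longlongrightarrow> 2 / (1 + b) * fBm_cov ((1 + b) / 2) s s') at_top"
proof -
  have *: "((\<lambda>S. S powr (- a) * cov_incr a b S (S + s) S (S + s'))
     \<longlongrightarrow> 2 / (1 + b) * fBm_cov ((1 + b) / 2) s s') at_top" if "0 \<le> s" "s \<le> s'" for s s'
  proof -
    have "((\<lambda>S. S powr (- a) * kint a b S (S + s) (S + s) + S powr (- a) * kint a b S (S + s) (S + s'))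
        \<longlongrightarrow> (s powr (1 + b) - (s - s) powr (1 + b)) / (1 + b) +
           (s' powr (1 + b) - (s' - s) powr (1 + b)) / (1 + b)) at_top"
      using that assms by (intro tendsto_add tendsto_kint_shift) auto
    moreover have "(s powr (1 + b) - (s - s) powr (1 + b)) / (1 + b) +
           (s' powr (1 + b) - (s' - s) powr (1 + b)) / (1 + b) = 2 / (1 + b) * fBm_cov ((1 + b) / 2) s s'"
      proof -
      have e: "2 * ((1 + b) / 2) = 1 + b" by simp
      have "x / (1 + b) + (y - z) / (1 + b) = 2 / (1 + b) * ((x + y - z) / 2)" for x y z
      proof -
        have d: "2 / d * (w / 2) = w / d" for d w :: real by simp
        show ?thesis unfolding d by (simp add: add_divide_distrib diff_divide_distrib)
      qed
      then show ?thesis using that assms unfolding fBm_cov_def e by simp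
    qed
    ultimately have "((\<lambda>S. S powr (- a) * kint a b S (S + s) (S + s) + S powr (- a) * kint a b S (S + s) (S + s'))
        \<longlongrightarrow> 2 / (1 + b) * fBm_cov ((1 + b) / 2) s s') at_top" by simp
    then show ?thesis
    proof (rule Lim_transform_eventually)
      show "\<forall>\<^sub>F S in at_top. S powr (- a) * kint a b S (S + s) (S + s) + S powr (- a) * kint a b S (S + s) (S + s') =
         S powr (- a) * cov_incr a b S (S + s) S (S + s')"
        using eventually_ge_at_top[of 0]
        by eventually_elim (use that assms in \<open>simp add: cov_incr_overlap distrib_left\<close>)
    qed
  qed
  have sym: "fBm_cov H s s' = fBm_cov H s' s" for H
    by (simp add: fBm_cov_def abs_minus_commute)
  show ?thesis
    using *[of s s'] *[of s' s] assms sym by (cases "s \<le> s'") (auto simp: cov_incr_commute)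
qed

lemma cov_incr_0_left_shift:
  assumes "-1 < b" "0 \<le> h" "0 \<le> s" "0 \<le> s'"
  shows "cov_incr 0 b h (h + s) h (h + s') = cov_incr 0 b 0 s 0 s'"
proof -
  have *: "cov_incr 0 b h (h + s) h (h + s') = cov_incr 0 b 0 s 0 s'" if "0 \<le> s" "s \<le> s'" for s s'
    using cov_incr_overlap[of 0 b h s s'] cov_incr_overlap[of 0 b 0 s s'] that assms
    by (simp add: kint_0_left)
  show ?thesis
    using *[of s s'] *[of s' s] assms by (cases "s \<le> s'") (auto simp: cov_incr_commute)
qed

text \<open>Under invariance, one and the same function of \<open>\<epsilon>\<close> has the
  short-increment limit \<open>h powr a / (1 + b)\<close> for every \<open>h > 0\<close>; comparing
  \<open>h = 1\<close> with \<open>h = 2\<close> gives \<open>2 powr a = 1\<close>.\<close>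

lemma kint_shift_invariant_imp:
  assumes "-1 < a" "-1 < b"
    and inv: "\<And>h s. 0 \<le> h \<Longrightarrow> 0 < s \<Longrightarrow> kint a b h (h + s) (h + s) = kint a b 0 s s"
  shows "a = 0"
proof -
  have lim: "((\<lambda>\<epsilon>. \<epsilon> powr (- b - 1) * kint a b 0 \<epsilon> \<epsilon>) \<longlongrightarrow> h powr a / (1 + b)) (at_right 0)" if "0 < h" for h
    using tendsto_kint_short[OF assms(1,2) that]
    by (rule Lim_transform_eventually)
       (use eventually_at_right_less[of 0] in \<open>eventually_elim, use inv that in simp\<close>)
  have "1 powr a / (1 + b) = 2 powr a / (1 + b)"
    by (rule tendsto_unique[OF _ lim lim]) auto
  then have "2 powr a = (1::real)" using assms by simp
  then show ?thesis by (simp add: powr_def)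
qed

lemma wfbm_cov_diff_far:
  assumes "-1 < a" "-1 < b" "0 \<le> v" "v \<le> x" "v \<le> y"
  shows "wfbm_cov a b v y - wfbm_cov a b v x = kint a b 0 v y - kint a b 0 v x"
  using assms by (simp add: wfbm_cov_kint)

lemma tendsto_wfbm_cov_diff:
  assumes "-1 < a" "-1 < b" "b \<le> 1" "0 \<le> v" "s < t"
  shows "((\<lambda>\<tau>. \<tau> powr (1 - b) * (wfbm_cov a b v (t + \<tau>) - wfbm_cov a b v (s + \<tau>)))
     \<longlongrightarrow> b * (t - s) * (v powr (1 + a) / (1 + a))) at_top"
proof -
  have "((\<lambda>\<tau>. \<tau> powr (1 - b) * (kint a b 0 v (t + \<tau>) - kint a b 0 v (s + \<tau>)))
     \<longlongrightarrow> b * (t - s) * (v powr (1 + a) / (1 + a))) at_top"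
    using tendsto_kint_diff[of a b 0 v s t] assms by simp
  then show ?thesis
  proof (rule Lim_transform_eventually)
    show "\<forall>\<^sub>F \<tau> in at_top. \<tau> powr (1 - b) * (kint a b 0 v (t + \<tau>) - kint a b 0 v (s + \<tau>)) =
      \<tau> powr (1 - b) * (wfbm_cov a b v (t + \<tau>) - wfbm_cov a b v (s + \<tau>))"
      using eventually_ge_at_top[of "max (v - s) (v - t)"]
      by eventually_elim (use assms in \<open>subst wfbm_cov_diff_far, auto\<close>)
  qed
qed

text \<open>The part \<open>kint a b 0 v v\<close> is constant in \<open>x\<close>. It disappears
  under the normalization for \<open>b > 0\<close>, while for \<open>b = 0\<close> it equals the
  other part and doubles the limit.\<close>

lemma tendsto_wfbm_cov_far:
  assumes "-1 < a" "0 \<le> b" "0 \<le> v"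
  shows "((\<lambda>x. x powr (- b) * wfbm_cov a b v (t + x))
     \<longlongrightarrow> (if b = 0 then 2 else 1) * (v powr (1 + a) / (1 + a))) at_top"
proof -
  have "((\<lambda>x::real. x powr (- b)) \<longlongrightarrow> (if b = 0 then 1 else 0)) at_top"
  proof (cases "b = 0")
    case True
    have "((\<lambda>x::real. 1::real) \<longlongrightarrow> 1) at_top" by simp
    then show ?thesis using True
      by (auto intro: Lim_transform_eventually eventually_mono[OF eventually_gt_at_top[of 0]])
  next
    case False
    then show ?thesis using assms by (auto intro!: tendsto_neg_powr filterlim_ident)
  qed
  then have "((\<lambda>x. x powr (- b) * kint a b 0 v v + x powr (- b) * kint a b 0 v (t + x))
     \<longlongrightarrow> (if b = 0 then 1 else 0) * kint a b 0 v v + v powr (1 + a) / (1 + a)) at_top"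
    using assms by (intro tendsto_add tendsto_mult tendsto_const tendsto_kint_far) auto
  moreover have "(if b = 0 then 1 else 0) * kint a b 0 v v + v powr (1 + a) / (1 + a) =
      (if b = 0 then 2 else 1) * (v powr (1 + a) / (1 + a))"
    using assms by (auto simp: kint_0_right)
  ultimately have "((\<lambda>x. x powr (- b) * kint a b 0 v v + x powr (- b) * kint a b 0 v (t + x))
     \<longlongrightarrow> (if b = 0 then 2 else 1) * (v powr (1 + a) / (1 + a))) at_top" by simp
  then show ?thesis
  proof (rule Lim_transform_eventually)
    show "\<forall>\<^sub>F x in at_top. x powr (- b) * kint a b 0 v v + x powr (- b) * kint a b 0 v (t + x) =
        x powr (- b) * wfbm_cov a b v (t + x)"
      using eventually_ge_at_top[of "v - t"]
      by eventually_elim (use assms in \<open>simp add: wfbm_cov_kint distrib_left\<close>)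
  qed
qed

text \<open>The product rule for differences splits the expression into a term with coefficient
  \<open>b1\<close> and one with coefficient \<open>b2\<close>. If, say, \<open>b2 = 0\<close>, the
  second term vanishes and the doubled limit of the second covariance multiplies all that is left;
  hence a single factor 2 in front.\<close>

lemma tendsto_wfbm_cov_prod_diff:
  assumes "-1 < a1" "0 \<le> b1" "b1 \<le> 1" "-1 < a2" "0 \<le> b2" "b2 \<le> 1" "\<not> (b1 = 0 \<and> b2 = 0)" "0 \<le> v" "s < t"
  shows "((\<lambda>\<tau>. \<tau> powr (1 - (b1 + b2)) *
      (wfbm_cov a1 b1 v (t + \<tau>) * wfbm_cov a2 b2 v (t + \<tau>) - wfbm_cov a1 b1 v (s + \<tau>) * wfbm_cov a2 b2 v (s + \<tau>)))
     \<longlongrightarrow> (if b1 = 0 \<or> b2 = 0 then 2 else 1) *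
       ((b1 + b2) / ((1 + a1) * (1 + a2)) * v powr (2 + a1 + a2) * (t - s))) at_top"
proof -
  let ?C1 = "wfbm_cov a1 b1 v" and ?C2 = "wfbm_cov a2 b2 v"
  have "((\<lambda>\<tau>. (\<tau> powr (1 - b1) * (?C1 (t + \<tau>) - ?C1 (s + \<tau>))) * (\<tau> powr (- b2) * ?C2 (t + \<tau>)) +
              (\<tau> powr (- b1) * ?C1 (s + \<tau>)) * (\<tau> powr (1 - b2) * (?C2 (t + \<tau>) - ?C2 (s + \<tau>))))
     \<longlongrightarrow> (b1 * (t - s) * (v powr (1 + a1) / (1 + a1))) *
         ((if b2 = 0 then 2 else 1) * (v powr (1 + a2) / (1 + a2))) +
         ((if b1 = 0 then 2 else 1) * (v powr (1 + a1) / (1 + a1))) *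
         (b2 * (t - s) * (v powr (1 + a2) / (1 + a2)))) at_top"
    using assms by (intro tendsto_add tendsto_mult tendsto_wfbm_cov_diff tendsto_wfbm_cov_far) auto
  moreover have "(b1 * (t - s) * (v powr (1 + a1) / (1 + a1))) *
         ((if b2 = 0 then 2 else 1) * (v powr (1 + a2) / (1 + a2))) +
         ((if b1 = 0 then 2 else 1) * (v powr (1 + a1) / (1 + a1))) *
         (b2 * (t - s) * (v powr (1 + a2) / (1 + a2))) =
      (if b1 = 0 \<or> b2 = 0 then 2 else 1) *
       ((b1 + b2) / ((1 + a1) * (1 + a2)) * v powr (2 + a1 + a2) * (t - s))"
  proof -
    define X1 X2 where "X1 = v powr (1 + a1) / (1 + a1)" "X2 = v powr (1 + a2) / (1 + a2)"
    have "v powr (2 + a1 + a2) = v powr (1 + a1) * v powr (1 + a2)"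
      by (simp add: powr_add[symmetric] add.assoc)
    then have X: "(b1 + b2) / ((1 + a1) * (1 + a2)) * v powr (2 + a1 + a2) * (t - s) = (b1 + b2) * (X1 * X2) * (t - s)"
      by (simp add: X1_X2_def mult_ac)
    show ?thesis using assms unfolding X X1_X2_def[symmetric] by (auto simp: algebra_simps)
  qed
  ultimately have "((\<lambda>\<tau>. (\<tau> powr (1 - b1) * (?C1 (t + \<tau>) - ?C1 (s + \<tau>))) * (\<tau> powr (- b2) * ?C2 (t + \<tau>)) +
              (\<tau> powr (- b1) * ?C1 (s + \<tau>)) * (\<tau> powr (1 - b2) * (?C2 (t + \<tau>) - ?C2 (s + \<tau>))))
     \<longlongrightarrow> (if b1 = 0 \<or> b2 = 0 then 2 else 1) *
       ((b1 + b2) / ((1 + a1) * (1 + a2)) * v powr (2 + a1 + a2) * (t - s))) at_top" by simp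
  then show ?thesis
  proof (rule Lim_transform_eventually, intro always_eventually allI)
    fix \<tau> :: real
    have 1: "\<tau> powr (1 - (b1 + b2)) = \<tau> powr (1 - b1) * \<tau> powr (- b2)"
      and 2: "\<tau> powr (1 - b1) * \<tau> powr (- b2) = \<tau> powr (- b1) * \<tau> powr (1 - b2)"
      by (simp_all add: powr_add[symmetric] algebra_simps)
    have "(\<tau> powr (1 - b1) * (?C1 (t + \<tau>) - ?C1 (s + \<tau>))) * (\<tau> powr (- b2) * ?C2 (t + \<tau>)) +
              (\<tau> powr (- b1) * ?C1 (s + \<tau>)) * (\<tau> powr (1 - b2) * (?C2 (t + \<tau>) - ?C2 (s + \<tau>))) =
       (\<tau> powr (1 - b1) * \<tau> powr (- b2)) * ((?C1 (t + \<tau>) - ?C1 (s + \<tau>)) * ?C2 (t + \<tau>)) +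
       (\<tau> powr (- b1) * \<tau> powr (1 - b2)) * (?C1 (s + \<tau>) * (?C2 (t + \<tau>) - ?C2 (s + \<tau>)))"
      by (simp add: mult_ac)
    also have "\<dots> = \<tau> powr (1 - (b1 + b2)) *
      (?C1 (t + \<tau>) * ?C2 (t + \<tau>) - ?C1 (s + \<tau>) * ?C2 (s + \<tau>))"
      unfolding 2[symmetric] 1 by (simp add: algebra_simps)
    finally show "(\<tau> powr (1 - b1) * (?C1 (t + \<tau>) - ?C1 (s + \<tau>))) * (\<tau> powr (- b2) * ?C2 (t + \<tau>)) +
              (\<tau> powr (- b1) * ?C1 (s + \<tau>)) * (\<tau> powr (1 - b2) * (?C2 (t + \<tau>) - ?C2 (s + \<tau>))) = \<tau> powr (1 - (b1 + b2)) *
      (?C1 (t + \<tau>) * ?C2 (t + \<tau>) - ?C1 (s + \<tau>) * ?C2 (s + \<tau>))" .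
  qed
qed

section \<open>Covariances that do not factorize\<close>

lemma powr_tendsto_pos_at_top:
  fixes c l :: real
  assumes "((\<lambda>x. x powr c) \<longlongrightarrow> l) at_top" "0 < l"
  shows "c = 0" "l = 1"
proof -
  show "c = 0"
  proof (rule ccontr)
    assume "c \<noteq> 0"
    then consider "c > 0" | "c < 0" by linarith
    then show False
    proof cases
      case 1
      then have "filterlim (\<lambda>x::real. x powr c) at_top at_top" by real_asymp
      then show False using assms(1) not_tendsto_and_filterlim_at_infinity[of at_top "\<lambda>x. x powr c" l]
        by (auto intro: filterlim_at_top_imp_at_infinity)
    next
      case 2
      then have "((\<lambda>x::real. x powr c) \<longlongrightarrow> 0) at_top" by real_asymp
      then show False using assms tendsto_unique[OF _ assms(1), of 0] by auto
    qed
  qed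
  then have "((\<lambda>x::real. x powr c) \<longlongrightarrow> 1) at_top"
    using eventually_gt_at_top[of "0::real"] by (intro tendsto_eventually) (auto elim: eventually_mono)
  then show "l = 1" using tendsto_unique[OF _ assms(1)] by auto
qed

text \<open>The densities \<open>(1 + a) r powr a\<close> and \<open>(1 + a') r powr a'\<close> cross exactly once, at \<open>r0\<close>;
  subtracting the value of the monotone factor at \<open>r0\<close> makes the integrand of constant sign.\<close>

lemma kint_normalized_inj:
  assumes "-1 < a" "a < a'" "-1 < b" "b \<noteq> 0"
  shows "(1 + a) * kint a b 0 1 1 \<noteq> (1 + a') * kint a' b 0 1 1"
proof
  assume eq: "(1 + a) * kint a b 0 1 1 = (1 + a') * kint a' b 0 1 1"
  \<comment> \<open>The two densities agree exactly where \<open>r powr (a' - a) = q\<close>, that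
    is, at \<open>r0\<close>.\<close>
  define q where "q = (1 + a) / (1 + a')"
  define r0 where "r0 = q powr (1 / (a' - a))"
  have q: "0 < q" "q < 1" using assms by (auto simp: q_def)
  have r0: "r0 > 0" "r0 < 1" "r0 powr (a' - a) = q"
    using q assms powr_less_mono2[of "1 / (a' - a)" q 1] by (auto simp: r0_def powr_powr)
  define h where "h = (\<lambda>r::real. (1 + a') * r powr a' - (1 + a) * r powr a)"
  have h: "h r = (1 + a') * r powr a * (r powr (a' - a) - r0 powr (a' - a))" if "r > 0" for r
    using that assms r0 by (simp add: h_def q_def powr_diff right_diff_distrib)
  have hneg: "h r < 0" if "0 < r" "r < r0" for r
    using that assms r0 powr_less_mono2[of "a' - a" r r0] by (simp add: h mult_pos_neg)
  have hpos: "h r > 0" if "r0 < r" for r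
    using that assms r0 powr_less_mono2[of "a' - a" r0 r] by (simp add: h)
  have i: "set_integrable lborel {0..1} (\<lambda>r. r powr a * (1 - r) powr b)"
    "set_integrable lborel {0..1} (\<lambda>r. r powr a' * (1 - r) powr b)"
    "set_integrable lborel {0..1} (\<lambda>r. r powr a)"
    "set_integrable lborel {0..1} (\<lambda>r. r powr a')"
    using assms by (auto intro!: set_integrable_kint set_integrable_powr)
  have F: "h r * ((1 - r) powr b - (1 - r0) powr b) =
      ((1 + a') * (r powr a' * (1 - r) powr b) - (1 + a) * (r powr a * (1 - r) powr b)) -
      (1 - r0) powr b * ((1 + a') * r powr a' - (1 + a) * r powr a)" for r
    by (simp add: h_def algebra_simps)
  have Fi: "set_integrable lborel {0..1} (\<lambda>r. h r * ((1 - r) powr b - (1 - r0) powr b))"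
    unfolding F using i by (intro set_integral_diff set_integrable_mult_right) auto
  \<comment> \<open>Both densities have mass 1, so subtracting the constant
    \<open>(1 - r0) powr b\<close> does not change the integral, which is zero by the assumed
    equality.\<close>
  have F0: "(LBINT r:{0..1}. h r * ((1 - r) powr b - (1 - r0) powr b)) = 0"
  proof -
    have "(LBINT r:{0..1}. (1 + a') * (r powr a' * (1 - r) powr b) - (1 + a) * (r powr a * (1 - r) powr b)) = 0"
      using i eq by (subst set_integral_diff) (auto simp: kint_def)
    moreover have "(LBINT r:{0..1}. (1 + a') * r powr a' - (1 + a) * r powr a) = 0"
      using i assms by (subst set_integral_diff) (auto simp: set_integral_powr)
    moreover have "set_integrable lborel {0..1} (\<lambda>r. (1 + a') * (r powr a' * (1 - r) powr b) - (1 + a) * (r powr a * (1 - r) powr b))"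
      "set_integrable lborel {0..1} (\<lambda>r. (1 - r0) powr b * ((1 + a') * r powr a' - (1 + a) * r powr a))"
      using i by (intro set_integral_diff set_integrable_mult_right; simp)+
    ultimately show ?thesis unfolding F by (subst set_integral_diff(2)) (simp_all only: set_integral_mult_right)
  qed
  show False
  \<comment> \<open>The factor \<open>h\<close> changes from negative to positive at
    \<open>r0\<close>, and \<open>(1 - r) powr b\<close> is decreasing for \<open>b > 0\<close> and
    increasing for \<open>b < 0\<close>. The product is thus negative in the first case and positive
    in the second, except at \<open>r0\<close>.\<close>
  proof (cases "b > 0")
    case True
    have "0 < (LBINT r:{0..1}. (-1) * (h r * ((1 - r) powr b - (1 - r0) powr b)))"
    proof (rule set_integral_pos[where c = r0])
      show "set_integrable lborel {0..1} (\<lambda>r. (-1) * (h r * ((1 - r) powr b - (1 - r0) powr b)))"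
        using Fi by (rule set_integrable_mult_right)
      fix r :: real assume r: "0 < r" "r < 1" "r \<noteq> r0"
      show "0 < (-1) * (h r * ((1 - r) powr b - (1 - r0) powr b))"
      proof (cases "r < r0")
        case c: True
        then have "(1 - r0) powr b < (1 - r) powr b" using r r0 True by (intro powr_less_mono2) auto
        then show ?thesis using hneg[of r] r c by (simp add: mult_neg_pos)
      next
        case False
        then have "(1 - r) powr b < (1 - r0) powr b" using r r0 True by (intro powr_less_mono2) auto
        then show ?thesis using hpos[of r] r False by (simp add: mult_pos_neg)
      qed
    qed auto
    then show False unfolding set_integral_mult_right using F0 by simp
  next
    case b: False
    have "0 < (LBINT r:{0..1}. h r * ((1 - r) powr b - (1 - r0) powr b))"
    proof (rule set_integral_pos[OF Fi, where c = r0])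
      fix r :: real assume r: "0 < r" "r < 1" "r \<noteq> r0"
      show "0 < h r * ((1 - r) powr b - (1 - r0) powr b)"
      proof (cases "r < r0")
        case c: True
        then have "(1 - r) powr b < (1 - r0) powr b"
          using r r0 b assms by (intro powr_less_mono2_neg) auto
        then show ?thesis using hneg[of r] r c by (simp add: mult_neg_neg)
      next
        case False
        then have "(1 - r0) powr b < (1 - r) powr b"
          using r r0 b assms by (intro powr_less_mono2_neg) auto
        then show ?thesis using hpos[of r] r False by simp
      qed
    qed auto
    then show False using F0 by simp
  qed
qed

section \<open>Growth of the covariance for large times and near time 1\<close>

lemma kint_bounds_far:
  assumes "-1 < a" "0 \<le> b" "1 \<le> t"
  shows "(t - 1) powr b / (1 + a) \<le> kint a b 0 1 t" "kint a b 0 1 t \<le> t powr b / (1 + a)"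
proof -
  have i: "set_integrable lborel {0..1} (\<lambda>r. r powr a * (t - r) powr b)"
    and ic: "set_integrable lborel {0..1} (\<lambda>r. c * r powr a)" for c
    using assms by (auto intro!: set_integrable_kint set_integrable_powr)
  have I: "(LBINT r:{0..1}. c * r powr a) = c / (1 + a)" for c
    using assms by (simp add: set_integral_powr)
  have "(LBINT r:{0..1}. (t - 1) powr b * r powr a) \<le> kint a b 0 1 t"
    unfolding kint_def using assms
    by (intro set_integral_mono[OF ic i])
       (auto simp: mult.commute[of _ "_ powr a"] intro!: mult_left_mono powr_mono2)
  then show "(t - 1) powr b / (1 + a) \<le> kint a b 0 1 t" by (simp only: I)
  have "kint a b 0 1 t \<le> (LBINT r:{0..1}. t powr b * r powr a)"
    unfolding kint_def using assms
    by (intro set_integral_mono[OF i ic])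
       (auto simp: mult.commute[of _ "_ powr a"] intro!: mult_left_mono powr_mono2)
  then show "kint a b 0 1 t \<le> t powr b / (1 + a)" by (simp only: I)
qed

lemma kint_mono_far:
  assumes "-1 < a" "0 \<le> b" "1 \<le> t"
  shows "kint a b 0 1 1 \<le> kint a b 0 1 t"
  unfolding kint_def using assms
  by (intro set_integral_mono set_integrable_kint) (auto intro!: mult_left_mono powr_mono2)

text \<open>For \<open>b < 0\<close> the second part of the covariance decays and the constant first
  part dominates; this is why the order is \<open>max b 0\<close> and not \<open>b\<close>.\<close>

lemma tendsto_wfbm_cov_1_far:
  assumes "-1 < a" "-1 < b"
  shows "((\<lambda>x. x powr (- max b 0) * wfbm_cov a b 1 x)
     \<longlongrightarrow> (if b < 0 then kint a b 0 1 1 else (if b = 0 then 2 else 1) / (1 + a))) at_top"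
proof (cases "b < 0")
  case True
  have "((\<lambda>x. x powr b * (x powr (- b) * kint a b 0 1 (0 + x))) \<longlongrightarrow> 0 * (1 powr (1 + a) / (1 + a))) at_top"
    using assms True
    by (intro tendsto_mult tendsto_kint_far tendsto_neg_powr filterlim_ident) auto
  then have "((\<lambda>x. kint a b 0 1 1 + x powr b * (x powr (- b) * kint a b 0 1 (0 + x))) \<longlongrightarrow> kint a b 0 1 1 + 0) at_top"
    by (intro tendsto_add tendsto_const) simp
  moreover have "\<forall>\<^sub>F x in at_top. kint a b 0 1 1 + x powr b * (x powr (- b) * kint a b 0 1 (0 + x)) =
      x powr (- max b 0) * wfbm_cov a b 1 x"
    using eventually_ge_at_top[of 1]
    by eventually_elim (use True assms in \<open>simp add: wfbm_cov_kint powr_minus\<close>)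
  ultimately show ?thesis using True by (auto intro: Lim_transform_eventually)
next
  case False
  then show ?thesis using tendsto_wfbm_cov_far[of a b 1 0] assms by (auto simp: max_def)
qed

text \<open>The mean value theorem and the monotonicity of \<open>z powr (b - 1)\<close> bound the
  difference quotient by its value at the left end. The resulting singularity
  \<open>(1 - r) powr (b - 1)\<close> is integrable because \<open>b > 0\<close>, so the growth is
  at most linear.\<close>

lemma kint_near_upper:
  assumes "-1 < a" "0 < b" "b \<le> 1" "0 < \<epsilon>"
  shows "kint a b 0 1 (1 + \<epsilon>) - kint a b 0 1 1 \<le> b * kint a (b - 1) 0 1 1 * \<epsilon>"
proof -
  have i: "set_integrable lborel {0..1} (\<lambda>r. r powr a * (1 + \<epsilon> - r) powr b)"
    "set_integrable lborel {0..1} (\<lambda>r. r powr a * (1 - r) powr b)"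
    "set_integrable lborel {0..1} (\<lambda>r. b * \<epsilon> * (r powr a * (1 - r) powr (b - 1)))"
    using assms by (auto intro!: set_integrable_kint set_integrable_mult_right)
  have "(LBINT r:{0..1}. r powr a * (1 + \<epsilon> - r) powr b - r powr a * (1 - r) powr b)
      \<le> (LBINT r:{0..1}. b * \<epsilon> * (r powr a * (1 - r) powr (b - 1)))"
  proof (intro set_integral_mono_AE set_integral_diff i)
    \<comment> \<open>The point \<open>r = 1\<close> has to be left out: there the majorant is 0 by
      the convention for \<open>0 powr\<close>.\<close>
    show "AE r\<in>{0..1} in lborel. r powr a * (1 + \<epsilon> - r) powr b - r powr a * (1 - r) powr b
        \<le> b * \<epsilon> * (r powr a * (1 - r) powr (b - 1))"
      using AE_lborel_singleton[of 1]
    proof (eventually_elim, safe)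
      fix r :: real assume r: "r \<noteq> 1" "r \<in> {0..1}"
      define y where "y = 1 - r"
      have y: "y > 0" using r by (auto simp: y_def)
      have "\<exists>z>y. z < y + \<epsilon> \<and> (y + \<epsilon>) powr b - y powr b = (y + \<epsilon> - y) * (b * z powr (b - 1))"
        using y assms by (intro MVT2) (auto intro!: derivative_eq_intros)
      then obtain z where z: "z > y" "(y + \<epsilon>) powr b - y powr b = \<epsilon> * (b * z powr (b - 1))" by auto
      have "z powr (b - 1) \<le> y powr (b - 1)" using y z assms by (intro powr_mono2') auto
      then have "(y + \<epsilon>) powr b - y powr b \<le> \<epsilon> * (b * y powr (b - 1))"
        unfolding z(2) using assms by (intro mult_left_mono) auto
      then have "r powr a * ((y + \<epsilon>) powr b - y powr b) \<le> r powr a * (\<epsilon> * (b * y powr (b - 1)))"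
        by (intro mult_left_mono) auto
      then show "r powr a * (1 + \<epsilon> - r) powr b - r powr a * (1 - r) powr b
        \<le> b * \<epsilon> * (r powr a * (1 - r) powr (b - 1))"
        by (simp add: y_def algebra_simps)
    qed
  qed
  then show ?thesis using i by (simp add: kint_def set_integral_diff mult_ac)
qed

text \<open>Already the piece over \<open>[1 - \<epsilon>, 1]\<close> causes a drop of order
  \<open>\<epsilon> powr (1 + b)\<close>: the integrand falls there by at least a multiple of
  \<open>\<epsilon> powr b\<close>, over a length \<open>\<epsilon>\<close>. As
  \<open>1 + b < 1\<close>, this is steeper than linear.\<close>

lemma kint_near_lower:
  assumes "-1 < a" "-1 < b" "b < 0"
  obtains c where "0 < c"
    "\<And>\<epsilon>. 0 < \<epsilon> \<Longrightarrow> \<epsilon> \<le> 1 / 2 \<Longrightarrow> c * \<epsilon> powr (1 + b) \<le> kint a b 0 1 1 - kint a b 0 1 (1 + \<epsilon>)"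
proof
  \<comment> \<open>The minimum of \<open>r powr a\<close> over \<open>[1/2, 1]\<close>, whichever
    sign \<open>a\<close> has; \<open>\<epsilon> \<le> 1 / 2\<close> keeps the relevant piece inside
    this interval.\<close>
  define m :: real where "m = min 1 ((1/2) powr a)"
  have m: "m > 0" "m \<le> r powr a" if "1/2 \<le> r" "r \<le> 1" for r
  proof -
    show "m > 0" by (simp add: m_def)
    show "m \<le> r powr a"
    proof (cases "a \<ge> 0")
      case True
      then show ?thesis using that powr_mono2[of a "1/2" r] by (simp add: m_def min_le_iff_disj)
    next
      case False
      then show ?thesis using that powr_mono2'[of a r 1] by (simp add: m_def min_le_iff_disj)
    qed
  qed
  \<comment> \<open>The factor \<open>m\<close> bounds the weight. The rest comes from the mean
    value theorem, whose intermediate point satisfies \<open>z < 2 * \<epsilon>\<close>.\<close>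
  define c where "c = m * (- b) * 2 powr (b - 1)"
  show "0 < c" unfolding c_def using m[of 1] assms by (intro mult_pos_pos) auto
  fix \<epsilon> :: real assume \<epsilon>: "0 < \<epsilon>" "\<epsilon> \<le> 1 / 2"
  have k: "kint a b 0 1 x = kint a b 0 (1 - \<epsilon>) x + kint a b (1 - \<epsilon>) 1 x" if "1 \<le> x" for x
    using that assms \<epsilon> by (intro kint_combine) auto
  \<comment> \<open>Over the rest of the interval the integrand also decreases, so that piece may be
    dropped.\<close>
  have 1: "kint a b 0 (1 - \<epsilon>) (1 + \<epsilon>) \<le> kint a b 0 (1 - \<epsilon>) 1"
    unfolding kint_def using assms \<epsilon>
    by (intro set_integral_mono set_integrable_kint) (auto intro!: mult_left_mono powr_mono2')
  have i: "set_integrable lborel {1-\<epsilon>..1} (\<lambda>r. r powr a * (1 + \<epsilon> - r) powr b)"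
    "set_integrable lborel {1-\<epsilon>..1} (\<lambda>r. r powr a * (1 - r) powr b)"
    using assms \<epsilon> by (auto intro!: set_integrable_kint)
  have "(LBINT r:{1-\<epsilon>..1}. c * \<epsilon> powr b)
      \<le> (LBINT r:{1-\<epsilon>..1}. r powr a * (1 - r) powr b - r powr a * (1 + \<epsilon> - r) powr b)"
  proof (intro set_integral_mono_AE set_integral_diff i)
    show "AE r\<in>{1-\<epsilon>..1} in lborel. c * \<epsilon> powr b \<le> r powr a * (1 - r) powr b - r powr a * (1 + \<epsilon> - r) powr b"
      using AE_lborel_singleton[of 1]
    proof (eventually_elim, safe)
      fix r :: real assume r: "r \<noteq> 1" "r \<in> {1-\<epsilon>..1}"
      define y where "y = 1 - r"
      have y: "y > 0" "y \<le> \<epsilon>" using r by (auto simp: y_def)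
      have "\<exists>z>y. z < y + \<epsilon> \<and> (y + \<epsilon>) powr b - y powr b = (y + \<epsilon> - y) * (b * z powr (b - 1))"
        using y \<epsilon> by (intro MVT2) (auto intro!: derivative_eq_intros)
      then obtain z where z: "z > y" "z < y + \<epsilon>" "y powr b - (y + \<epsilon>) powr b = \<epsilon> * ((-b) * z powr (b - 1))"
        by (auto simp: algebra_simps)
      have "(2 * \<epsilon>) powr (b - 1) \<le> z powr (b - 1)" using y z assms by (intro powr_mono2') auto
      then have "\<epsilon> * ((-b) * (2 * \<epsilon>) powr (b - 1)) \<le> y powr b - (y + \<epsilon>) powr b"
        unfolding z(3) using assms \<epsilon> by (intro mult_left_mono) auto
      moreover have "\<epsilon> * ((-b) * (2 * \<epsilon>) powr (b - 1)) = (-b) * 2 powr (b - 1) * \<epsilon> powr b"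
        using \<epsilon> by (simp add: powr_mult powr_diff)
      ultimately have le: "(-b) * 2 powr (b - 1) * \<epsilon> powr b \<le> y powr b - (y + \<epsilon>) powr b"
        by (simp only:)
      have "0 \<le> (-b) * 2 powr (b - 1) * \<epsilon> powr b"
        using assms by (intro mult_nonneg_nonneg) auto
      then have "m * ((-b) * 2 powr (b - 1) * \<epsilon> powr b) \<le> r powr a * (y powr b - (y + \<epsilon>) powr b)"
        using m[of r] r \<epsilon> assms by (intro mult_mono le) auto
      then show "c * \<epsilon> powr b \<le> r powr a * (1 - r) powr b - r powr a * (1 + \<epsilon> - r) powr b"
        by (simp add: y_def c_def algebra_simps)
    qed
  qed (rule borel_integrable_atLeastAtMost', simp)
  moreover have "(LBINT r:{1-\<epsilon>..1}. c * \<epsilon> powr b) = \<epsilon> * (c * \<epsilon> powr b)"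
    using \<epsilon> by (subst set_integral_const) auto
  ultimately have "\<epsilon> * (c * \<epsilon> powr b) \<le> kint a b (1 - \<epsilon>) 1 1 - kint a b (1 - \<epsilon>) 1 (1 + \<epsilon>)"
    using i \<epsilon> by (simp only: kint_def set_integral_diff)
  then show "c * \<epsilon> powr (1 + b) \<le> kint a b 0 1 1 - kint a b 0 1 (1 + \<epsilon>)"
    using 1 k[of 1] k[of "1 + \<epsilon>"] \<epsilon> by (simp add: powr_add mult_ac)
qed


section \<open>Excluding a factorization by the signs of the exponents\<close>

lemma wfbm_cov_1_far:
  assumes "-1 < a" "-1 < b" "1 \<le> t"
  shows "wfbm_cov a b 1 t = kint a b 0 1 1 + kint a b 0 1 t"
  using assms by (simp add: wfbm_cov_kint)

text \<open>The coefficient of \<open>x powr max b 0\<close> in the covariance at times 1 and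
  \<open>x\<close>, as found in \<open>tendsto_wfbm_cov_1_far\<close>.\<close>

definition far_const :: "real \<Rightarrow> real \<Rightarrow> real" where
  "far_const a b = (if b < 0 then kint a b 0 1 1 else (if b = 0 then 2 else 1) / (1 + a))"

lemma far_const_pos: "-1 < a \<Longrightarrow> -1 < b \<Longrightarrow> 0 < far_const a b"
  by (auto simp: far_const_def kint_pos)

text \<open>The situation on a ray, with the smaller time normalized to 1 and
  \<open>K = \<theta> powr (1 + a2 + b2)\<close>. Fixing that time loses the scaling behaviour of
  the two sides, so the equality of the degrees is recorded separately in
  \<open>homogeneity\<close>.\<close>

locale cov_factorization =
  fixes a b a1 b1 a2 b2 K :: real
  assumes params: "wfbm_params a b" "wfbm_params a1 b1" "wfbm_params a2 b2"
    and K: "K > 0"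
    and fact: "\<And>t. 1 \<le> t \<Longrightarrow> K * (wfbm_cov a1 b1 1 t * wfbm_cov a2 b2 1 t) = wfbm_cov a b 1 t"
    and homogeneity: "1 + a + b = (1 + a1 + b1) + (1 + a2 + b2)"
begin

abbreviation "B \<equiv> kint a b 0 1 1"
abbreviation "B1 \<equiv> kint a1 b1 0 1 1"
abbreviation "B2 \<equiv> kint a2 b2 0 1 1"
abbreviation "g \<equiv> kint a b 0 1"
abbreviation "g1 \<equiv> kint a1 b1 0 1"
abbreviation "g2 \<equiv> kint a2 b2 0 1"

lemma bounds: "-1 < a" "-1 < b" "b \<le> 1" "-1 < a1" "-1 < b1" "b1 \<le> 1" "-1 < a2" "-1 < b2" "b2 \<le> 1"
  using params by (auto simp: wfbm_params_def)

lemma B_pos: "0 < B" "0 < B1" "0 < B2"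
  using bounds by (auto intro!: kint_pos)

lemma swap: "cov_factorization a b a2 b2 a1 b1 K"
  using params K fact homogeneity by unfold_locales (auto simp: mult_ac add_ac)

lemma fact_kint: "1 \<le> t \<Longrightarrow> K * ((B1 + g1 t) * (B2 + g2 t)) = B + g t"
  using fact[of t] bounds by (simp add: wfbm_cov_1_far)

lemma fact_1: "K * (B1 * B2) = B / 2"
  using fact_kint[of 1] by simp

text \<open>The quotient of the two normalized sides has a positive limit, but by the factorization
  it is a pure power of \<open>x\<close>. Its exponent must therefore be 0 and its limit 1.\<close>

lemma leading_order:
  shows "max b 0 = max b1 0 + max b2 0" "K * (far_const a1 b1 * far_const a2 b2) = far_const a b"
proof -
  let ?p = "max b1 0 + max b2 0 - max b 0"
  have "((\<lambda>x. x powr (- max b 0) * wfbm_cov a b 1 x /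
     (K * ((x powr (- max b1 0) * wfbm_cov a1 b1 1 x) * (x powr (- max b2 0) * wfbm_cov a2 b2 1 x))))
     \<longlongrightarrow> far_const a b / (K * (far_const a1 b1 * far_const a2 b2))) at_top"
    unfolding far_const_def using bounds K far_const_pos[of a1 b1] far_const_pos[of a2 b2]
    by (intro tendsto_intros tendsto_wfbm_cov_1_far) (auto simp: far_const_def)
  moreover have "\<forall>\<^sub>F x in at_top. x powr (- max b 0) * wfbm_cov a b 1 x /
     (K * ((x powr (- max b1 0) * wfbm_cov a1 b1 1 x) * (x powr (- max b2 0) * wfbm_cov a2 b2 1 x))) = x powr ?p"
    using eventually_ge_at_top[of 1]
  proof eventually_elim
    case (elim x)
    have "wfbm_cov a1 b1 1 x > 0" "wfbm_cov a2 b2 1 x > 0"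
      using bounds elim B_pos kint_nonneg by (auto simp: wfbm_cov_1_far add_pos_nonneg)
    then show ?case
      using elim K by (simp add: fact[OF elim, symmetric] powr_add powr_diff powr_minus field_simps)
  qed
  ultimately have lim: "((\<lambda>x. x powr ?p) \<longlongrightarrow> far_const a b / (K * (far_const a1 b1 * far_const a2 b2))) at_top"
    by (rule Lim_transform_eventually)
  have pos: "0 < far_const a b / (K * (far_const a1 b1 * far_const a2 b2))" using far_const_pos bounds K by simp
  show "max b 0 = max b1 0 + max b2 0" using powr_tendsto_pos_at_top(1)[OF lim pos] by simp
  show "K * (far_const a1 b1 * far_const a2 b2) = far_const a b" using powr_tendsto_pos_at_top(2)[OF lim pos] pos by (auto simp: field_simps)
qed

text \<open>Both covariances on the left tend to their constant parts, so
  \<open>K * (B1 * B2)\<close> would be \<open>B\<close> (for \<open>b < 0\<close>) or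
  \<open>2 * B\<close> (for \<open>b = 0\<close>). At \<open>t = 1\<close> it is
  \<open>B / 2\<close>.\<close>

lemma not_both_negative: "\<not> (b1 < 0 \<and> b2 < 0)"
proof
  assume n: "b1 < 0 \<and> b2 < 0"
  then have "b \<le> 0" using leading_order(1) by (simp add: max_def split: if_splits)
  moreover have "b = 0 \<Longrightarrow> B = 1 / (1 + a)" using bounds kint_0_right[of a 0 1 1] by simp
  ultimately have "far_const a b = B \<or> far_const a b = 2 * B" by (auto simp: far_const_def)
  then show False using leading_order(2) n fact_1 B_pos by (auto simp: far_const_def)
qed

text \<open>The leading terms \<open>g\<close> and \<open>K * g1 * g2\<close> have the same order
  and coefficient, and since \<open>b \<le> 1\<close> their difference is bounded above:
  \<open>t powr b - (t - 1) powr b\<close> stays at most 1. The cross term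
  \<open>K * B2 * g1\<close> would then be bounded, but it grows like
  \<open>t powr b1\<close>.\<close>

lemma not_both_positive: "\<not> (b1 > 0 \<and> b2 > 0)"
proof
  assume p: "b1 > 0 \<and> b2 > 0"
  then have b: "b = b1 + b2" using leading_order(1) by (auto simp: max_def split: if_splits)
  have KL: "K / ((1 + a1) * (1 + a2)) = 1 / (1 + a)"
    using leading_order(2) p b by (simp add: far_const_def)
  have "K * B2 * g1 t \<le> B + 1 / (1 + a)" if "2 \<le> t" for t
  proof -
    have "\<exists>z>t - 1. z < t \<and> t powr b - (t - 1) powr b = (t - (t - 1)) * (b * z powr (b - 1))"
      using that by (intro MVT2) (auto intro!: derivative_eq_intros)
    then obtain z where z: "z > t - 1" "t powr b - (t - 1) powr b = (t - (t - 1)) * (b * z powr (b - 1))"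
      by blast
    then have z: "z > 1" "t powr b - (t - 1) powr b = b * z powr (b - 1)" using that by auto
    have "z powr (b - 1) \<le> 1" using z bounds powr_mono[of "b - 1" 0 z] by simp
    then have "t powr b - (t - 1) powr b \<le> 1"
      unfolding z(2) using p b bounds mult_mono[of b 1 "z powr (b - 1)" 1] by simp
    moreover have "g t \<le> t powr b / (1 + a)" using that p b bounds by (intro kint_bounds_far) auto
    moreover have "(t - 1) powr b / (1 + a) \<le> K * (g1 t * g2 t)"
    proof -
      have "(t - 1) powr b / (1 + a) = K * ((t - 1) powr b1 / (1 + a1) * ((t - 1) powr b2 / (1 + a2)))"
      proof -
        have "(t - 1) powr b / (1 + a) = (1 / (1 + a)) * ((t - 1) powr b1 * (t - 1) powr b2)"
          by (simp add: b powr_add)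
        also have "\<dots> = K * ((t - 1) powr b1 / (1 + a1) * ((t - 1) powr b2 / (1 + a2)))"
          unfolding KL[symmetric] by simp
        finally show ?thesis .
      qed
      also have "\<dots> \<le> K * (g1 t * g2 t)"
        using that p bounds K by (intro mult_left_mono mult_mono kint_bounds_far kint_nonneg) auto
      finally show ?thesis .
    qed
    ultimately have "g t - K * (g1 t * g2 t) \<le> 1 / (1 + a)"
      using bounds by (smt (verit) diff_divide_distrib divide_right_mono)
    moreover have "B + g t = K * (B1 * B2) + K * B1 * g2 t + K * B2 * g1 t + K * (g1 t * g2 t)"
      using fact_kint[of t] that by (simp add: algebra_simps)
    moreover have "0 \<le> K * (B1 * B2)" "0 \<le> K * B1 * g2 t" using K B_pos kint_nonneg by auto
    ultimately show ?thesis by linarith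
  qed
  then have *: "K * B2 * (t - 1) powr b1 / (1 + a1) \<le> B + 1 / (1 + a)" if "2 \<le> t" for t
    using mult_left_mono[OF kint_bounds_far(1)[of a1 b1 t], of "K * B2"] that p bounds K B_pos by fastforce
  have "filterlim (\<lambda>t. (K * B2 / (1 + a1)) * (t - 1) powr b1) at_top at_top"
  proof (rule filterlim_tendsto_pos_mult_at_top[OF tendsto_const])
    show "0 < K * B2 / (1 + a1)" using K B_pos bounds by simp
    show "filterlim (\<lambda>t. (t - 1) powr b1) at_top at_top" using p by real_asymp
  qed
  then have "\<forall>\<^sub>F t in at_top. B + 1 / (1 + a) < (K * B2 / (1 + a1)) * (t - 1) powr b1"
    by (simp add: filterlim_at_top_dense)
  then have "\<forall>\<^sub>F t::real in at_top. False"
    using eventually_ge_at_top[of 2] by eventually_elim (use * in force)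
  then show False by simp
qed

text \<open>As \<open>t\<close> leaves 1, the first factor rises at most linearly in
  \<open>\<epsilon>\<close>, while the second falls at least by a multiple of
  \<open>\<epsilon> powr (1 + b2)\<close>, which is larger for small \<open>\<epsilon>\<close>. The
  product would decrease, but \<open>b > 0\<close> makes the other side nondecreasing.
  Quantitatively, \<open>\<epsilon> powr b2\<close> would be bounded.\<close>

lemma not_opposite: "\<not> (b1 > 0 \<and> b2 < 0)"
proof
  assume p: "b1 > 0 \<and> b2 < 0"
  then have b: "b > 0" using leading_order(1) by (auto simp: max_def split: if_splits)
  obtain c where c: "0 < c"
    "\<And>\<epsilon>. 0 < \<epsilon> \<Longrightarrow> \<epsilon> \<le> 1 / 2 \<Longrightarrow> c * \<epsilon> powr (1 + b2) \<le> B2 - g2 (1 + \<epsilon>)"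
    using kint_near_lower[of a2 b2] bounds p by blast
  define d where "d = b1 * kint a1 (b1 - 1) 0 1 1"
  have *: "B1 * c * \<epsilon> powr b2 \<le> B2 * d" if e: "0 < \<epsilon>" "\<epsilon> \<le> 1 / 2" for \<epsilon>
  proof -
    define x where "x = g1 (1 + \<epsilon>) - B1"
    define y where "y = B2 - g2 (1 + \<epsilon>)"
    have x: "0 \<le> x" "x \<le> d * \<epsilon>"
      using kint_near_upper[of a1 b1 \<epsilon>] kint_mono_far[of a1 b1 "1 + \<epsilon>"] bounds p e
      by (auto simp: x_def d_def)
    have y: "0 \<le> y" "c * \<epsilon> powr (1 + b2) \<le> y"
    proof -
      show c: "c * \<epsilon> powr (1 + b2) \<le> y" using c(2)[OF e] by (simp add: y_def)
      show "0 \<le> y" by (rule order_trans[OF _ c]) (use \<open>0 < c\<close> in simp)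
    qed
    have "B \<le> g (1 + \<epsilon>)" using kint_mono_far[of a b "1 + \<epsilon>"] bounds b e by simp
    then have "2 * B \<le> K * ((2 * B1 + x) * (2 * B2 - y))"
      using fact_kint[of "1 + \<epsilon>"] e by (simp add: x_def y_def)
    moreover have "2 * B = K * (4 * (B1 * B2))" using fact_1 by simp
    ultimately have "4 * (B1 * B2) \<le> (2 * B1 + x) * (2 * B2 - y)" using K by simp
    moreover have "0 \<le> x * y" using x y by simp
    ultimately have "B1 * y \<le> B2 * x" by (simp add: algebra_simps)
    moreover have "B1 * (c * \<epsilon> powr (1 + b2)) \<le> B1 * y" "B2 * x \<le> B2 * (d * \<epsilon>)"
      using B_pos x y by (auto intro!: mult_left_mono)
    ultimately have "B1 * (c * \<epsilon> powr (1 + b2)) \<le> B2 * (d * \<epsilon>)" by linarith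
    then have "\<epsilon> * (B1 * c * \<epsilon> powr b2) \<le> \<epsilon> * (B2 * d)"
      using e by (simp add: powr_add mult_ac)
    then show ?thesis using e by simp
  qed
  have "filterlim (\<lambda>\<epsilon>. (B1 * c) * \<epsilon> powr b2) at_top (at_right 0)"
  proof (rule filterlim_tendsto_pos_mult_at_top[OF tendsto_const])
    show "0 < B1 * c" using c B_pos by simp
    show "filterlim (\<lambda>\<epsilon>::real. \<epsilon> powr b2) at_top (at_right 0)" using p by real_asymp
  qed
  then have "\<forall>\<^sub>F \<epsilon> in at_right 0. B2 * d < (B1 * c) * \<epsilon> powr b2"
    by (simp add: filterlim_at_top_dense)
  moreover have "\<forall>\<^sub>F \<epsilon>::real in at_right 0. \<epsilon> < 1 / 2"
    by (rule eventually_mono[OF eventually_at_right_real[of 0 "1 / 2"]]) auto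
  ultimately have "\<forall>\<^sub>F \<epsilon>::real in at_right 0. False"
    using eventually_at_right_less[of 0] by eventually_elim (use * in force)
  then show False by simp
qed

text \<open>The second factor is constant for \<open>t \<ge> 1\<close>, so \<open>g\<close> is a
  multiple of \<open>g1\<close>. Large \<open>t\<close> gives \<open>b = b1\<close> and the ratio of
  \<open>1 + a1\<close> to \<open>1 + a\<close>; inserting this at \<open>t = 1\<close> gives
  \<open>a = a1\<close> by \<open>kint_normalized_inj\<close>. Then homogeneity leaves
  \<open>1 + a2 = 0\<close>, which is impossible.\<close>

lemma not_one_zero: "\<not> (b1 \<noteq> 0 \<and> b2 = 0)"
proof
  assume p: "b1 \<noteq> 0 \<and> b2 = 0"
  have g2: "g2 t = B2" if "1 \<le> t" for t
    using p bounds that kint_0_right[of a2 0 1 t] kint_0_right[of a2 0 1 1] by simp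
  define K' where "K' = 2 * K * B2"
  have K': "K' > 0" using K B_pos by (simp add: K'_def)
  have KB: "K' * B1 = B" using fact_1 by (simp add: K'_def mult_ac)
  have Kg: "K' * g1 t = g t" if "1 \<le> t" for t
    using fact_kint[OF that] g2[OF that] KB by (simp add: K'_def algebra_simps)
  have "((\<lambda>x. x powr (- b) * g (0 + x) / (K' * (x powr (- b1) * g1 (0 + x))))
      \<longlongrightarrow> (1 powr (1 + a) / (1 + a)) / (K' * (1 powr (1 + a1) / (1 + a1)))) at_top"
    using bounds K' by (intro tendsto_intros tendsto_kint_far) auto
  then have "((\<lambda>x. x powr (- b) * g (0 + x) / (K' * (x powr (- b1) * g1 (0 + x))))
      \<longlongrightarrow> (1 + a1) / (K' * (1 + a))) at_top"
    by (simp add: mult_ac)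
  moreover have "\<forall>\<^sub>F x in at_top. x powr (- b) * g (0 + x) / (K' * (x powr (- b1) * g1 (0 + x))) = x powr (b1 - b)"
    using eventually_ge_at_top[of 1]
  proof eventually_elim
    case (elim x)
    have "g1 x > 0" using elim bounds by (intro kint_pos) auto
    then show ?case using elim K' by (simp add: Kg[symmetric] powr_diff powr_minus field_simps)
  qed
  ultimately have lim: "((\<lambda>x. x powr (b1 - b)) \<longlongrightarrow> (1 + a1) / (K' * (1 + a))) at_top"
    by (rule Lim_transform_eventually)
  have pos: "0 < (1 + a1) / (K' * (1 + a))" using bounds K' by simp
  have b: "b = b1" using powr_tendsto_pos_at_top(1)[OF lim pos] by simp
  have "1 + a1 = K' * (1 + a)" using powr_tendsto_pos_at_top(2)[OF lim pos] bounds K' by (simp add: field_simps)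
  then have eq: "(1 + a1) * kint a1 b1 0 1 1 = (1 + a) * kint a b1 0 1 1"
    using KB b by (simp add: mult_ac)
  have "a = a1"
  proof (rule ccontr)
    assume "a \<noteq> a1"
    then consider "a < a1" | "a1 < a" by linarith
    then show False
    proof cases
      case 1
      show False by (rule notE[OF kint_normalized_inj[OF _ 1] eq[symmetric]]) (use bounds p in auto)
    next
      case 2
      show False by (rule notE[OF kint_normalized_inj[OF _ 2] eq]) (use bounds p in auto)
    qed
  qed
  then show False using homogeneity b p bounds by simp
qed

lemma both_zero: "b1 = 0 \<and> b2 = 0"
proof -
  interpret s: cov_factorization a b a2 b2 a1 b1 K by (rule swap)
  show ?thesis
    using not_both_negative not_both_positive not_opposite s.not_opposite not_one_zero s.not_one_zero
    by linarith
qed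

end

section \<open>Trigonometric polynomials\<close>

text \<open>Each generator has a Gaussian expectation in closed form. The phase
  \<open>\<phi>\<close> provides constants and sines, and with it the set is closed under
  products.\<close>

inductive_set trig_poly :: "'i set \<Rightarrow> (('i \<Rightarrow> real) \<Rightarrow> real) set" for J :: "'i set" where
  cos: "(\<lambda>x. c * cos ((\<Sum>j\<in>J. t j * x j) + \<phi>)) \<in> trig_poly J"
| add: "g \<in> trig_poly J \<Longrightarrow> h \<in> trig_poly J \<Longrightarrow> (\<lambda>x. g x + h x) \<in> trig_poly J"

lemma trig_poly_const: "(\<lambda>x. c) \<in> trig_poly J"
  using trig_poly.cos[of c "\<lambda>_. 0" J 0] by simp

lemma trig_poly_sin:
  assumes "finite J" "i \<in> J"
  shows "(\<lambda>x. sin (x i / L)) \<in> trig_poly J"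
proof -
  have "(\<Sum>j\<in>J. (if j = i then 1 / L else 0) * x j) = x i / L" for x :: "'a \<Rightarrow> real"
    using assms by (simp add: if_distrib[where f="\<lambda>y. y * _"] cong: if_cong)
  then have "(\<lambda>x. 1 * cos ((\<Sum>j\<in>J. (if j = i then 1 / L else 0) * x j) + - pi / 2)) = (\<lambda>x. sin (x i / L))"
    by (simp add: cos_diff)
  then show ?thesis using trig_poly.cos[of 1 "\<lambda>j. if j = i then 1 / L else 0" J "- pi / 2"] by simp
qed

text \<open>The formula \<open>cos A * cos B = (cos (A - B) + cos (A + B)) / 2\<close> for
  generators, and distributivity for sums. This makes the set an algebra, as Stone-Weierstrass
  requires.\<close>

lemma trig_poly_mult:
  assumes "g \<in> trig_poly J" "h \<in> trig_poly J"
  shows "(\<lambda>x. g x * h x) \<in> trig_poly J"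
  using assms
proof (induction arbitrary: h rule: trig_poly.induct)
  case (cos c t \<phi>)
  from cos show ?case
  proof (induction rule: trig_poly.induct)
    case (cos c' t' \<phi>')
    have "(\<lambda>x. (c * c' / 2) * cos ((\<Sum>j\<in>J. (t j - t' j) * x j) + (\<phi> - \<phi>'))
             + (c * c' / 2) * cos ((\<Sum>j\<in>J. (t j + t' j) * x j) + (\<phi> + \<phi>'))) \<in> trig_poly J"
      by (intro trig_poly.intros)
    also have "(\<lambda>x. (c * c' / 2) * cos ((\<Sum>j\<in>J. (t j - t' j) * x j) + (\<phi> - \<phi>'))
             + (c * c' / 2) * cos ((\<Sum>j\<in>J. (t j + t' j) * x j) + (\<phi> + \<phi>'))) =
       (\<lambda>x. c * cos ((\<Sum>j\<in>J. t j * x j) + \<phi>) * (c' * cos ((\<Sum>j\<in>J. t' j * x j) + \<phi>')))"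
    proof
      fix x
      let ?A = "(\<Sum>j\<in>J. t j * x j) + \<phi>" and ?B = "(\<Sum>j\<in>J. t' j * x j) + \<phi>'"
      have 1: "(\<Sum>j\<in>J. (t j - t' j) * x j) + (\<phi> - \<phi>') = ?A - ?B"
        "(\<Sum>j\<in>J. (t j + t' j) * x j) + (\<phi> + \<phi>') = ?A + ?B"
        by (simp_all add: left_diff_distrib distrib_right sum.distrib sum_subtractf)
      show "(c * c' / 2) * cos ((\<Sum>j\<in>J. (t j - t' j) * x j) + (\<phi> - \<phi>'))
             + (c * c' / 2) * cos ((\<Sum>j\<in>J. (t j + t' j) * x j) + (\<phi> + \<phi>')) =
        c * cos ?A * (c' * cos ?B)"
        unfolding 1 by (simp only: cos_add cos_diff) (simp add: algebra_simps)
    qed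
    finally show ?case .
  next
    case (add g h)
    then show ?case using trig_poly.add by (fastforce simp: distrib_left)
  qed
next
  case (add g g')
  then show ?case using trig_poly.add by (fastforce simp: distrib_right)
qed

lemma trig_poly_bounded: "g \<in> trig_poly J \<Longrightarrow> \<exists>B. \<forall>x. \<bar>g x\<bar> \<le> B"
proof (induction rule: trig_poly.induct)
  case (cos c t \<phi>)
  show ?case by (rule exI[of _ "\<bar>c\<bar>"]) (auto simp: abs_mult mult_left_le)
next
  case (add g h)
  then obtain B B' where "\<forall>x. \<bar>g x\<bar> \<le> B" "\<forall>x. \<bar>h x\<bar> \<le> B'" by auto
  then show ?case by (intro exI[of _ "B + B'"]) (auto intro: order_trans[OF abs_triangle_ineq] add_mono)
qed

lemma trig_poly_measurable:
  assumes "g \<in> trig_poly J" "\<And>j. j \<in> J \<Longrightarrow> X j \<in> borel_measurable M"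
  shows "(\<lambda>\<omega>. g (\<lambda>j\<in>J. X j \<omega>)) \<in> borel_measurable M"
  using assms(1) by induction (use assms(2) in auto)

text \<open>In the coordinates \<open>y = sin (x / L)\<close>, polynomials in \<open>y\<close> are trigonometric polynomials in \<open>x\<close> and the
  Stone-Weierstrass bound on the compact cube \<open>\<bar>y\<bar> \<le> 1\<close> becomes a bound for all \<open>x\<close>.\<close>

lemma trig_poly_approx:
  assumes J: "finite J" and f: "continuous_map (powertop_real J) euclideanreal f"
    and B: "\<And>x. x \<in> J \<rightarrow>\<^sub>E UNIV \<Longrightarrow> \<bar>f x\<bar> \<le> B" and "0 < L" "0 < \<epsilon>"
  obtains g where "g \<in> trig_poly J" "\<And>x. x \<in> J \<rightarrow>\<^sub>E UNIV \<Longrightarrow> \<bar>g x\<bar> \<le> B + \<epsilon>"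
    "\<And>x. x \<in> J \<rightarrow>\<^sub>E UNIV \<Longrightarrow> (\<And>j. j \<in> J \<Longrightarrow> \<bar>x j\<bar> \<le> L) \<Longrightarrow> \<bar>f x - g x\<bar> \<le> \<epsilon>"
proof -
  obtain e :: "nat \<Rightarrow> 'a" where e: "bij_betw e {0..<card J} J"
    using ex_bij_betw_nat_finite[OF J] by blast
  define n where "n = card J"
  define d where "d = inv_into {0..<n} e"
  have e_in: "e i \<in> J" if "i < n" for i using e that by (auto simp: n_def bij_betw_def)
  have d: "d j < n" "e (d j) = j" if "j \<in> J" for j
    using e that f_inv_into_f[of j e "{0..<n}"] inv_into_into[of j e "{0..<n}"]
    by (auto simp: bij_betw_def n_def d_def)
  have de: "d (e i) = i" if "i < n" for i
    using e that by (auto simp: bij_betw_def n_def d_def)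
  \<comment> \<open>Coordinates beyond those of \<open>J\<close> are pinned to 0, so two different
    points of the cube differ in a coordinate that belongs to an element of
    \<open>J\<close>.\<close>
  define S :: "(nat \<Rightarrow> real) set" where "S = PiE UNIV (\<lambda>i. if i < n then {-1..1} else {0})"
  have S_D: "-1 \<le> y i \<and> y i \<le> 1" "\<not> i < n \<Longrightarrow> y i = 0" if "y \<in> S" for y i
    using PiE_mem[of y UNIV _ i] that by (force simp: S_def split: if_splits)+
  define enc :: "('a \<Rightarrow> real) \<Rightarrow> nat \<Rightarrow> real" where "enc x = (\<lambda>i. if i < n then sin (x (e i) / L) else 0)" for x
  \<comment> \<open>The algebra for Stone-Weierstrass: continuous functions on the cube that become
    trigonometric polynomials after substituting the sines.\<close>
  define R where "R = {P. continuous_on S P \<and> (\<lambda>x. P (enc x)) \<in> trig_poly J}"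
  define F where "F y = f (\<lambda>j\<in>J. L * arcsin (y (d j)))" for y :: "nat \<Rightarrow> real"
  have coord: "continuous_on S (\<lambda>y. y i)" for i
    by (rule continuous_on_subset[OF continuous_on_product_coordinates]) simp
  interpret function_ring_on R S
  proof
    have "compactin (powertop_real UNIV) S"
      unfolding S_def compactin_PiE by auto
    then show "compact S" by (simp add: euclidean_product_topology)
    show "continuous_on S P" if "P \<in> R" for P using that by (simp add: R_def)
    show "(\<lambda>y. P y + Q y) \<in> R" if "P \<in> R" "Q \<in> R" for P Q
      using that by (auto simp: R_def intro!: continuous_intros trig_poly.add)
    show "(\<lambda>y. P y * Q y) \<in> R" if "P \<in> R" "Q \<in> R" for P Q
      using that by (auto simp: R_def intro!: continuous_intros trig_poly_mult)
    show "(\<lambda>_. c) \<in> R" for c by (auto simp: R_def intro!: trig_poly_const)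
    show "\<exists>P\<in>R. P x \<noteq> P y" if xy: "x \<in> S" "y \<in> S" "x \<noteq> y" for x y
    proof -
      obtain i where i: "x i \<noteq> y i" using xy by auto
      then have "i < n" using S_D(2)[OF xy(1), of i] S_D(2)[OF xy(2), of i] by (cases "i < n") auto
      then have "(\<lambda>y. y i) \<in> R"
        using trig_poly_sin[OF J e_in[of i], of L] coord by (auto simp: R_def enc_def)
      then show ?thesis using i by (intro bexI[of _ "\<lambda>y. y i"])
    qed
  qed
  have "continuous_on S F"
  proof -
    have "continuous_map (top_of_set S) (powertop_real J) (\<lambda>y. \<lambda>j\<in>J. L * arcsin (y (d j)))"
      unfolding continuous_map_componentwise
    proof (intro conjI ballI)
      fix j assume j: "j \<in> J"
      have "continuous_on S (\<lambda>y. L * arcsin (y (d j)))"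
        using coord[of "d j"] S_D(1) by (intro continuous_intros) auto
      then show "continuous_map (top_of_set S) euclideanreal (\<lambda>y. (\<lambda>j\<in>J. L * arcsin (y (d j))) j)"
        using j by simp
    qed auto
    from continuous_map_compose[OF this f] show ?thesis
      by (simp add: o_def F_def[abs_def])
  qed
  from Stone_Weierstrass_basic[OF this \<open>0 < \<epsilon>\<close>] obtain P where P: "P \<in> R" "\<And>y. y \<in> S \<Longrightarrow> \<bar>F y - P y\<bar> < \<epsilon>"
    by auto
  have enc_S: "enc x \<in> S" for x by (auto simp: enc_def S_def)
  show thesis
  proof
    show "(\<lambda>x. P (enc x)) \<in> trig_poly J" using P by (simp add: R_def)
    fix x assume x: "x \<in> J \<rightarrow>\<^sub>E (UNIV :: real set)"
    have "\<bar>F (enc x)\<bar> \<le> B" unfolding F_def by (rule B) auto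
    then show "\<bar>P (enc x)\<bar> \<le> B + \<epsilon>" using P(2)[OF enc_S[of x]] by linarith
    assume xL: "\<And>j. j \<in> J \<Longrightarrow> \<bar>x j\<bar> \<le> L"
    have "(\<lambda>j\<in>J. L * arcsin (enc x (d j))) = x"
    proof
      fix j
      show "(\<lambda>j\<in>J. L * arcsin (enc x (d j))) j = x j"
      proof (cases "j \<in> J")
        case True
        have "\<bar>x j / L\<bar> \<le> 1" using xL[OF True] \<open>0 < L\<close> by (simp add: field_simps)
        then have "- 1 \<le> x j / L" "x j / L \<le> 1" by (auto simp only: abs_le_iff)
        \<comment> \<open>Since \<open>pi / 2 > 1\<close>, the bound
          \<open>\<bar>x j\<bar> \<le> L\<close> places \<open>x j / L\<close> where
          \<open>arcsin\<close> inverts \<open>sin\<close>.\<close>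
        then have "arcsin (sin (x j / L)) = x j / L"
          using pi_gt3 by (intro arcsin_sin) linarith+
        then show ?thesis using True d \<open>0 < L\<close> by (simp add: enc_def)
      next
        case False
        then show ?thesis using x by (auto simp: PiE_def extensional_def)
      qed
    qed
    then show "\<bar>f x - P (enc x)\<bar> \<le> \<epsilon>" using P(2)[OF enc_S[of x]] by (simp add: F_def)
  qed
qed

text \<open>The function is a pointwise limit of trigonometric polynomials, which are measurable:
  approximate within \<open>1 / (n + 1)\<close> on the cube of half-width \<open>n + 1\<close>;
  every point lies in these cubes from some \<open>n\<close> on.\<close>

lemma continuous_map_powertop_measurable:
  assumes J: "finite J" and f: "continuous_map (powertop_real J) euclideanreal f"
    and B: "\<And>x. x \<in> J \<rightarrow>\<^sub>E UNIV \<Longrightarrow> \<bar>f x\<bar> \<le> B" and X: "\<And>j. j \<in> J \<Longrightarrow> X j \<in> borel_measurable M"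
  shows "(\<lambda>\<omega>. f (\<lambda>j\<in>J. X j \<omega>)) \<in> borel_measurable M"
proof -
  have "\<exists>g. g \<in> trig_poly J \<and> (\<forall>x. x \<in> J \<rightarrow>\<^sub>E UNIV \<longrightarrow> (\<forall>j\<in>J. \<bar>x j\<bar> \<le> real (Suc n)) \<longrightarrow> \<bar>f x - g x\<bar> \<le> 1 / real (Suc n))" for n
    using trig_poly_approx[OF J f B, of "real (Suc n)" "1 / real (Suc n)"] by (metis of_nat_0_less_iff zero_less_Suc zero_less_divide_1_iff)
  then obtain g where g: "\<And>n. g n \<in> trig_poly J"
    "\<And>n x. x \<in> J \<rightarrow>\<^sub>E UNIV \<Longrightarrow> (\<forall>j\<in>J. \<bar>x j\<bar> \<le> real (Suc n)) \<Longrightarrow> \<bar>f x - g n x\<bar> \<le> 1 / real (Suc n)"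
    by metis
  show ?thesis
  proof (rule borel_measurable_LIMSEQ_real)
    show "(\<lambda>\<omega>. g n (\<lambda>j\<in>J. X j \<omega>)) \<in> borel_measurable M" for n
      by (rule trig_poly_measurable[OF g(1) X])
    fix \<omega>
    let ?x = "\<lambda>j\<in>J. X j \<omega>"
    obtain N :: nat where N: "(\<Sum>j\<in>J. \<bar>X j \<omega>\<bar>) \<le> real N" using real_arch_simple by blast
    have "(\<lambda>n. f ?x - g n ?x) \<longlonglongrightarrow> 0"
    proof (rule Lim_null_comparison[OF _ LIMSEQ_inverse_real_of_nat])
      show "\<forall>\<^sub>F n in sequentially. norm (f ?x - g n ?x) \<le> inverse (real (Suc n))"
        using eventually_ge_at_top[of N]
      proof eventually_elim
        case (elim n)
        have "\<bar>X j \<omega>\<bar> \<le> real (Suc n)" if "j \<in> J" for j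
          using member_le_sum[OF that, of "\<lambda>j. \<bar>X j \<omega>\<bar>"] J N elim by auto
        then show ?case using g(2)[of ?x n] by (auto simp: inverse_eq_divide)
      qed
    qed
    then show "(\<lambda>n. g n ?x) \<longlonglongrightarrow> f ?x"
      using tendsto_diff[OF tendsto_const[of "f ?x"]] by fastforce
  qed
qed

section \<open>Centered Gaussian processes\<close>

text \<open>In the nondegenerate case, real and imaginary parts of the characteristic function of
  \<open>X / \<sigma>\<close> give the expectations of \<open>cos X\<close> and
  \<open>sin X\<close>, and the addition theorem brings in the phase. An almost surely constant
  variable with mean 0 vanishes, and the same formula holds with variance 0.\<close>

lemma gaussian_rv_centered:
  assumes "prob_space M" "gaussian_rv M X" "(\<integral>\<omega>. X \<omega> \<partial>M) = 0"
  shows "integrable M X" "integrable M (\<lambda>\<omega>. (X \<omega>)\<^sup>2)"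
    "(\<integral>\<omega>. cos (X \<omega> + \<phi>) \<partial>M) = cos \<phi> * exp (- (\<integral>\<omega>. (X \<omega>)\<^sup>2 \<partial>M) / 2)"
proof -
  interpret prob_space M by fact
  have [measurable]: "X \<in> borel_measurable M" using assms(2) by (simp add: gaussian_rv_def)
  from assms(2) consider (normal) \<mu> \<sigma> where "0 < \<sigma>"
      "distributed M lborel X (\<lambda>x. ennreal (normal_density \<mu> \<sigma> x))"
    | (const) \<mu> where "AE \<omega> in M. X \<omega> = \<mu>"
    by (auto simp: gaussian_rv_def)
  then have "integrable M X \<and> integrable M (\<lambda>\<omega>. (X \<omega>)\<^sup>2) \<and>
    (\<integral>\<omega>. cos (X \<omega> + \<phi>) \<partial>M) = cos \<phi> * exp (- (\<integral>\<omega>. (X \<omega>)\<^sup>2 \<partial>M) / 2)"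
  proof cases
    case normal
    have \<mu>: "\<mu> = 0" using normal_distributed_expectation[OF normal] assms(3) by simp
    have \<sigma>: "(\<integral>\<omega>. (X \<omega>)\<^sup>2 \<partial>M) = \<sigma>\<^sup>2"
      using normal_distributed_variance[OF normal] assms(3) by simp
    have i: "integrable M (\<lambda>\<omega>. (X \<omega>)^k)" for k
    proof -
      have "integrable lborel (\<lambda>x. normal_density \<mu> \<sigma> x * x ^ k)"
        using integrable_normal_moment[OF normal(1), of \<mu> k] \<mu> by simp
      then show ?thesis
        by (subst (asm) distributed_integrable[OF normal(2)]) auto
    qed
    define Z where "Z = (\<lambda>\<omega>. X \<omega> / \<sigma>)"
    have [measurable]: "Z \<in> borel_measurable M" unfolding Z_def by measurable
    have "distributed M lborel Z (\<lambda>x. ennreal (std_normal_density x))"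
      using normal normal_standard_normal_convert[of \<sigma> X \<mu>] \<mu> by (simp add: Z_def)
    then have dZ: "distr M lborel Z = std_normal_distribution"
      by (simp add: distributed_def)
    have "(CLINT \<omega>|M. iexp (\<sigma> * Z \<omega>)) = (CLINT x|distr M lborel Z. iexp (\<sigma> * x))"
      by (subst integral_distr) auto
    also have "\<dots> = complex_of_real (exp (- (\<sigma>\<^sup>2) / 2))"
      unfolding dZ using char_std_normal_distribution[THEN fun_cong, of \<sigma>] by (simp add: char_def)
    finally have ch: "(CLINT \<omega>|M. iexp (X \<omega>)) = complex_of_real (exp (- (\<sigma>\<^sup>2) / 2))"
      using normal(1) by (simp add: Z_def)
    have ii: "integrable M (\<lambda>\<omega>. iexp (X \<omega>))"
      by (rule integrable_const_bound[of _ 1]) auto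
    have c: "(\<integral>\<omega>. cos (X \<omega>) \<partial>M) = exp (- (\<sigma>\<^sup>2) / 2)"
      using integral_Re[OF ii] ch by (simp add: Re_exp)
    have s: "(\<integral>\<omega>. sin (X \<omega>) \<partial>M) = 0"
      using integral_Im[OF ii] ch by (simp add: Im_exp)
    have int: "integrable M (\<lambda>\<omega>. cos (X \<omega>))" "integrable M (\<lambda>\<omega>. sin (X \<omega>))"
      by (rule integrable_const_bound[of _ 1]; auto)+
    have "(\<integral>\<omega>. cos (X \<omega> + \<phi>) \<partial>M) = cos \<phi> * exp (- (\<sigma>\<^sup>2) / 2)"
      using int c s by (simp add: cos_add)
    then show ?thesis using i[of 1] i[of 2] \<sigma> by simp
  next
    case const
    have "(\<integral>\<omega>. X \<omega> \<partial>M) = (\<integral>\<omega>. \<mu> \<partial>M)" using const by (intro integral_cong_AE) auto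
    then have [simp]: "\<mu> = 0" using assms(3) by (simp add: prob_space)
    have "(\<integral>\<omega>. (X \<omega>)\<^sup>2 \<partial>M) = (\<integral>\<omega>. 0 \<partial>M)"
      by (rule integral_cong_AE) (use const in auto)
    moreover have "(\<integral>\<omega>. cos (X \<omega> + \<phi>) \<partial>M) = (\<integral>\<omega>. cos \<phi> \<partial>M)"
      by (rule integral_cong_AE) (use const in auto)
    moreover have "integrable M X \<longleftrightarrow> integrable M (\<lambda>\<omega>. 0::real)"
      by (rule integrable_cong_AE) (use const in auto)
    moreover have "integrable M (\<lambda>\<omega>. (X \<omega>)\<^sup>2) \<longleftrightarrow> integrable M (\<lambda>\<omega>. 0::real)"
      by (rule integrable_cong_AE) (use const in auto)
    ultimately show ?thesis by (simp add: prob_space)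
  qed
  then show "integrable M X" "integrable M (\<lambda>\<omega>. (X \<omega>)\<^sup>2)"
    "(\<integral>\<omega>. cos (X \<omega> + \<phi>) \<partial>M) = cos \<phi> * exp (- (\<integral>\<omega>. (X \<omega>)\<^sup>2 \<partial>M) / 2)" by auto
qed

section \<open>Second moments and linear combinations\<close>

lemma integrable_mult_squares:
  fixes X Y :: "'a \<Rightarrow> real"
  assumes "integrable M (\<lambda>\<omega>. (X \<omega>)\<^sup>2)" "integrable M (\<lambda>\<omega>. (Y \<omega>)\<^sup>2)"
    and [measurable]: "X \<in> borel_measurable M" "Y \<in> borel_measurable M"
  shows "integrable M (\<lambda>\<omega>. X \<omega> * Y \<omega>)"
proof (rule Bochner_Integration.integrable_bound)
  show "integrable M (\<lambda>\<omega>. (X \<omega>)\<^sup>2 + (Y \<omega>)\<^sup>2)" using assms by simp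
  have "\<bar>x * y\<bar> \<le> x\<^sup>2 + y\<^sup>2" for x y :: real
    using sum_squares_bound[of x y] sum_squares_bound[of x "- y"] zero_le_power2[of x] zero_le_power2[of y]
    by (simp add: abs_le_iff; linarith)
  then show "AE \<omega> in M. norm (X \<omega> * Y \<omega>) \<le> norm ((X \<omega>)\<^sup>2 + (Y \<omega>)\<^sup>2)" by simp
qed measurable

text \<open>Increments, sections, rescalings and restrictions to a ray all consist of elements of
  this span. Membership alone yields measurability, normality, mean 0 and finite second
  moments.\<close>

definition lin_comb :: "'i set \<Rightarrow> ('i \<Rightarrow> 'w \<Rightarrow> real) \<Rightarrow> ('w \<Rightarrow> real) set" where
  "lin_comb I X = {V. \<exists>J c. finite J \<and> J \<subseteq> I \<and> V = (\<lambda>\<omega>. \<Sum>j\<in>J. c j * X j \<omega>)}"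

lemma lin_comb_base: "i \<in> I \<Longrightarrow> X i \<in> lin_comb I X"
  unfolding lin_comb_def by (intro CollectI exI[of _ "{i}"] exI[of _ "\<lambda>_. 1"]) auto

lemma lin_comb_scale: "V \<in> lin_comb I X \<Longrightarrow> (\<lambda>\<omega>. c * V \<omega>) \<in> lin_comb I X"
proof -
  assume "V \<in> lin_comb I X"
  then obtain J d where "finite J" "J \<subseteq> I" "V = (\<lambda>\<omega>. \<Sum>j\<in>J. d j * X j \<omega>)"
    by (auto simp: lin_comb_def)
  then show ?thesis unfolding lin_comb_def
    by (intro CollectI exI[of _ J] exI[of _ "\<lambda>j. c * d j"]) (auto simp: sum_distrib_left mult.assoc)
qed

lemma lin_comb_add:
  assumes "V \<in> lin_comb I X" "U \<in> lin_comb I X"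
  shows "(\<lambda>\<omega>. V \<omega> + U \<omega>) \<in> lin_comb I X"
proof -
  obtain J c K d where J: "finite J" "J \<subseteq> I" "V = (\<lambda>\<omega>. \<Sum>j\<in>J. c j * X j \<omega>)"
    and K: "finite K" "K \<subseteq> I" "U = (\<lambda>\<omega>. \<Sum>j\<in>K. d j * X j \<omega>)"
    using assms by (auto simp: lin_comb_def)
  have "(\<Sum>j\<in>J. c j * X j \<omega>) = (\<Sum>j\<in>J \<union> K. (if j \<in> J then c j else 0) * X j \<omega>)"
    "(\<Sum>j\<in>K. d j * X j \<omega>) = (\<Sum>j\<in>J \<union> K. (if j \<in> K then d j else 0) * X j \<omega>)" for \<omega>
    using J K by (auto intro!: sum.mono_neutral_cong_left)
  then have "(\<lambda>\<omega>. V \<omega> + U \<omega>) = (\<lambda>\<omega>. \<Sum>j\<in>J \<union> K. ((if j \<in> J then c j else 0) + (if j \<in> K then d j else 0)) * X j \<omega>)"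
    unfolding J K by (simp add: sum.distrib distrib_right)
  then show ?thesis
    unfolding lin_comb_def using J K
    by (intro CollectI exI[of _ "J \<union> K"] exI[of _ "\<lambda>j. (if j \<in> J then c j else 0) + (if j \<in> K then d j else 0)"]) auto
qed

lemma lin_comb_diff:
  assumes "V \<in> lin_comb I X" "U \<in> lin_comb I X"
  shows "(\<lambda>\<omega>. V \<omega> - U \<omega>) \<in> lin_comb I X"
  using lin_comb_add[OF assms(1) lin_comb_scale[OF assms(2), of "-1"]] by simp

lemma lin_comb_sum:
  assumes "finite J" "\<And>j. j \<in> J \<Longrightarrow> V j \<in> lin_comb I X"
  shows "(\<lambda>\<omega>. \<Sum>j\<in>J. c j * V j \<omega>) \<in> lin_comb I X"
  using assms
proof (induction J)
  case empty
  show ?case unfolding lin_comb_def by (auto intro!: exI[of _ "{}"])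
next
  case (insert j J)
  then show ?case using lin_comb_add[OF lin_comb_scale[of "V j"], of I X _ "c j"] by simp
qed

lemma
  assumes "centered_gaussian_process M I X" "V \<in> lin_comb I X"
  shows lin_comb_measurable: "V \<in> borel_measurable M"
    and lin_comb_gaussian: "gaussian_rv M V"
    and lin_comb_mean: "(\<integral>\<omega>. V \<omega> \<partial>M) = 0"
    and lin_comb_square_integrable: "integrable M (\<lambda>\<omega>. (V \<omega>)\<^sup>2)"
proof -
  have X: "gaussian_rv M (X i)" "(\<integral>\<omega>. X i \<omega> \<partial>M) = 0" if "i \<in> I" for i
    using assms(1) that spec[of "\<lambda>J. \<forall>c. finite J \<and> J \<subseteq> I \<longrightarrow> gaussian_rv M (\<lambda>\<omega>. \<Sum>j\<in>J. c j * X j \<omega>)" "{i}"]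
    by (auto simp: centered_gaussian_process_def dest!: spec[of _ "\<lambda>_. 1"])
  have p: "prob_space M" using assms(1) by (simp add: centered_gaussian_process_def)
  have Xi: "integrable M (X i)" if "i \<in> I" for i
    using gaussian_rv_centered(1)[OF p] X that by blast
  obtain J c where J: "finite J" "J \<subseteq> I" "V = (\<lambda>\<omega>. \<Sum>j\<in>J. c j * X j \<omega>)"
    using assms(2) by (auto simp: lin_comb_def)
  show g: "gaussian_rv M V" using assms(1) J by (auto simp: centered_gaussian_process_def)
  then show "V \<in> borel_measurable M" by (simp add: gaussian_rv_def)
  show m: "(\<integral>\<omega>. V \<omega> \<partial>M) = 0"
    unfolding J using J X Xi by (subst Bochner_Integration.integral_sum) (auto intro!: sum.neutral)
  show "integrable M (\<lambda>\<omega>. (V \<omega>)\<^sup>2)"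
    by (rule gaussian_rv_centered(2)[OF p g m])
qed

lemma lin_comb_mult_integrable:
  assumes "centered_gaussian_process M I X" "V \<in> lin_comb I X" "U \<in> lin_comb I X"
  shows "integrable M (\<lambda>\<omega>. V \<omega> * U \<omega>)"
  using assms by (intro integrable_mult_squares lin_comb_square_integrable lin_comb_measurable)

lemma lin_comb_process:
  assumes "centered_gaussian_process M I X" "\<And>i. i \<in> I' \<Longrightarrow> Y i \<in> lin_comb I X"
  shows "centered_gaussian_process M I' Y"
  unfolding centered_gaussian_process_def
proof (intro conjI ballI allI impI)
  show "prob_space M" using assms(1) by (simp add: centered_gaussian_process_def)
  show "Y i \<in> borel_measurable M" "(\<integral>\<omega>. Y i \<omega> \<partial>M) = 0" if "i \<in> I'" for i
    using lin_comb_measurable[OF assms(1)] lin_comb_mean[OF assms(1)] assms(2)[OF that] by auto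
  show "gaussian_rv M (\<lambda>\<omega>. \<Sum>j\<in>J. c j * Y j \<omega>)" if "finite J \<and> J \<subseteq> I'" for J c
    using that assms(2) by (intro lin_comb_gaussian[OF assms(1)] lin_comb_sum) auto
qed

lemma covariance_lin_comb:
  assumes "centered_gaussian_process M I X" "V \<in> lin_comb I X" "U \<in> lin_comb I X"
  shows "covariance M V U = (\<integral>\<omega>. V \<omega> * U \<omega> \<partial>M)"
  using assms by (simp add: covariance_def lin_comb_mean)

lemma gaussian_process_cos:
  assumes "centered_gaussian_process M I X" "finite J" "J \<subseteq> I"
  shows "(\<integral>\<omega>. cos ((\<Sum>j\<in>J. t j * X j \<omega>) + \<phi>) \<partial>M) =
    cos \<phi> * exp (- (\<Sum>i\<in>J. \<Sum>j\<in>J. t i * t j * (\<integral>\<omega>. X i \<omega> * X j \<omega> \<partial>M)) / 2)"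
proof -
  have V: "(\<lambda>\<omega>. \<Sum>j\<in>J. t j * X j \<omega>) \<in> lin_comb I X"
    using assms by (intro lin_comb_sum lin_comb_base) auto
  have p: "prob_space M" using assms(1) by (simp add: centered_gaussian_process_def)
  have L: "integrable M (\<lambda>\<omega>. X i \<omega> * X j \<omega>)" if "i \<in> J" "j \<in> J" for i j
    using assms that by (intro lin_comb_mult_integrable[OF assms(1)] lin_comb_base) auto
  have "(\<integral>\<omega>. (\<Sum>j\<in>J. t j * X j \<omega>)\<^sup>2 \<partial>M) = (\<integral>\<omega>. (\<Sum>i\<in>J. \<Sum>j\<in>J. t i * t j * (X i \<omega> * X j \<omega>)) \<partial>M)"
    by (simp add: power2_eq_square sum_product mult_ac)
  also have "\<dots> = (\<Sum>i\<in>J. \<integral>\<omega>. (\<Sum>j\<in>J. t i * t j * (X i \<omega> * X j \<omega>)) \<partial>M)"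
    using L by (intro Bochner_Integration.integral_sum Bochner_Integration.integrable_sum integrable_mult_right)
  also have "\<dots> = (\<Sum>i\<in>J. \<Sum>j\<in>J. \<integral>\<omega>. t i * t j * (X i \<omega> * X j \<omega>) \<partial>M)"
    using L by (intro sum.cong refl Bochner_Integration.integral_sum integrable_mult_right)
  also have "\<dots> = (\<Sum>i\<in>J. \<Sum>j\<in>J. t i * t j * (\<integral>\<omega>. X i \<omega> * X j \<omega> \<partial>M))"
    by simp
  finally show ?thesis
    using gaussian_rv_centered(3)[OF p lin_comb_gaussian[OF assms(1) V] lin_comb_mean[OF assms(1) V], of \<phi>]
    by simp
qed

section \<open>Covariances determine finite-dimensional limits and laws\<close>

lemma trig_poly_integrable:
  assumes "prob_space M" "g \<in> trig_poly J" "\<And>j. j \<in> J \<Longrightarrow> X j \<in> borel_measurable M"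
  shows "integrable M (\<lambda>\<omega>. g (\<lambda>j\<in>J. X j \<omega>))"
proof -
  interpret prob_space M by fact
  obtain B where "\<And>x. \<bar>g x\<bar> \<le> B" using trig_poly_bounded[OF assms(2)] by blast
  then show ?thesis
    using trig_poly_measurable[OF assms(2,3)] by (intro integrable_const_bound[of _ B]) auto
qed

lemma centered_gaussian_processD:
  assumes "centered_gaussian_process M I X"
  shows "prob_space M" "i \<in> I \<Longrightarrow> X i \<in> borel_measurable M"
  using assms by (auto simp: centered_gaussian_process_def)

lemma trig_poly_tendsto:
  assumes X: "\<forall>\<^sub>F z in F. centered_gaussian_process M I (X z)"
    and Y: "centered_gaussian_process N I Y"
    and cov: "\<And>i j. i \<in> I \<Longrightarrow> j \<in> I \<Longrightarrow>
      ((\<lambda>z. \<integral>\<omega>. X z i \<omega> * X z j \<omega> \<partial>M) \<longlongrightarrow> (\<integral>\<omega>. Y i \<omega> * Y j \<omega> \<partial>N)) F"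
    and J: "finite J" "J \<subseteq> I" and g: "g \<in> trig_poly J"
  shows "((\<lambda>z. \<integral>\<omega>. g (\<lambda>j\<in>J. X z j \<omega>) \<partial>M) \<longlongrightarrow> (\<integral>\<omega>. g (\<lambda>j\<in>J. Y j \<omega>) \<partial>N)) F"
  using g
proof induction
  case (cos c t \<phi>)
  let ?Q = "\<lambda>C. c * (cos \<phi> * exp (- (\<Sum>i\<in>J. \<Sum>j\<in>J. t i * t j * C i j) / 2))"
  have eq: "(\<integral>\<omega>. c * cos ((\<Sum>j\<in>J. t j * (\<lambda>j\<in>J. Z j \<omega>) j) + \<phi>) \<partial>P) = ?Q (\<lambda>i j. \<integral>\<omega>. Z i \<omega> * Z j \<omega> \<partial>P)"
    if "centered_gaussian_process P I Z" for P :: "'x measure" and Z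
    using gaussian_process_cos[OF that J, of t \<phi>] by (simp cong: sum.cong)
  have "((\<lambda>z. ?Q (\<lambda>i j. \<integral>\<omega>. X z i \<omega> * X z j \<omega> \<partial>M)) \<longlongrightarrow> ?Q (\<lambda>i j. \<integral>\<omega>. Y i \<omega> * Y j \<omega> \<partial>N)) F"
    using J by (intro tendsto_intros cov) auto
  then show ?case
    unfolding eq[OF Y]
  proof (rule Lim_transform_eventually)
    show "\<forall>\<^sub>F z in F. ?Q (\<lambda>i j. \<integral>\<omega>. X z i \<omega> * X z j \<omega> \<partial>M) =
      (\<integral>\<omega>. c * cos ((\<Sum>j\<in>J. t j * (\<lambda>j\<in>J. X z j \<omega>) j) + \<phi>) \<partial>M)"
      using X by eventually_elim (rule eq[symmetric])
  qed
next
  case (add g h)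
  have int: "(\<integral>\<omega>. g (\<lambda>j\<in>J. Z j \<omega>) + h (\<lambda>j\<in>J. Z j \<omega>) \<partial>P) =
      (\<integral>\<omega>. g (\<lambda>j\<in>J. Z j \<omega>) \<partial>P) + (\<integral>\<omega>. h (\<lambda>j\<in>J. Z j \<omega>) \<partial>P)"
    if "centered_gaussian_process P I Z" for P :: "'x measure" and Z
    using add(1,2) J centered_gaussian_processD[OF that]
    by (intro Bochner_Integration.integral_add trig_poly_integrable) auto
  have "((\<lambda>z. (\<integral>\<omega>. g (\<lambda>j\<in>J. X z j \<omega>) \<partial>M) + (\<integral>\<omega>. h (\<lambda>j\<in>J. X z j \<omega>) \<partial>M))
     \<longlongrightarrow> (\<integral>\<omega>. g (\<lambda>j\<in>J. Y j \<omega>) \<partial>N) + (\<integral>\<omega>. h (\<lambda>j\<in>J. Y j \<omega>) \<partial>N)) F"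
    by (intro tendsto_add add.IH)
  then show ?case
    unfolding int[OF Y]
  proof (rule Lim_transform_eventually)
    show "\<forall>\<^sub>F z in F. (\<integral>\<omega>. g (\<lambda>j\<in>J. X z j \<omega>) \<partial>M) + (\<integral>\<omega>. h (\<lambda>j\<in>J. X z j \<omega>) \<partial>M) =
      (\<integral>\<omega>. g (\<lambda>j\<in>J. X z j \<omega>) + h (\<lambda>j\<in>J. X z j \<omega>) \<partial>M)"
      using X by eventually_elim (rule int[symmetric])
  qed
qed

text \<open>A Chebyshev argument. Inside the cube the error is at most \<open>\<epsilon>\<close>.
  Outside, some coordinate exceeds \<open>L\<close>, so the trivial error
  \<open>2 * B + \<epsilon>\<close> may be multiplied by the sum of squares divided by
  \<open>L\<^sup>2\<close>, which is then at least 1. Integration turns the squares into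
  variances.\<close>

lemma trig_poly_approx_integral:
  assumes X: "centered_gaussian_process M I X" and J: "finite J" "J \<subseteq> I"
    and f: "continuous_map (powertop_real J) euclideanreal f"
    and B: "\<And>x. x \<in> J \<rightarrow>\<^sub>E UNIV \<Longrightarrow> \<bar>f x\<bar> \<le> B"
    and g: "g \<in> trig_poly J" "\<And>x. x \<in> J \<rightarrow>\<^sub>E UNIV \<Longrightarrow> \<bar>g x\<bar> \<le> B + \<epsilon>"
    "\<And>x. x \<in> J \<rightarrow>\<^sub>E UNIV \<Longrightarrow> (\<And>j. j \<in> J \<Longrightarrow> \<bar>x j\<bar> \<le> L) \<Longrightarrow> \<bar>f x - g x\<bar> \<le> \<epsilon>"
    and "0 < L" "0 < \<epsilon>"
  shows "\<bar>(\<integral>\<omega>. f (\<lambda>j\<in>J. X j \<omega>) \<partial>M) - (\<integral>\<omega>. g (\<lambda>j\<in>J. X j \<omega>) \<partial>M)\<bar>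
    \<le> \<epsilon> + (2 * B + \<epsilon>) * (\<Sum>j\<in>J. \<integral>\<omega>. X j \<omega> * X j \<omega> \<partial>M) / L\<^sup>2"
proof -
  interpret prob_space M using X by (rule centered_gaussian_processD)
  have Xm: "X j \<in> borel_measurable M" if "j \<in> J" for j
    using centered_gaussian_processD[OF X] that J by blast
  have fi: "integrable M (\<lambda>\<omega>. f (\<lambda>j\<in>J. X j \<omega>))"
    using continuous_map_powertop_measurable[OF J(1) f B Xm] B
    by (intro integrable_const_bound[of _ B]) auto
  have gi: "integrable M (\<lambda>\<omega>. g (\<lambda>j\<in>J. X j \<omega>))"
    using g(1) Xm by (intro trig_poly_integrable) (auto simp: prob_space_axioms)
  have Xi: "integrable M (\<lambda>\<omega>. X j \<omega> * X j \<omega>)" if "j \<in> J" for j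
    using that J by (intro lin_comb_mult_integrable[OF X] lin_comb_base) auto
  let ?b = "\<lambda>\<omega>. \<epsilon> + (2 * B + \<epsilon>) / L\<^sup>2 * (\<Sum>j\<in>J. X j \<omega> * X j \<omega>)"
  have "B \<ge> 0" using B[of "\<lambda>j\<in>J. 0"] by auto
  have pw: "\<bar>f (\<lambda>j\<in>J. X j \<omega>) - g (\<lambda>j\<in>J. X j \<omega>)\<bar> \<le> ?b \<omega>" for \<omega>
  proof (cases "\<forall>j\<in>J. \<bar>X j \<omega>\<bar> \<le> L")
    case True
    then have "\<bar>f (\<lambda>j\<in>J. X j \<omega>) - g (\<lambda>j\<in>J. X j \<omega>)\<bar> \<le> \<epsilon>" by (intro g(3)) auto
    moreover have "0 \<le> (2 * B + \<epsilon>) / L\<^sup>2 * (\<Sum>j\<in>J. X j \<omega> * X j \<omega>)"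
    proof (rule mult_nonneg_nonneg)
      show "0 \<le> (\<Sum>j\<in>J. X j \<omega> * X j \<omega>)" by (intro sum_nonneg zero_le_square)
    qed (use \<open>B \<ge> 0\<close> \<open>0 < \<epsilon>\<close> in auto)
    ultimately show ?thesis by linarith
  next
    case False
    then obtain i where i: "i \<in> J" "L < \<bar>X i \<omega>\<bar>" by force
    have "L\<^sup>2 \<le> X i \<omega> * X i \<omega>"
      using i \<open>0 < L\<close> power_mono[of L "\<bar>X i \<omega>\<bar>" 2] by (simp add: power2_eq_square)
    also have "\<dots> \<le> (\<Sum>j\<in>J. X j \<omega> * X j \<omega>)"
      using i J by (intro member_le_sum[of i J "\<lambda>j. X j \<omega> * X j \<omega>"]) auto
    finally have "(2 * B + \<epsilon>) / L\<^sup>2 * L\<^sup>2 \<le> (2 * B + \<epsilon>) / L\<^sup>2 * (\<Sum>j\<in>J. X j \<omega> * X j \<omega>)"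
      using \<open>B \<ge> 0\<close> \<open>0 < \<epsilon>\<close> by (intro mult_left_mono) auto
    moreover have "\<bar>f (\<lambda>j\<in>J. X j \<omega>)\<bar> \<le> B" "\<bar>g (\<lambda>j\<in>J. X j \<omega>)\<bar> \<le> B + \<epsilon>"
      by (auto intro!: B g(2))
    ultimately show ?thesis using \<open>0 < L\<close> \<open>0 < \<epsilon>\<close> by simp
  qed
  have "\<bar>(\<integral>\<omega>. f (\<lambda>j\<in>J. X j \<omega>) \<partial>M) - (\<integral>\<omega>. g (\<lambda>j\<in>J. X j \<omega>) \<partial>M)\<bar> =
      \<bar>\<integral>\<omega>. f (\<lambda>j\<in>J. X j \<omega>) - g (\<lambda>j\<in>J. X j \<omega>) \<partial>M\<bar>"
    using fi gi by simp
  also have "\<dots> \<le> (\<integral>\<omega>. \<bar>f (\<lambda>j\<in>J. X j \<omega>) - g (\<lambda>j\<in>J. X j \<omega>)\<bar> \<partial>M)"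
    by (rule integral_abs_bound)
  also have "\<dots> \<le> (\<integral>\<omega>. ?b \<omega> \<partial>M)"
    using fi gi Xi by (intro integral_mono pw) auto
  also have "\<dots> = \<epsilon> + (2 * B + \<epsilon>) / L\<^sup>2 * (\<integral>\<omega>. (\<Sum>j\<in>J. X j \<omega> * X j \<omega>) \<partial>M)"
    using Xi by (subst Bochner_Integration.integral_add) (auto simp: prob_space)
  also have "(\<integral>\<omega>. (\<Sum>j\<in>J. X j \<omega> * X j \<omega>) \<partial>M) = (\<Sum>j\<in>J. \<integral>\<omega>. X j \<omega> * X j \<omega> \<partial>M)"
    using Xi by (rule Bochner_Integration.integral_sum)
  finally show ?thesis by (simp only: times_divide_eq_left)
qed

text \<open>The process is required to be Gaussian only eventually, because increments based at
  \<open>(S, T)\<close> stay in the quadrant only for nonnegative \<open>S\<close> and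
  \<open>T\<close>.\<close>

theorem fdd_converges_gaussian:
  assumes X: "\<forall>\<^sub>F z in F. centered_gaussian_process M I (X z)"
    and Y: "centered_gaussian_process N I Y"
    and cov: "\<And>i j. i \<in> I \<Longrightarrow> j \<in> I \<Longrightarrow>
      ((\<lambda>z. \<integral>\<omega>. X z i \<omega> * X z j \<omega> \<partial>M) \<longlongrightarrow> (\<integral>\<omega>. Y i \<omega> * Y j \<omega> \<partial>N)) F"
  shows "fdd_converges M I X N Y F"
  unfolding fdd_converges_def
proof (intro allI impI, elim conjE)
  fix J f assume J: "finite J" "J \<subseteq> I" and f: "continuous_map (powertop_real J) euclideanreal f"
    and "bounded (f ` (J \<rightarrow>\<^sub>E UNIV))"
  then obtain B where B: "\<And>x. x \<in> J \<rightarrow>\<^sub>E UNIV \<Longrightarrow> \<bar>f x\<bar> \<le> B"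
    unfolding bounded_iff by auto
  have B0: "B \<ge> 0" using B[of "\<lambda>j\<in>J. 0"] by auto
  let ?v = "\<lambda>z. \<Sum>j\<in>J. \<integral>\<omega>. X z j \<omega> * X z j \<omega> \<partial>M" and ?s = "\<Sum>j\<in>J. \<integral>\<omega>. Y j \<omega> * Y j \<omega> \<partial>N"
  have s0: "?s \<ge> 0" by (intro sum_nonneg integral_nonneg_AE) auto
  have v: "(?v \<longlongrightarrow> ?s) F" using J by (intro tendsto_sum cov) auto
  show "((\<lambda>z. \<integral>\<omega>. f (\<lambda>j\<in>J. X z j \<omega>) \<partial>M) \<longlongrightarrow> (\<integral>\<omega>. f (\<lambda>j\<in>J. Y j \<omega>) \<partial>N)) F"
  proof (rule tendstoI)
    fix \<eta> :: real assume \<eta>: "\<eta> > 0"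
    \<comment> \<open>The error budget: \<open>\<epsilon>\<close> and the tail term contribute at
      most \<open>\<eta> / 8\<close> each, so replacing \<open>f\<close> by \<open>g\<close> costs
      \<open>\<eta> / 4\<close> on either side, and \<open>g\<close> itself contributes another
      \<open>\<eta> / 4\<close>. The variances of \<open>X z\<close> are eventually below
      \<open>?s + 1\<close>, so one \<open>L\<close> serves all these \<open>z\<close>.\<close>
    define \<epsilon> where "\<epsilon> = min 1 (\<eta> / 8)"
    have \<epsilon>: "0 < \<epsilon>" "\<epsilon> \<le> 1" "\<epsilon> \<le> \<eta> / 8" using \<eta> by (auto simp: \<epsilon>_def)
    define a where "a = (2 * B + 1) * (?s + 1)"
    have a: "a > 0" using B0 s0 by (auto simp: a_def intro!: mult_pos_pos)
    define L where "L = sqrt (8 * a / \<eta>)"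
    have L: "0 < L" "(2 * B + 1) * (?s + 1) / L\<^sup>2 = \<eta> / 8"
      using \<eta> a unfolding a_def[symmetric] by (auto simp: L_def)
    obtain g where g: "g \<in> trig_poly J" "\<And>x. x \<in> J \<rightarrow>\<^sub>E UNIV \<Longrightarrow> \<bar>g x\<bar> \<le> B + \<epsilon>"
      "\<And>x. x \<in> J \<rightarrow>\<^sub>E UNIV \<Longrightarrow> (\<And>j. j \<in> J \<Longrightarrow> \<bar>x j\<bar> \<le> L) \<Longrightarrow> \<bar>f x - g x\<bar> \<le> \<epsilon>"
      using trig_poly_approx[OF J(1) f B L(1) \<epsilon>(1)] by blast
    have est: "\<epsilon> + (2 * B + \<epsilon>) * v / L\<^sup>2 \<le> \<eta> / 4" if "0 \<le> v" "v \<le> ?s + 1" for v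
    proof -
      have "(2 * B + \<epsilon>) * v / L\<^sup>2 \<le> (2 * B + 1) * (?s + 1) / L\<^sup>2"
        using that B0 \<epsilon> by (intro divide_right_mono mult_mono) auto
      then show ?thesis using L(2) \<epsilon> by linarith
    qed
    have approx: "\<bar>(\<integral>\<omega>. f (\<lambda>j\<in>J. Z j \<omega>) \<partial>P) - (\<integral>\<omega>. g (\<lambda>j\<in>J. Z j \<omega>) \<partial>P)\<bar>
        \<le> \<epsilon> + (2 * B + \<epsilon>) * (\<Sum>j\<in>J. \<integral>\<omega>. Z j \<omega> * Z j \<omega> \<partial>P) / L\<^sup>2"
      if "centered_gaussian_process P I Z" for P :: "'x measure" and Z
      by (rule trig_poly_approx_integral[OF that J f B g L(1) \<epsilon>(1)])
    have "\<forall>\<^sub>F z in F. ?v z < ?s + 1"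
      using order_tendstoD(2)[OF v] by simp
    moreover have "\<forall>\<^sub>F z in F. dist (\<integral>\<omega>. g (\<lambda>j\<in>J. X z j \<omega>) \<partial>M) (\<integral>\<omega>. g (\<lambda>j\<in>J. Y j \<omega>) \<partial>N) < \<eta> / 4"
      using trig_poly_tendsto[OF X Y cov J g(1)] \<eta> by (intro tendstoD) auto
    ultimately show "\<forall>\<^sub>F z in F. dist (\<integral>\<omega>. f (\<lambda>j\<in>J. X z j \<omega>) \<partial>M) (\<integral>\<omega>. f (\<lambda>j\<in>J. Y j \<omega>) \<partial>N) < \<eta>"
      using X
    proof eventually_elim
      case (elim z)
      have "0 \<le> ?v z" by (intro sum_nonneg integral_nonneg_AE) auto
      then have "\<bar>(\<integral>\<omega>. f (\<lambda>j\<in>J. X z j \<omega>) \<partial>M) - (\<integral>\<omega>. g (\<lambda>j\<in>J. X z j \<omega>) \<partial>M)\<bar> \<le> \<eta> / 4"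
        by (intro order_trans[OF approx[OF elim(3)]] est) (use elim(1) in auto)
      moreover have "\<bar>(\<integral>\<omega>. f (\<lambda>j\<in>J. Y j \<omega>) \<partial>N) - (\<integral>\<omega>. g (\<lambda>j\<in>J. Y j \<omega>) \<partial>N)\<bar> \<le> \<eta> / 4"
        by (intro order_trans[OF approx[OF Y]] est) (use s0 in auto)
      ultimately show ?case using elim(2) \<eta> unfolding dist_real_def by linarith
    qed
  qed
qed

text \<open>Equality is convergence of a constant sequence, so the convergence theorem applies to
  the constant family \<open>X\<close>.\<close>

lemma gaussian_integral_eq:
  assumes X: "centered_gaussian_process M I X" and Y: "centered_gaussian_process N I Y"
    and cov: "\<And>i j. i \<in> I \<Longrightarrow> j \<in> I \<Longrightarrow> (\<integral>\<omega>. X i \<omega> * X j \<omega> \<partial>M) = (\<integral>\<omega>. Y i \<omega> * Y j \<omega> \<partial>N)"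
    and J: "finite J" "J \<subseteq> I" and f: "continuous_map (powertop_real J) euclideanreal f"
    and b: "bounded (f ` (J \<rightarrow>\<^sub>E UNIV))"
  shows "(\<integral>\<omega>. f (\<lambda>j\<in>J. X j \<omega>) \<partial>M) = (\<integral>\<omega>. f (\<lambda>j\<in>J. Y j \<omega>) \<partial>N)"
proof -
  have "fdd_converges M I (\<lambda>_::nat. X) N Y sequentially"
    using X Y cov by (intro fdd_converges_gaussian) auto
  then have "(\<lambda>_::nat. \<integral>\<omega>. f (\<lambda>j\<in>J. X j \<omega>) \<partial>M) \<longlonglongrightarrow> (\<integral>\<omega>. f (\<lambda>j\<in>J. Y j \<omega>) \<partial>N)"
    using J f b unfolding fdd_converges_def by blast
  then show ?thesis by (simp add: LIMSEQ_const_iff)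
qed

lemma ramp_tendsto_indicator:
  "(\<lambda>n. max 0 (min 1 (1 - real n * (y - c)))) \<longlonglongrightarrow> indicator {..c} (y::real)"
proof (cases "y \<le> c")
  case True
  then have "1 - real n * (y - c) \<ge> 1" for n by (simp add: mult_nonneg_nonpos)
  then have "(\<lambda>n. max 0 (min 1 (1 - real n * (y - c)))) = (\<lambda>n. 1)" by (auto simp: min_def max_def)
  then show ?thesis using True by simp
next
  case False
  obtain N :: nat where N: "1 / (y - c) \<le> real N" using real_arch_simple by blast
  have "max 0 (min 1 (1 - real n * (y - c))) = 0" if "n \<ge> N" for n
  proof -
    have "1 / (y - c) \<le> real n" using N that by linarith
    then have "1 \<le> real n * (y - c)" using False by (simp add: field_simps)
    then show ?thesis by simp
  qed
  then have "\<forall>\<^sub>F n in sequentially. max 0 (min 1 (1 - real n * (y - c))) = 0"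
    by (auto simp: eventually_sequentially)
  then show ?thesis using False by (simp add: tendsto_eventually)
qed

text \<open>Products of ramps are bounded and continuous, so their expectations agree. They tend to
  the indicator of the orthant and are bounded by 1, so dominated convergence transfers the
  equality.\<close>

lemma gaussian_orthant_eq:
  assumes X: "centered_gaussian_process M I X" and Y: "centered_gaussian_process N I Y"
    and cov: "\<And>i j. i \<in> I \<Longrightarrow> j \<in> I \<Longrightarrow> (\<integral>\<omega>. X i \<omega> * X j \<omega> \<partial>M) = (\<integral>\<omega>. Y i \<omega> * Y j \<omega> \<partial>N)"
    and J: "finite J" "J \<subseteq> I"
  shows "(\<integral>\<omega>. (\<Prod>j\<in>J. indicator {..c j} (X j \<omega>)) \<partial>M) = (\<integral>\<omega>. (\<Prod>j\<in>J. indicator {..c j} (Y j \<omega>)) \<partial>N :: real)"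
proof -
  define \<rho> where "\<rho> n j y = max 0 (min 1 (1 - real n * (y - c j)))" for n j and y :: real
  have lim: "(\<lambda>n. \<integral>\<omega>. (\<Prod>j\<in>J. \<rho> n j (Z j \<omega>)) \<partial>P) \<longlonglongrightarrow> (\<integral>\<omega>. (\<Prod>j\<in>J. indicator {..c j} (Z j \<omega>)) \<partial>P)"
    if Z: "centered_gaussian_process P I Z" for P :: "'x measure" and Z
  proof (rule integral_dominated_convergence[where w="\<lambda>_. 1"])
    interpret prob_space P using Z by (rule centered_gaussian_processD)
    have [measurable]: "Z j \<in> borel_measurable P" if "j \<in> J" for j
      using centered_gaussian_processD[OF Z] that J by blast
    show "(\<lambda>\<omega>. \<Prod>j\<in>J. indicat_real {..c j} (Z j \<omega>)) \<in> borel_measurable P" by measurable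
    show "(\<lambda>\<omega>. \<Prod>j\<in>J. \<rho> n j (Z j \<omega>)) \<in> borel_measurable P" for n unfolding \<rho>_def by measurable
    show "integrable P (\<lambda>_. 1::real)" by simp
    show "AE \<omega> in P. (\<lambda>n. \<Prod>j\<in>J. \<rho> n j (Z j \<omega>)) \<longlonglongrightarrow> (\<Prod>j\<in>J. indicat_real {..c j} (Z j \<omega>))"
      unfolding \<rho>_def by (intro AE_I2 tendsto_prod ramp_tendsto_indicator)
    show "AE \<omega> in P. norm (\<Prod>j\<in>J. \<rho> n j (Z j \<omega>)) \<le> 1" for n
      unfolding prod_norm[symmetric] by (intro AE_I2 prod_le_1) (auto simp: \<rho>_def)
  qed
  have "(\<integral>\<omega>. (\<Prod>j\<in>J. \<rho> n j (X j \<omega>)) \<partial>M) = (\<integral>\<omega>. (\<Prod>j\<in>J. \<rho> n j (Y j \<omega>)) \<partial>N)" for n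
  proof -
    have "continuous_map (powertop_real J) euclideanreal (\<lambda>x. \<rho> n j (x j))" if "j \<in> J" for j
    proof -
      have "continuous_map (powertop_real J) euclideanreal (\<lambda>x. x j)"
        using that by (rule continuous_map_product_projection)
      moreover have "continuous_map euclideanreal euclideanreal (\<rho> n j)"
        unfolding \<rho>_def by (auto intro!: continuous_intros)
      ultimately show ?thesis using continuous_map_compose[of _ euclideanreal "\<lambda>x. x j" euclideanreal "\<rho> n j"]
        by (simp add: o_def)
    qed
    then have c: "continuous_map (powertop_real J) euclideanreal (\<lambda>x. \<Prod>j\<in>J. \<rho> n j (x j))"
      using J by (intro continuous_map_prod) auto
    have b: "bounded ((\<lambda>x. \<Prod>j\<in>J. \<rho> n j (x j)) ` (J \<rightarrow>\<^sub>E UNIV))"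
    proof -
      have "norm (\<Prod>j\<in>J. \<rho> n j (x j)) \<le> 1" for x
        unfolding prod_norm[symmetric] by (intro prod_le_1) (auto simp: \<rho>_def)
      then show ?thesis unfolding bounded_iff by blast
    qed
    show ?thesis using gaussian_integral_eq[OF X Y cov J c b] by (simp cong: prod.cong)
  qed
  then show ?thesis using LIMSEQ_unique[OF lim[OF X]] lim[OF Y] by simp
qed

text \<open>Cylinders over finitely many half-lines generate the product algebra and are stable
  under intersection, so two probability laws that agree on them coincide.\<close>

theorem process_law_gaussian_eq:
  assumes X: "centered_gaussian_process M I X" and Y: "centered_gaussian_process N I Y"
    and cov: "\<And>i j. i \<in> I \<Longrightarrow> j \<in> I \<Longrightarrow> (\<integral>\<omega>. X i \<omega> * X j \<omega> \<partial>M) = (\<integral>\<omega>. Y i \<omega> * Y j \<omega> \<partial>N)"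
  shows "process_law M I X = process_law N I Y"
proof -
  let ?\<Omega> = "I \<rightarrow>\<^sub>E (UNIV :: real set)"
  define G where "G = {{f \<in> ?\<Omega>. \<forall>i\<in>j. f i \<in> A i} | A j.
    j \<in> {j. finite j \<and> j \<subseteq> I} \<and> A \<in> Pi j (\<lambda>_. range atMost :: real set set)}"
  have sets_G: "sets (PiM I (\<lambda>_. borel :: real measure)) = sigma_sets ?\<Omega> G"
  proof -
    have "sets (PiM I (\<lambda>_. sigma UNIV (range atMost :: real set set))) = sets (sigma ?\<Omega> G)"
      unfolding G_def
    proof (rule sets_PiM_sigma)
      show "\<exists>S\<subseteq>range atMost. countable S \<and> (UNIV :: real set) = \<Union> S"
        by (rule exI[of _ "(\<lambda>n::nat. {..real n}) ` UNIV"]) (auto intro: real_arch_simple)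
    qed auto
    moreover have "G \<subseteq> Pow ?\<Omega>" by (auto simp: G_def)
    ultimately show ?thesis by (simp add: borel_eq_atMost)
  qed
  have meas: "(\<lambda>\<omega>. \<lambda>i\<in>I. Z i \<omega>) \<in> measurable P (PiM I (\<lambda>_. borel))"
    if "centered_gaussian_process P I Z" for P :: "'x measure" and Z
    using centered_gaussian_processD[OF that] by (intro measurable_restrict) auto
  have val: "emeasure (process_law P I Z) {f \<in> ?\<Omega>. \<forall>i\<in>j. f i \<in> {..c i}} =
      ennreal (\<integral>\<omega>. (\<Prod>i\<in>j. indicator {..c i} (Z i \<omega>)) \<partial>P)"
    if Z: "centered_gaussian_process P I Z" and j: "finite j" "j \<subseteq> I" for P :: "'x measure" and Z j c
  proof -
    interpret prob_space P using Z by (rule centered_gaussian_processD)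
    have [measurable]: "Z i \<in> borel_measurable P" if "i \<in> j" for i
      using centered_gaussian_processD[OF Z] that j by blast
    let ?E = "{\<omega> \<in> space P. \<forall>i\<in>j. Z i \<omega> \<le> c i}"
    have E: "?E \<in> sets P" using j by measurable
    have "{f \<in> ?\<Omega>. \<forall>i\<in>j. f i \<in> {..c i}} \<in> G"
      using j unfolding G_def by (intro CollectI exI[of _ "\<lambda>i. {..c i}"] exI[of _ j]) auto
    then have "emeasure (process_law P I Z) {f \<in> ?\<Omega>. \<forall>i\<in>j. f i \<in> {..c i}} =
       emeasure P ((\<lambda>\<omega>. \<lambda>i\<in>I. Z i \<omega>) -` {f \<in> ?\<Omega>. \<forall>i\<in>j. f i \<in> {..c i}} \<inter> space P)"
      unfolding process_law_def using sets_G by (intro emeasure_distr meas Z) auto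
    also have "(\<lambda>\<omega>. \<lambda>i\<in>I. Z i \<omega>) -` {f \<in> ?\<Omega>. \<forall>i\<in>j. f i \<in> {..c i}} \<inter> space P = ?E"
      using j by (auto simp: subset_eq)
    also have "emeasure P ?E = ennreal (\<integral>\<omega>. indicator ?E \<omega> \<partial>P)"
      using E by (simp add: emeasure_eq_measure)
    also have "(\<integral>\<omega>. indicator ?E \<omega> \<partial>P) = (\<integral>\<omega>. (\<Prod>i\<in>j. indicator {..c i} (Z i \<omega>)) \<partial>P :: real)"
      using j by (intro Bochner_Integration.integral_cong refl) (auto simp: indicator_def)
    finally show ?thesis .
  qed
  show ?thesis
  proof (rule measure_eqI_generator_eq[of G ?\<Omega> _ _ "\<lambda>_. ?\<Omega>"])
    show "Int_stable G"
    proof (rule Int_stableI)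
      fix a b assume "a \<in> G" "b \<in> G"
      then obtain A j A' j' where a: "a = {f \<in> ?\<Omega>. \<forall>i\<in>j. f i \<in> A i}" "finite j" "j \<subseteq> I" "A \<in> Pi j (\<lambda>_. range atMost)"
        and b: "b = {f \<in> ?\<Omega>. \<forall>i\<in>j'. f i \<in> A' i}" "finite j'" "j' \<subseteq> I" "A' \<in> Pi j' (\<lambda>_. range atMost)"
        by (auto simp: G_def)
      \<comment> \<open>Half-lines intersect in half-lines, so a coordinate constrained by both
        cylinders is again constrained by one half-line.\<close>
      define A'' where "A'' i = (if i \<in> j then if i \<in> j' then A i \<inter> A' i else A i else A' i)" for i
      have "a \<inter> b = {f \<in> ?\<Omega>. \<forall>i\<in>j \<union> j'. f i \<in> A'' i}"
        unfolding a b by (auto simp: A''_def)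
      moreover have "A'' \<in> Pi (j \<union> j') (\<lambda>_. range atMost)"
        using a(4) b(4) by (force simp: A''_def Pi_iff image_iff)
      ultimately show "a \<inter> b \<in> G"
        unfolding G_def using a b by (intro CollectI exI[of _ A''] exI[of _ "j \<union> j'"]) auto
    qed
    show "G \<subseteq> Pow ?\<Omega>" by (auto simp: G_def)
    show "emeasure (process_law M I X) a = emeasure (process_law N I Y) a" if aG: "a \<in> G" for a
    proof -
      obtain A j where a: "a = {f \<in> ?\<Omega>. \<forall>i\<in>j. f i \<in> A i}" "finite j" "j \<subseteq> I" "A \<in> Pi j (\<lambda>_. range atMost)"
        using aG by (auto simp: G_def)
      then have "\<forall>i\<in>j. \<exists>c. A i = {..c}" by (auto simp: Pi_iff image_iff)
      then obtain c where "\<And>i. i \<in> j \<Longrightarrow> A i = {..c i}" by metis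
      then have a': "a = {f \<in> ?\<Omega>. \<forall>i\<in>j. f i \<in> {..c i}}" using a by auto
      show ?thesis
        unfolding a' val[OF X a(2,3)] val[OF Y a(2,3)]
        using gaussian_orthant_eq[OF X Y cov a(2,3), of c] by simp
    qed
    show "sets (process_law M I X) = sigma_sets ?\<Omega> G" "sets (process_law N I Y) = sigma_sets ?\<Omega> G"
      by (simp_all add: process_law_def sets_G)
    show "range (\<lambda>_::nat. ?\<Omega>) \<subseteq> G"
      unfolding G_def by (auto intro!: exI[of _ "{}"])
    show "(\<Union>i::nat. ?\<Omega>) = ?\<Omega>" by simp
    interpret P: prob_space "process_law M I X"
      unfolding process_law_def using X meas by (intro prob_space.prob_space_distr centered_gaussian_processD) auto
    show "emeasure (process_law M I X) ?\<Omega> \<noteq> \<infinity>" for i :: nat by simp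
  qed
qed

section \<open>The sheet\<close>

text \<open>In a product filter the two variables approach their limits independently. Because the
  covariances factor, one-dimensional limits are all that the two-parameter statements
  require.\<close>

lemma tendsto_mult_prod_filter:
  fixes f :: "'a \<Rightarrow> real" and g :: "'b \<Rightarrow> real"
  assumes "(f \<longlongrightarrow> a) F" "(g \<longlongrightarrow> b) G"
  shows "((\<lambda>(x, y). f x * g y) \<longlongrightarrow> a * b) (F \<times>\<^sub>F G)"
  using tendsto_mult[OF filterlim_compose[OF assms(1) filterlim_fst] filterlim_compose[OF assms(2) filterlim_snd]]
  by (simp add: case_prod_unfold)

lemma eventually_prod_filterI:
  assumes "eventually P F" "eventually Q G" "\<And>x y. P x \<Longrightarrow> Q y \<Longrightarrow> R (x, y)"
  shows "eventually R (F \<times>\<^sub>F G)"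
  using assms by (auto simp: eventually_prod_filter)

text \<open>Used to read variances off equal laws when stationarity is assumed.\<close>

lemma process_law_integral:
  assumes "\<And>i. i \<in> I \<Longrightarrow> X i \<in> borel_measurable M" "i \<in> I"
    and [measurable]: "f \<in> borel_measurable borel"
  shows "(\<integral>x. f (x i) \<partial>process_law M I X) = (\<integral>\<omega>. f (X i \<omega>) \<partial>M :: real)"
proof -
  have "(\<lambda>\<omega>. \<lambda>i\<in>I. X i \<omega>) \<in> measurable M (PiM I (\<lambda>_. borel))"
    using assms by (intro measurable_restrict) auto
  moreover have "(\<lambda>x. f (x i)) \<in> borel_measurable (PiM I (\<lambda>_. borel))"
    using assms by measurable
  ultimately show ?thesis
    unfolding process_law_def by (subst integral_distr) (use assms in auto)
qed

lemma mem_quadrant: "(s, t) \<in> quadrant \<longleftrightarrow> 0 \<le> s \<and> 0 \<le> t"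
  by (auto simp: quadrant_def)

section \<open>Covariance structure of the sheet\<close>

locale wfb_sheet =
  fixes M :: "'w measure" and a1 b1 a2 b2 :: real and W :: "real \<times> real \<Rightarrow> 'w \<Rightarrow> real"
  assumes sheet: "weighted_fB_sheet M a1 b1 a2 b2 W"
begin

abbreviation "C1 \<equiv> wfbm_cov a1 b1"
abbreviation "C2 \<equiv> wfbm_cov a2 b2"

lemma params: "-1 < a1" "-1 < b1" "b1 \<le> 1" "-1 < a2" "-1 < b2" "b2 \<le> 1"
  and wfbm_params: "wfbm_params a1 b1" "wfbm_params a2 b2"
  and gaussian: "centered_gaussian_process M quadrant W"
  using sheet by (auto simp: weighted_fB_sheet_def wfbm_params_def)

lemma cov: "0 \<le> s \<Longrightarrow> 0 \<le> t \<Longrightarrow> 0 \<le> s' \<Longrightarrow> 0 \<le> t' \<Longrightarrow>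
    (\<integral>\<omega>. W (s, t) \<omega> * W (s', t') \<omega> \<partial>M) = C1 s s' * C2 t t'"
  using sheet by (simp add: weighted_fB_sheet_def)

lemma lin_comb_W: "0 \<le> s \<Longrightarrow> 0 \<le> t \<Longrightarrow> W (s, t) \<in> lin_comb quadrant W"
  by (rule lin_comb_base) (simp add: mem_quadrant)

lemma lin_comb_rect_incr:
  "0 \<le> s \<Longrightarrow> 0 \<le> t \<Longrightarrow> 0 \<le> s' \<Longrightarrow> 0 \<le> t' \<Longrightarrow> rect_incr W (s, t) (s', t') \<in> lin_comb quadrant W"
  unfolding rect_incr.simps by (intro lin_comb_add lin_comb_diff lin_comb_W)

lemma integrable_W_mult:
  "0 \<le> s \<Longrightarrow> 0 \<le> t \<Longrightarrow> 0 \<le> s' \<Longrightarrow> 0 \<le> t' \<Longrightarrow> integrable M (\<lambda>\<omega>. W (s, t) \<omega> * W (s', t') \<omega>)"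
  by (intro lin_comb_mult_integrable[OF gaussian] lin_comb_W)

text \<open>Bilinearity gives sixteen products of a \<open>C1\<close> term and a \<open>C2\<close>
  term. Their signs factor as well, so the sum is a product of two mixed differences.\<close>

lemma rect_incr_cov:
  assumes "0 \<le> s" "0 \<le> t" "0 \<le> s'" "0 \<le> t'" "0 \<le> p" "0 \<le> r" "0 \<le> p'" "0 \<le> r'"
  shows "(\<integral>\<omega>. rect_incr W (s, t) (s', t') \<omega> * rect_incr W (p, r) (p', r') \<omega> \<partial>M) =
    cov_incr a1 b1 s s' p p' * cov_incr a2 b2 t t' r r'"
proof -
  let ?R = "rect_incr W (p, r) (p', r')"
  have R: "?R \<in> lin_comb quadrant W" using assms by (intro lin_comb_rect_incr)
  have i: "integrable M (\<lambda>\<omega>. W (x, y) \<omega> * ?R \<omega>)" if "0 \<le> x" "0 \<le> y" for x y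
    using that by (intro lin_comb_mult_integrable[OF gaussian] lin_comb_W R)
  have 1: "(\<integral>\<omega>. W (x, y) \<omega> * ?R \<omega> \<partial>M) = C1 x p' * C2 y r' - C1 x p * C2 y r' - C1 x p' * C2 y r + C1 x p * C2 y r"
    if "0 \<le> x" "0 \<le> y" for x y
    using that assms by (simp add: right_diff_distrib distrib_left integrable_W_mult cov)
  have "(\<integral>\<omega>. rect_incr W (s, t) (s', t') \<omega> * ?R \<omega> \<partial>M) =
     (\<integral>\<omega>. W (s', t') \<omega> * ?R \<omega> - W (s, t') \<omega> * ?R \<omega> - W (s', t) \<omega> * ?R \<omega> + W (s, t) \<omega> * ?R \<omega> \<partial>M)"
    by (intro Bochner_Integration.integral_cong refl)
       (simp only: rect_incr.simps[of W s t] left_diff_distrib distrib_right)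
  also have "\<dots> = (\<integral>\<omega>. W (s', t') \<omega> * ?R \<omega> \<partial>M) - (\<integral>\<omega>. W (s, t') \<omega> * ?R \<omega> \<partial>M)
      - (\<integral>\<omega>. W (s', t) \<omega> * ?R \<omega> \<partial>M) + (\<integral>\<omega>. W (s, t) \<omega> * ?R \<omega> \<partial>M)"
    using assms by (simp add: i del: rect_incr.simps)
  also have "\<dots> = cov_incr a1 b1 s s' p p' * cov_incr a2 b2 t t' r r'"
    using assms by (simp add: 1 cov_incr_def algebra_simps del: rect_incr.simps)
  finally show ?thesis .
qed

lemma incr_cov_eq:
  assumes "0 \<le> s" "0 \<le> t" "0 \<le> s'" "0 \<le> t'" "0 \<le> p" "0 \<le> r" "0 \<le> p'" "0 \<le> r'"
  shows "incr_cov M W (s, t) (s', t') (p, r) (p', r') = cov_incr a1 b1 s s' p p' * cov_incr a2 b2 t t' r r'"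
  unfolding incr_cov_def using assms
  by (simp add: covariance_lin_comb[OF gaussian] lin_comb_rect_incr rect_incr_cov del: rect_incr.simps)

lemma rect_incr_square:
  assumes "0 \<le> s" "0 \<le> t" "s \<le> s'" "t \<le> t'"
  shows "(\<integral>\<omega>. (rect_incr W (s, t) (s', t') \<omega>)\<^sup>2 \<partial>M) = 4 * kint a1 b1 s s' s' * kint a2 b2 t t' t'"
  using rect_incr_cov[of s t s' t' s t s' t'] assms params
  by (simp add: power2_eq_square cov_incr_diag del: rect_incr.simps)

section \<open>Self-similarity, stationarity and one-parameter sections\<close>

lemma self_similar:
  assumes "0 < h" "0 < k"
  shows "process_law M quadrant (\<lambda>(s, t). W (h * s, k * t)) =
         process_law M quadrant
           (\<lambda>(s, t) \<omega>. h powr ((1 + a1 + b1) / 2) * k powr ((1 + a2 + b2) / 2) * W (s, t) \<omega>)"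
proof (rule process_law_gaussian_eq)
  show "centered_gaussian_process M quadrant (\<lambda>(s, t). W (h * s, k * t))"
    using assms by (intro lin_comb_process[OF gaussian]) (auto simp: mem_quadrant intro!: lin_comb_W)
  show "centered_gaussian_process M quadrant
      (\<lambda>(s, t) \<omega>. h powr ((1 + a1 + b1) / 2) * k powr ((1 + a2 + b2) / 2) * W (s, t) \<omega>)"
    by (intro lin_comb_process[OF gaussian]) (auto simp: mem_quadrant intro!: lin_comb_W lin_comb_scale)
  fix i j assume ij: "i \<in> quadrant" "j \<in> quadrant"
  obtain s t s' t' where [simp]: "i = (s, t)" "j = (s', t')" by fastforce
  have n: "0 \<le> s" "0 \<le> t" "0 \<le> s'" "0 \<le> t'" using ij by (auto simp: mem_quadrant)
  have sq: "x powr (g / 2) * x powr (g / 2) = x powr g" for x g :: real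
    by (simp add: powr_add[symmetric])
  let ?c = "h powr ((1 + a1 + b1) / 2) * k powr ((1 + a2 + b2) / 2)"
  have "?c * ?c = (h powr ((1 + a1 + b1) / 2) * h powr ((1 + a1 + b1) / 2)) *
      (k powr ((1 + a2 + b2) / 2) * k powr ((1 + a2 + b2) / 2))"
    by (simp only: mult_ac)
  then have c: "?c * ?c = h powr (1 + a1 + b1) * k powr (1 + a2 + b2)" by (simp only: sq)
  have "(\<integral>\<omega>. (?c * W (s, t) \<omega>) * (?c * W (s', t') \<omega>) \<partial>M) = (\<integral>\<omega>. (?c * ?c) * (W (s, t) \<omega> * W (s', t') \<omega>) \<partial>M)"
    by (intro Bochner_Integration.integral_cong refl) (simp only: mult_ac)
  also have "\<dots> = (\<integral>\<omega>. W (h * s, k * t) \<omega> * W (h * s', k * t') \<omega> \<partial>M)"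
    unfolding c using n assms params by (simp add: cov wfbm_cov_scale)
  finally show "(\<integral>\<omega>. (case i of (s, t) \<Rightarrow> W (h * s, k * t)) \<omega> * (case j of (s, t) \<Rightarrow> W (h * s, k * t)) \<omega> \<partial>M) =
    (\<integral>\<omega>. (case i of (s, t) \<Rightarrow> \<lambda>\<omega>. ?c * W (s, t) \<omega>) \<omega> * (case j of (s, t) \<Rightarrow> \<lambda>\<omega>. ?c * W (s, t) \<omega>) \<omega> \<partial>M)"
    by simp
qed

lemma increments_gaussian:
  assumes "0 \<le> h" "0 \<le> k"
  shows "centered_gaussian_process M quadrant (\<lambda>(s, t). rect_incr W (h, k) (h + s, k + t))"
  using assms
  by (intro lin_comb_process[OF gaussian])
     (auto simp: mem_quadrant simp del: rect_incr.simps intro!: lin_comb_rect_incr)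

lemma stationary_increments_iff: "stationary_increments M W \<longleftrightarrow> a1 = 0 \<and> a2 = 0"
proof
  assume stat: "stationary_increments M W"
  have sq: "kint a1 b1 h (h + s) (h + s) * kint a2 b2 k (k + t) (k + t) = kint a1 b1 0 s s * kint a2 b2 0 t t"
    if "0 \<le> h" "0 \<le> k" "0 < s" "0 < t" for h k s t
  proof -
    let ?X = "\<lambda>h k (s, t). rect_incr W (h, k) (h + s, k + t)"
    have q: "(s, t) \<in> quadrant" using that by (simp add: mem_quadrant)
    have m: "?X h k i \<in> borel_measurable M" if "0 \<le> h" "0 \<le> k" "i \<in> quadrant" for h k i
      using centered_gaussian_processD(2)[OF increments_gaussian[OF that(1,2)] that(3)] .
    have law: "process_law M quadrant (?X h k) = process_law M quadrant (?X 0 0)"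
      using stat that by (simp add: stationary_increments_def del: rect_incr.simps)
    have "(\<integral>\<omega>. (?X h k (s, t) \<omega>)\<^sup>2 \<partial>M) = (\<integral>x. (x (s, t))\<^sup>2 \<partial>process_law M quadrant (?X h k))"
      by (rule process_law_integral[where f = "\<lambda>x. x\<^sup>2", symmetric]) (rule m[OF that(1,2)], assumption, rule q, simp)
    also have "\<dots> = (\<integral>\<omega>. (?X 0 0 (s, t) \<omega>)\<^sup>2 \<partial>M)"
      unfolding law
      by (rule process_law_integral[where f = "\<lambda>x. x\<^sup>2"]) (rule m[OF order_refl order_refl], assumption, rule q, simp)
    finally show ?thesis
      using rect_incr_square[of h k "h + s" "k + t"] rect_incr_square[of 0 0 s t] that
      by (simp del: rect_incr.simps)
  qed
  have pos: "0 < kint a1 b1 0 1 1" "0 < kint a2 b2 0 1 1" using params by (auto intro!: kint_pos)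
  \<comment> \<open>With \<open>k = 0\<close> and \<open>t = 1\<close> both sides of
    \<open>sq\<close> contain the same positive second factor, which cancels and leaves shift
    invariance in the first coordinate.\<close>
  have "a1 = 0"
    using params(1,2) by (rule kint_shift_invariant_imp) (use sq[of _ 0 _ 1] pos in auto)
  moreover have "a2 = 0"
    using params(4,5) by (rule kint_shift_invariant_imp) (use sq[of 0 _ 1] pos in auto)
  ultimately show "a1 = 0 \<and> a2 = 0" ..
next
  assume a: "a1 = 0 \<and> a2 = 0"
  show "stationary_increments M W"
    unfolding stationary_increments_def
  proof (intro allI impI)
    fix h k :: real assume hk: "0 \<le> h" "0 \<le> k"
    show "process_law M quadrant (\<lambda>(s, t). rect_incr W (h, k) (h + s, k + t)) =
        process_law M quadrant (\<lambda>(s, t). rect_incr W (0, 0) (s, t))"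
    proof (rule process_law_gaussian_eq)
      show "centered_gaussian_process M quadrant (\<lambda>(s, t). rect_incr W (h, k) (h + s, k + t))"
        using hk by (rule increments_gaussian)
      show "centered_gaussian_process M quadrant (\<lambda>(s, t). rect_incr W (0, 0) (s, t))"
        using increments_gaussian[of 0 0] by (simp del: rect_incr.simps)
      fix i j assume ij: "i \<in> quadrant" "j \<in> quadrant"
      obtain s t s' t' where [simp]: "i = (s, t)" "j = (s', t')" by fastforce
      have n: "0 \<le> s" "0 \<le> t" "0 \<le> s'" "0 \<le> t'" using ij by (auto simp: mem_quadrant)
      show "(\<integral>\<omega>. (case i of (s, t) \<Rightarrow> rect_incr W (h, k) (h + s, k + t)) \<omega> *
                 (case j of (s, t) \<Rightarrow> rect_incr W (h, k) (h + s, k + t)) \<omega> \<partial>M) =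
            (\<integral>\<omega>. (case i of (s, t) \<Rightarrow> rect_incr W (0, 0) (s, t)) \<omega> *
                 (case j of (s, t) \<Rightarrow> rect_incr W (0, 0) (s, t)) \<omega> \<partial>M)"
        using n hk a params by (simp add: rect_incr_cov cov_incr_0_left_shift del: rect_incr.simps)
    qed
  qed
qed

lemma incr_cov_ordered:
  assumes "0 \<le> s" "0 \<le> t" "s < s'" "t < t'" "s' \<le> p" "t' \<le> r" "p < p'" "r < r'"
  shows "incr_cov M W (s, t) (s', t') (p, r) (p', r') =
             (LBINT u:{s..s'}. u powr a1 * ((p' - u) powr b1 - (p - u) powr b1)) *
             (LBINT v:{t..t'}. v powr a2 * ((r' - v) powr b2 - (r - v) powr b2))"
    and "b1 * b2 > 0 \<Longrightarrow> incr_cov M W (s, t) (s', t') (p, r) (p', r') > 0"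
    and "b1 * b2 = 0 \<Longrightarrow> incr_cov M W (s, t) (s', t') (p, r) (p', r') = 0"
    and "b1 * b2 < 0 \<Longrightarrow> incr_cov M W (s, t) (s', t') (p, r) (p', r') < 0"
proof -
  have eq: "incr_cov M W (s, t) (s', t') (p, r) (p', r') = cov_incr a1 b1 s s' p p' * cov_incr a2 b2 t t' r r'"
    using assms by (intro incr_cov_eq) auto
  note 1 = cov_incr_sign[OF params(1,2) assms(1,3,5,7)]
  note 2 = cov_incr_sign[OF params(4,5) assms(2,4,6,8)]
  show "incr_cov M W (s, t) (s', t') (p, r) (p', r') =
             (LBINT u:{s..s'}. u powr a1 * ((p' - u) powr b1 - (p - u) powr b1)) *
             (LBINT v:{t..t'}. v powr a2 * ((r' - v) powr b2 - (r - v) powr b2))"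
    unfolding eq using assms params by (simp add: cov_incr_disjoint_integral)
  show "b1 * b2 > 0 \<Longrightarrow> incr_cov M W (s, t) (s', t') (p, r) (p', r') > 0"
    unfolding eq using 1 2 by (auto simp: zero_less_mult_iff)
  show "b1 * b2 = 0 \<Longrightarrow> incr_cov M W (s, t) (s', t') (p, r) (p', r') = 0"
    unfolding eq using 1 2 by auto
  show "b1 * b2 < 0 \<Longrightarrow> incr_cov M W (s, t) (s', t') (p, r) (p', r') < 0"
    unfolding eq using 1 2 by (auto simp: mult_less_0_iff)
qed

lemma null_line:
  assumes "0 \<le> s" "0 \<le> t" "s = 0 \<or> t = 0"
  shows "AE \<omega> in M. W (s, t) \<omega> = 0"
proof -
  have "(\<integral>\<omega>. (W (s, t) \<omega>)\<^sup>2 \<partial>M) = 0"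
    using assms by (auto simp: power2_eq_square cov)
  then have "AE \<omega> in M. (W (s, t) \<omega>)\<^sup>2 = 0"
    using lin_comb_square_integrable[OF gaussian lin_comb_W[OF assms(1,2)]]
    by (subst (asm) integral_nonneg_eq_0_iff_AE) auto
  then show ?thesis by simp
qed

lemma section_fst_wfBm:
  assumes "0 < t"
  shows "weighted_fBm M a1 b1 (\<lambda>s \<omega>. 1 / sqrt (C2 t t) * W (s, t) \<omega>)"
  unfolding weighted_fBm_def
proof (intro conjI allI impI)
  have pos: "0 < C2 t t" using assms params by (intro wfbm_cov_diag_pos) auto
  show "centered_gaussian_process M {0..} (\<lambda>s \<omega>. 1 / sqrt (C2 t t) * W (s, t) \<omega>)"
    using assms by (intro lin_comb_process[OF gaussian] lin_comb_scale lin_comb_W) auto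
  fix u v :: real assume uv: "0 \<le> u" "0 \<le> v"
  have "(\<integral>\<omega>. (1 / sqrt (C2 t t) * W (u, t) \<omega>) * (1 / sqrt (C2 t t) * W (v, t) \<omega>) \<partial>M) =
      (\<integral>\<omega>. (1 / C2 t t) * (W (u, t) \<omega> * W (v, t) \<omega>) \<partial>M)"
    using pos by (intro Bochner_Integration.integral_cong refl) simp
  also have "\<dots> = C1 u v" using uv assms pos by (simp add: cov)
  finally show "(\<integral>\<omega>. (1 / sqrt (C2 t t) * W (u, t) \<omega>) * (1 / sqrt (C2 t t) * W (v, t) \<omega>) \<partial>M) = C1 u v" .
qed (rule wfbm_params)

lemma section_fst:
  assumes "0 \<le> t"
  shows "\<exists>c Y. weighted_fBm M a1 b1 Y \<and> (\<forall>s\<ge>0. AE \<omega> in M. W (s, t) \<omega> = c * Y s \<omega>)"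
proof (cases "t = 0")
  case True
  \<comment> \<open>The section vanishes almost surely, so \<open>c = 0\<close>. A weighted
    fractional Brownian motion on \<open>M\<close> must still be exhibited, and the section at
    \<open>t = 1\<close> provides it.\<close>
  then show ?thesis using section_fst_wfBm[of 1] null_line[of _ 0] by (intro exI[of _ 0] exI conjI) auto
next
  case False
  then have "0 < C2 t t" using assms params by (intro wfbm_cov_diag_pos) auto
  then show ?thesis using section_fst_wfBm[of t] False assms
    by (intro exI[of _ "sqrt (C2 t t)"] exI[of _ "\<lambda>s \<omega>. 1 / sqrt (C2 t t) * W (s, t) \<omega>"]) auto
qed

lemma section_snd_wfBm:
  assumes "0 < s"
  shows "weighted_fBm M a2 b2 (\<lambda>t \<omega>. 1 / sqrt (C1 s s) * W (s, t) \<omega>)"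
  unfolding weighted_fBm_def
proof (intro conjI allI impI)
  have pos: "0 < C1 s s" using assms params by (intro wfbm_cov_diag_pos) auto
  show "centered_gaussian_process M {0..} (\<lambda>t \<omega>. 1 / sqrt (C1 s s) * W (s, t) \<omega>)"
    using assms by (intro lin_comb_process[OF gaussian] lin_comb_scale lin_comb_W) auto
  fix u v :: real assume uv: "0 \<le> u" "0 \<le> v"
  have "(\<integral>\<omega>. (1 / sqrt (C1 s s) * W (s, u) \<omega>) * (1 / sqrt (C1 s s) * W (s, v) \<omega>) \<partial>M) =
      (\<integral>\<omega>. (1 / C1 s s) * (W (s, u) \<omega> * W (s, v) \<omega>) \<partial>M)"
    using pos by (intro Bochner_Integration.integral_cong refl) simp
  also have "\<dots> = C2 u v" using uv assms pos by (simp add: cov)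
  finally show "(\<integral>\<omega>. (1 / sqrt (C1 s s) * W (s, u) \<omega>) * (1 / sqrt (C1 s s) * W (s, v) \<omega>) \<partial>M) = C2 u v" .
qed (rule wfbm_params)

lemma section_snd:
  assumes "0 \<le> s"
  shows "\<exists>c Y. weighted_fBm M a2 b2 Y \<and> (\<forall>t\<ge>0. AE \<omega> in M. W (s, t) \<omega> = c * Y t \<omega>)"
proof (cases "s = 0")
  case True
  then show ?thesis using section_snd_wfBm[of 1] null_line[of 0] by (intro exI[of _ 0] exI conjI) auto
next
  case False
  then have "0 < C1 s s" using assms params by (intro wfbm_cov_diag_pos) auto
  then show ?thesis using section_snd_wfBm[of s] False assms
    by (intro exI[of _ "sqrt (C1 s s)"] exI[of _ "\<lambda>t \<omega>. 1 / sqrt (C1 s s) * W (s, t) \<omega>"]) auto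
qed

section \<open>Asymptotics of short, long and distant increments\<close>

lemma tendsto_short_increments:
  assumes "0 < s" "0 < t"
  shows "((\<lambda>(\<epsilon>, \<delta>). \<epsilon> powr (- b1 - 1) * \<delta> powr (- b2 - 1) *
              (\<integral>\<omega>. (rect_incr W (s, t) (s + \<epsilon>, t + \<delta>) \<omega>)\<^sup>2 \<partial>M))
           \<longlongrightarrow> 4 / ((1 + b1) * (1 + b2)) * s powr a1 * t powr a2)
         (at_right 0 \<times>\<^sub>F at_right 0)"
proof -
  have "((\<lambda>(\<epsilon>, \<delta>). 4 * (\<epsilon> powr (- b1 - 1) * kint a1 b1 s (s + \<epsilon>) (s + \<epsilon>)) *
      (\<delta> powr (- b2 - 1) * kint a2 b2 t (t + \<delta>) (t + \<delta>))) \<longlongrightarrow>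
      4 * (s powr a1 / (1 + b1)) * (t powr a2 / (1 + b2))) (at_right 0 \<times>\<^sub>F at_right 0)"
    using assms params by (intro tendsto_mult_prod_filter tendsto_mult_left tendsto_kint_short)
  also have "4 * (s powr a1 / (1 + b1)) * (t powr a2 / (1 + b2)) = 4 / ((1 + b1) * (1 + b2)) * s powr a1 * t powr a2"
    by simp
  finally show ?thesis
  proof (rule Lim_transform_eventually)
    show "\<forall>\<^sub>F z in at_right 0 \<times>\<^sub>F at_right 0.
      (case z of (\<epsilon>, \<delta>) \<Rightarrow> 4 * (\<epsilon> powr (- b1 - 1) * kint a1 b1 s (s + \<epsilon>) (s + \<epsilon>)) *
        (\<delta> powr (- b2 - 1) * kint a2 b2 t (t + \<delta>) (t + \<delta>))) =
      (case z of (\<epsilon>, \<delta>) \<Rightarrow> \<epsilon> powr (- b1 - 1) * \<delta> powr (- b2 - 1) *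
              (\<integral>\<omega>. (rect_incr W (s, t) (s + \<epsilon>, t + \<delta>) \<omega>)\<^sup>2 \<partial>M))"
      by (rule eventually_prod_filterI[OF eventually_at_right_less[of 0] eventually_at_right_less[of 0]])
         (use assms in \<open>simp add: rect_incr_square del: rect_incr.simps\<close>)
  qed
qed

lemma tendsto_long_increments:
  assumes "0 \<le> s" "0 \<le> t"
  shows "((\<lambda>(S, T). S powr (- (1 + a1 + b1)) * T powr (- (1 + a2 + b2)) *
              (\<integral>\<omega>. (rect_incr W (s, t) (s + S, t + T) \<omega>)\<^sup>2 \<partial>M))
           \<longlongrightarrow> 4 * kint a1 b1 0 1 1 * kint a2 b2 0 1 1)
         (at_top \<times>\<^sub>F at_top)"
proof -
  have "((\<lambda>(S, T). 4 * (S powr (- (1 + a1 + b1)) * kint a1 b1 s (s + S) (s + S)) *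
      (T powr (- (1 + a2 + b2)) * kint a2 b2 t (t + T) (t + T))) \<longlongrightarrow>
      4 * kint a1 b1 0 1 1 * kint a2 b2 0 1 1) (at_top \<times>\<^sub>F at_top)"
    using assms params by (intro tendsto_mult_prod_filter tendsto_mult_left tendsto_kint_long)
  then show ?thesis
  proof (rule Lim_transform_eventually)
    show "\<forall>\<^sub>F z in at_top \<times>\<^sub>F at_top.
      (case z of (S, T) \<Rightarrow> 4 * (S powr (- (1 + a1 + b1)) * kint a1 b1 s (s + S) (s + S)) *
        (T powr (- (1 + a2 + b2)) * kint a2 b2 t (t + T) (t + T))) =
      (case z of (S, T) \<Rightarrow> S powr (- (1 + a1 + b1)) * T powr (- (1 + a2 + b2)) *
              (\<integral>\<omega>. (rect_incr W (s, t) (s + S, t + T) \<omega>)\<^sup>2 \<partial>M))"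
      by (rule eventually_prod_filterI[OF eventually_ge_at_top[of 0] eventually_ge_at_top[of 0]])
         (use assms in \<open>simp add: rect_incr_square del: rect_incr.simps\<close>)
  qed
qed

text \<open>The normalized mean squares have the same positive limit at every base point, and the
  normalization cancels in their quotient.\<close>

lemma asymp_stationary_long: "asymp_stationary_increments M W quadrant (at_top \<times>\<^sub>F at_top)"
  unfolding asymp_stationary_increments_def
proof (intro ballI, clarify)
  fix s t p r assume z: "(s, t) \<in> quadrant" "(p, r) \<in> quadrant"
  let ?E = "\<lambda>s t (x, y). \<integral>\<omega>. (rect_incr W (s, t) (s + x, t + y) \<omega>)\<^sup>2 \<partial>M"
  let ?w = "\<lambda>(S, T). S powr (- (1 + a1 + b1)) * T powr (- (1 + a2 + b2))"
  let ?l = "4 * kint a1 b1 0 1 1 * kint a2 b2 0 1 1"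
  have l: "?l > 0" using params kint_pos[of a1 b1 0 1 1] kint_pos[of a2 b2 0 1 1] by simp
  have lim: "((\<lambda>z. ?w z * ?E s t z) \<longlongrightarrow> ?l) (at_top \<times>\<^sub>F at_top)" if "(s, t) \<in> quadrant" for s t
    using tendsto_long_increments[of s t] that
    by (simp add: mem_quadrant case_prod_unfold del: rect_incr.simps)
  have "((\<lambda>z. (?w z * ?E s t z) / (?w z * ?E p r z)) \<longlongrightarrow> ?l / ?l) (at_top \<times>\<^sub>F at_top)"
    using l by (intro tendsto_divide lim z) auto
  moreover have "?l / ?l = 1" by (rule divide_self) (use l in linarith)
  ultimately have "((\<lambda>z. (?w z * ?E s t z) / (?w z * ?E p r z)) \<longlongrightarrow> 1) (at_top \<times>\<^sub>F at_top)"
    by (simp only:)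
  then show "((\<lambda>(x, y). (\<integral>\<omega>. (rect_incr W (s, t) (s + x, t + y) \<omega>)\<^sup>2 \<partial>M) /
       (\<integral>\<omega>. (rect_incr W (p, r) (p + x, r + y) \<omega>)\<^sup>2 \<partial>M)) \<longlongrightarrow> 1) (at_top \<times>\<^sub>F at_top)"
    by (rule Lim_transform_eventually,
        intro eventually_prod_filterI[OF eventually_gt_at_top[of 0] eventually_gt_at_top[of 0]])
       (simp del: rect_incr.simps)
qed

text \<open>For the base points \<open>(2, 1)\<close> and \<open>(1, 1)\<close> the quotient of the
  mean squares tends to \<open>2 powr a1\<close>, which differs from 1.\<close>

lemma not_asymp_stationary_short:
  assumes "a1 \<noteq> 0"
  shows "\<not> asymp_stationary_increments M W ({0<..} \<times> {0<..}) (at_right 0 \<times>\<^sub>F at_right 0)"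
proof
  assume as: "asymp_stationary_increments M W ({0<..} \<times> {0<..}) (at_right 0 \<times>\<^sub>F at_right 0)"
  let ?E = "\<lambda>s t (x, y). \<integral>\<omega>. (rect_incr W (s, t) (s + x, t + y) \<omega>)\<^sup>2 \<partial>M"
  let ?w = "\<lambda>(x, y). x powr (- b1 - 1) * y powr (- b2 - 1)"
  let ?l = "\<lambda>s t. 4 / ((1 + b1) * (1 + b2)) * s powr a1 * t powr a2"
  have lim: "((\<lambda>z. ?w z * ?E s t z) \<longlongrightarrow> ?l s t) (at_right 0 \<times>\<^sub>F at_right 0)" if "0 < s" "0 < t" for s t
    using tendsto_short_increments[of s t] that
    by (simp add: case_prod_unfold del: rect_incr.simps)
  have 1: "((\<lambda>z. (?w z * ?E 2 1 z) / (?w z * ?E 1 1 z)) \<longlongrightarrow> ?l 2 1 / ?l 1 1) (at_right 0 \<times>\<^sub>F at_right 0)"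
    using params by (intro tendsto_divide lim) auto
  have "((\<lambda>(x, y). ?E 2 1 (x, y) / ?E 1 1 (x, y)) \<longlongrightarrow> 1) (at_right 0 \<times>\<^sub>F at_right 0)"
    using as unfolding asymp_stationary_increments_def by force
  then have 2: "((\<lambda>z. (?w z * ?E 2 1 z) / (?w z * ?E 1 1 z)) \<longlongrightarrow> 1) (at_right 0 \<times>\<^sub>F at_right 0)"
    by (rule Lim_transform_eventually,
        intro eventually_prod_filterI[OF eventually_at_right_less[of 0] eventually_at_right_less[of 0]])
       (simp del: rect_incr.simps)
  have "?l 2 1 / ?l 1 1 = 1"
    by (rule tendsto_unique[OF _ 1 2]) (simp add: prod_filter_eq_bot)
  then have "2 powr a1 = (1::real)" using params by (simp add: divide_eq_1_iff)
  then show False using assms by (simp add: powr_def)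
qed

lemma fdd_converges_fB_sheet:
  assumes B: "fB_sheet N ((1 + b1) / 2) ((1 + b2) / 2) B"
  shows "fdd_converges M quadrant
           (\<lambda>(S, T) (s, t) \<omega>. S powr (- a1 / 2) * T powr (- a2 / 2) *
              rect_incr W (S, T) (s + S, t + T) \<omega>)
           N (\<lambda>(s, t) \<omega>. 2 / sqrt ((1 + b1) * (1 + b2)) * B (s, t) \<omega>)
           (at_top \<times>\<^sub>F at_top)"
proof (rule fdd_converges_gaussian)
  show "\<forall>\<^sub>F z in at_top \<times>\<^sub>F at_top. centered_gaussian_process M quadrant
      ((\<lambda>(S, T) (s, t) \<omega>. S powr (- a1 / 2) * T powr (- a2 / 2) * rect_incr W (S, T) (s + S, t + T) \<omega>) z)"
    by (rule eventually_prod_filterI[OF eventually_ge_at_top[of 0] eventually_ge_at_top[of 0]])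
       (auto simp: mem_quadrant simp del: rect_incr.simps
         intro!: lin_comb_process[OF gaussian] lin_comb_scale lin_comb_rect_incr)
  have gB: "centered_gaussian_process N quadrant B" using B by (simp add: fB_sheet_def)
  show "centered_gaussian_process N quadrant (\<lambda>(s, t) \<omega>. 2 / sqrt ((1 + b1) * (1 + b2)) * B (s, t) \<omega>)"
  proof (rule lin_comb_process[OF gB])
    show "(case i of (s, t) \<Rightarrow> \<lambda>\<omega>. 2 / sqrt ((1 + b1) * (1 + b2)) * B (s, t) \<omega>) \<in> lin_comb quadrant B"
      if "i \<in> quadrant" for i
      using that by (cases i) (simp only: prod.case, rule lin_comb_scale, rule lin_comb_base)
  qed
  fix i j assume ij: "i \<in> quadrant" "j \<in> quadrant"
  obtain s t s' t' where [simp]: "i = (s, t)" "j = (s', t')" by fastforce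
  have n: "0 \<le> s" "0 \<le> t" "0 \<le> s'" "0 \<le> t'" using ij by (auto simp: mem_quadrant)
  \<comment> \<open>Its square is \<open>2 / (1 + b1) * (2 / (1 + b2))\<close>, the product of the
    two constants in \<open>tendsto_cov_incr_shift\<close>.\<close>
  let ?c = "2 / sqrt ((1 + b1) * (1 + b2))"
  let ?l = "2 / (1 + b1) * fBm_cov ((1 + b1) / 2) s s' * (2 / (1 + b2) * fBm_cov ((1 + b2) / 2) t t')"
  have "?c * ?c = 2 / (1 + b1) * (2 / (1 + b2))" using params by simp
  moreover have "(\<integral>\<omega>. (?c * B (s, t) \<omega>) * (?c * B (s', t') \<omega>) \<partial>N) = (\<integral>\<omega>. (?c * ?c) * (B (s, t) \<omega> * B (s', t') \<omega>) \<partial>N)"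
    by (intro Bochner_Integration.integral_cong refl) (simp only: mult_ac)
  ultimately have Y: "(\<integral>\<omega>. (?c * B (s, t) \<omega>) * (?c * B (s', t') \<omega>) \<partial>N) = ?l"
    using B n by (simp add: fB_sheet_def)
  have "((\<lambda>(S, T). (S powr (- a1) * cov_incr a1 b1 S (S + s) S (S + s')) *
      (T powr (- a2) * cov_incr a2 b2 T (T + t) T (T + t'))) \<longlongrightarrow> ?l) (at_top \<times>\<^sub>F at_top)"
    using params n by (intro tendsto_mult_prod_filter tendsto_cov_incr_shift)
  then have "((\<lambda>(S, T). \<integral>\<omega>. (S powr (- a1 / 2) * T powr (- a2 / 2) * rect_incr W (S, T) (s + S, t + T) \<omega>) *
      (S powr (- a1 / 2) * T powr (- a2 / 2) * rect_incr W (S, T) (s' + S, t' + T) \<omega>) \<partial>M) \<longlongrightarrow> ?l) (at_top \<times>\<^sub>F at_top)"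
  proof (rule Lim_transform_eventually,
      intro eventually_prod_filterI[OF eventually_gt_at_top[of 0] eventually_gt_at_top[of 0]])
    fix S T :: real assume ST: "0 < S" "0 < T"
    let ?d = "S powr (- a1 / 2) * T powr (- a2 / 2)"
    have sq: "x powr (- g / 2) * x powr (- g / 2) = x powr (- g)" for x g :: real
      by (simp add: powr_add[symmetric])
    have "?d * ?d = (S powr (- a1 / 2) * S powr (- a1 / 2)) * (T powr (- a2 / 2) * T powr (- a2 / 2))"
      by (simp only: mult_ac)
    then have d: "?d * ?d = S powr (- a1) * T powr (- a2)" by (simp only: sq)
    have "(\<integral>\<omega>. (?d * rect_incr W (S, T) (s + S, t + T) \<omega>) * (?d * rect_incr W (S, T) (s' + S, t' + T) \<omega>) \<partial>M) =
      (\<integral>\<omega>. (?d * ?d) * (rect_incr W (S, T) (s + S, t + T) \<omega> * rect_incr W (S, T) (s' + S, t' + T) \<omega>) \<partial>M)"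
      by (intro Bochner_Integration.integral_cong refl) (simp only: mult_ac)
    also have "\<dots> = (S powr (- a1) * cov_incr a1 b1 S (S + s) S (S + s')) *
      (T powr (- a2) * cov_incr a2 b2 T (T + t) T (T + t'))"
      unfolding d using ST n by (simp add: rect_incr_cov add.commute del: rect_incr.simps)
    finally show "(case (S, T) of (S, T) \<Rightarrow> (S powr (- a1) * cov_incr a1 b1 S (S + s) S (S + s')) *
      (T powr (- a2) * cov_incr a2 b2 T (T + t) T (T + t'))) =
      (case (S, T) of (S, T) \<Rightarrow> \<integral>\<omega>. (S powr (- a1 / 2) * T powr (- a2 / 2) * rect_incr W (S, T) (s + S, t + T) \<omega>) *
      (S powr (- a1 / 2) * T powr (- a2 / 2) * rect_incr W (S, T) (s' + S, t' + T) \<omega>) \<partial>M)"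
      by (simp del: rect_incr.simps)
  qed
  then show "((\<lambda>z. \<integral>\<omega>. (\<lambda>(S, T) (s, t) \<omega>. S powr (- a1 / 2) * T powr (- a2 / 2) * rect_incr W (S, T) (s + S, t + T) \<omega>) z i \<omega> *
      (\<lambda>(S, T) (s, t) \<omega>. S powr (- a1 / 2) * T powr (- a2 / 2) * rect_incr W (S, T) (s + S, t + T) \<omega>) z j \<omega> \<partial>M)
     \<longlongrightarrow> (\<integral>\<omega>. (case i of (s, t) \<Rightarrow> \<lambda>\<omega>. ?c * B (s, t) \<omega>) \<omega> * (case j of (s, t) \<Rightarrow> \<lambda>\<omega>. ?c * B (s, t) \<omega>) \<omega> \<partial>N)) (at_top \<times>\<^sub>F at_top)"
    unfolding \<open>i = _\<close> \<open>j = _\<close> prod.case Y by (simp add: case_prod_unfold del: rect_incr.simps)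
qed

lemma tendsto_incr_cov_far:
  assumes "0 \<le> s" "0 \<le> t" "s < s'" "t < t'" "0 \<le> p" "0 \<le> u" "p < p'" "u < u'"
  shows "((\<lambda>(\<tau>, \<kappa>). \<tau> powr (1 - b1) * \<kappa> powr (1 - b2) *
              incr_cov M W (s, t) (s', t') (p + \<tau>, u + \<kappa>) (p' + \<tau>, u' + \<kappa>))
           \<longlongrightarrow> b1 * b2 / ((1 + a1) * (1 + a2)) *
                 (p' - p) * (s' powr (1 + a1) - s powr (1 + a1)) *
                 (u' - u) * (t' powr (1 + a2) - t powr (1 + a2)))
         (at_top \<times>\<^sub>F at_top)"
proof -
  have "((\<lambda>(\<tau>, \<kappa>). (\<tau> powr (1 - b1) * (kint a1 b1 s s' (p' + \<tau>) - kint a1 b1 s s' (p + \<tau>))) *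
      (\<kappa> powr (1 - b2) * (kint a2 b2 t t' (u' + \<kappa>) - kint a2 b2 t t' (u + \<kappa>)))) \<longlongrightarrow>
      (b1 * (p' - p) * ((s' powr (1 + a1) - s powr (1 + a1)) / (1 + a1))) *
      (b2 * (u' - u) * ((t' powr (1 + a2) - t powr (1 + a2)) / (1 + a2)))) (at_top \<times>\<^sub>F at_top)"
    using assms params by (intro tendsto_mult_prod_filter tendsto_kint_diff) auto
  also have "(b1 * (p' - p) * ((s' powr (1 + a1) - s powr (1 + a1)) / (1 + a1))) *
      (b2 * (u' - u) * ((t' powr (1 + a2) - t powr (1 + a2)) / (1 + a2))) =
      b1 * b2 / ((1 + a1) * (1 + a2)) * (p' - p) * (s' powr (1 + a1) - s powr (1 + a1)) *
                 (u' - u) * (t' powr (1 + a2) - t powr (1 + a2))"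
    by (simp add: mult_ac)
  finally show ?thesis
  proof (rule Lim_transform_eventually)
    show "\<forall>\<^sub>F z in at_top \<times>\<^sub>F at_top.
      (case z of (\<tau>, \<kappa>) \<Rightarrow> (\<tau> powr (1 - b1) * (kint a1 b1 s s' (p' + \<tau>) - kint a1 b1 s s' (p + \<tau>))) *
      (\<kappa> powr (1 - b2) * (kint a2 b2 t t' (u' + \<kappa>) - kint a2 b2 t t' (u + \<kappa>)))) =
      (case z of (\<tau>, \<kappa>) \<Rightarrow> \<tau> powr (1 - b1) * \<kappa> powr (1 - b2) *
              incr_cov M W (s, t) (s', t') (p + \<tau>, u + \<kappa>) (p' + \<tau>, u' + \<kappa>))"
    \<comment> \<open>From here on the shifted rectangle lies beyond the fixed one in both
      coordinates, since \<open>p\<close> and \<open>u\<close> are nonnegative; so the formula for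
      disjoint increments applies.\<close>
    proof (rule eventually_prod_filterI[OF eventually_ge_at_top[of s'] eventually_ge_at_top[of t']])
      fix \<tau> \<kappa> assume "s' \<le> \<tau>" "t' \<le> \<kappa>"
      then show "(case (\<tau>, \<kappa>) of (\<tau>, \<kappa>) \<Rightarrow> (\<tau> powr (1 - b1) * (kint a1 b1 s s' (p' + \<tau>) - kint a1 b1 s s' (p + \<tau>))) *
      (\<kappa> powr (1 - b2) * (kint a2 b2 t t' (u' + \<kappa>) - kint a2 b2 t t' (u + \<kappa>)))) =
      (case (\<tau>, \<kappa>) of (\<tau>, \<kappa>) \<Rightarrow> \<tau> powr (1 - b1) * \<kappa> powr (1 - b2) *
              incr_cov M W (s, t) (s', t') (p + \<tau>, u + \<kappa>) (p' + \<tau>, u' + \<kappa>))"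
        using assms params by (simp add: incr_cov_eq cov_incr_disjoint mult_ac)
    qed
  qed
qed

section \<open>Restriction to a ray\<close>

lemma ray_cov:
  assumes "0 < \<theta>" "0 \<le> s" "0 \<le> t"
  shows "(\<integral>\<omega>. W (s, \<theta> * s) \<omega> * W (t, \<theta> * t) \<omega> \<partial>M) = \<theta> powr (1 + a2 + b2) * (C1 s t * C2 s t)"
  using assms params by (simp add: cov wfbm_cov_scale)

lemma ray_not_wfBm:
  assumes "0 < \<theta>" "weighted_fBm M a b (\<lambda>t. W (t, \<theta> * t))"
  shows "b1 = 0 \<and> b2 = 0"
proof -
  have ab: "wfbm_params a b" "-1 < a" "-1 < b" using assms by (auto simp: weighted_fBm_def wfbm_params_def)
  let ?K = "\<theta> powr (1 + a2 + b2)"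
  have fact: "?K * (C1 s t * C2 s t) = wfbm_cov a b s t" if "0 \<le> s" "0 \<le> t" for s t
    using assms that ray_cov[of \<theta> s t] by (simp add: weighted_fBm_def)
  \<comment> \<open>Comparing the variances at times 2 and 1 equates the degrees of homogeneity of
    both sides, which the locale needs.\<close>
  have "2 powr (1 + a + b) * wfbm_cov a b 1 1 = ?K * (C1 (2 * 1) (2 * 1) * C2 (2 * 1) (2 * 1))"
    using fact[of 2 2] wfbm_cov_scale[OF ab(2,3), of 2 1 1] by simp
  also have "\<dots> = 2 powr (1 + a1 + b1) * 2 powr (1 + a2 + b2) * (?K * (C1 1 1 * C2 1 1))"
    using params by (subst (1 2) wfbm_cov_scale) auto
  also have "\<dots> = 2 powr ((1 + a1 + b1) + (1 + a2 + b2)) * wfbm_cov a b 1 1"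
    using fact[of 1 1] by (simp add: powr_add)
  finally have "2 powr (1 + a + b) = 2 powr ((1 + a1 + b1) + (1 + a2 + b2))"
    using wfbm_cov_diag_pos[OF ab(2,3), of 1] by simp
  then have "1 + a + b = (1 + a1 + b1) + (1 + a2 + b2)"
    by (subst (asm) powr_inj) auto
  then interpret cov_factorization a b a1 b1 a2 b2 ?K
    using ab wfbm_params fact assms by unfold_locales auto
  show ?thesis by (rule both_zero)
qed

text \<open>Homogeneity in the second coordinate extracts the power of \<open>\<theta>\<close>. The
  covariance is then the difference of the contributions of \<open>v\<close> and \<open>u\<close>,
  and each of them is covered by \<open>tendsto_wfbm_cov_prod_diff\<close>.\<close>

lemma tendsto_ray_cov:
  assumes "0 < \<theta>" "0 \<le> b1" "0 \<le> b2" "\<not> (b1 = 0 \<and> b2 = 0)" "0 \<le> u" "u < v" "0 \<le> s" "s < t"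
  shows "((\<lambda>\<tau>. \<tau> powr (1 - (b1 + b2)) *
                covariance M (\<lambda>\<omega>. W (v, \<theta> * v) \<omega> - W (u, \<theta> * u) \<omega>)
                  (\<lambda>\<omega>. W (t + \<tau>, \<theta> * (t + \<tau>)) \<omega> - W (s + \<tau>, \<theta> * (s + \<tau>)) \<omega>))
             \<longlongrightarrow> (if b1 = 0 \<or> b2 = 0 then 2 else 1) *
                   (\<theta> powr (1 + a2 + b2) * (b1 + b2) / ((1 + a1) * (1 + a2)) *
                    (v powr (2 + a1 + a2) - u powr (2 + a1 + a2)) * (t - s)))
           at_top"
proof -
  let ?K = "\<theta> powr (1 + a2 + b2)"
  let ?D = "\<lambda>v \<tau>. C1 v (t + \<tau>) * C2 v (t + \<tau>) - C1 v (s + \<tau>) * C2 v (s + \<tau>)"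
  let ?l = "\<lambda>v. (if b1 = 0 \<or> b2 = 0 then 2 else 1) *
       ((b1 + b2) / ((1 + a1) * (1 + a2)) * v powr (2 + a1 + a2) * (t - s))"
  have "((\<lambda>\<tau>. ?K * (\<tau> powr (1 - (b1 + b2)) * ?D v \<tau> - \<tau> powr (1 - (b1 + b2)) * ?D u \<tau>)) \<longlongrightarrow> ?K * (?l v - ?l u)) at_top"
    using assms params by (intro tendsto_mult tendsto_const tendsto_diff tendsto_wfbm_cov_prod_diff) auto
  also have "?K * (?l v - ?l u) = (if b1 = 0 \<or> b2 = 0 then 2 else 1) *
                   (\<theta> powr (1 + a2 + b2) * (b1 + b2) / ((1 + a1) * (1 + a2)) *
                    (v powr (2 + a1 + a2) - u powr (2 + a1 + a2)) * (t - s))"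
  proof -
    have "K * (m * (q / d * x * y) - m * (q / d * x' * y)) = m * (K * q / d * (x - x') * y)"
      for K m q d x x' y :: real
    proof -
      have "K * (m * (q / d * x * y) - m * (q / d * x' * y)) = m * (K * (q / d) * (x - x') * y)"
        by (simp only: right_diff_distrib left_diff_distrib mult_ac)
      then show ?thesis by simp
    qed
    then show ?thesis .
  qed
  finally show ?thesis
  proof (rule Lim_transform_eventually)
    show "\<forall>\<^sub>F \<tau> in at_top. ?K * (\<tau> powr (1 - (b1 + b2)) * ?D v \<tau> - \<tau> powr (1 - (b1 + b2)) * ?D u \<tau>) =
      \<tau> powr (1 - (b1 + b2)) *
                covariance M (\<lambda>\<omega>. W (v, \<theta> * v) \<omega> - W (u, \<theta> * u) \<omega>)
                  (\<lambda>\<omega>. W (t + \<tau>, \<theta> * (t + \<tau>)) \<omega> - W (s + \<tau>, \<theta> * (s + \<tau>)) \<omega>)"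
      using eventually_ge_at_top[of 0]
    proof eventually_elim
      case (elim \<tau>)
      let ?Z = "\<lambda>t. W (t, \<theta> * t)"
      have n: "0 \<le> v" "0 \<le> t + \<tau>" "0 \<le> s + \<tau>" using assms elim by auto
      have Z: "?Z x \<in> lin_comb quadrant W" if "0 \<le> x" for x using that assms by (intro lin_comb_W) auto
      have "covariance M (\<lambda>\<omega>. ?Z v \<omega> - ?Z u \<omega>) (\<lambda>\<omega>. ?Z (t + \<tau>) \<omega> - ?Z (s + \<tau>) \<omega>) =
        (\<integral>\<omega>. (?Z v \<omega> - ?Z u \<omega>) * (?Z (t + \<tau>) \<omega> - ?Z (s + \<tau>) \<omega>) \<partial>M)"
        using n assms by (intro covariance_lin_comb[OF gaussian] lin_comb_diff Z)
      also have "\<dots> = (\<integral>\<omega>. ?Z v \<omega> * ?Z (t + \<tau>) \<omega> - ?Z v \<omega> * ?Z (s + \<tau>) \<omega>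
         - (?Z u \<omega> * ?Z (t + \<tau>) \<omega> - ?Z u \<omega> * ?Z (s + \<tau>) \<omega>) \<partial>M)"
        by (intro Bochner_Integration.integral_cong refl) (simp add: algebra_simps)
      also have "\<dots> = (\<integral>\<omega>. ?Z v \<omega> * ?Z (t + \<tau>) \<omega> \<partial>M) - (\<integral>\<omega>. ?Z v \<omega> * ?Z (s + \<tau>) \<omega> \<partial>M)
         - ((\<integral>\<omega>. ?Z u \<omega> * ?Z (t + \<tau>) \<omega> \<partial>M) - (\<integral>\<omega>. ?Z u \<omega> * ?Z (s + \<tau>) \<omega> \<partial>M))"
        using n assms by (simp add: integrable_W_mult)
      also have "\<dots> = ?K * (?D v \<tau> - ?D u \<tau>)"
        using n assms by (simp only: ray_cov right_diff_distrib)
      finally have c: "covariance M (\<lambda>\<omega>. ?Z v \<omega> - ?Z u \<omega>) (\<lambda>\<omega>. ?Z (t + \<tau>) \<omega> - ?Z (s + \<tau>) \<omega>) =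
        ?K * (?D v \<tau> - ?D u \<tau>)" .
      show ?case unfolding c by (simp only: right_diff_distrib mult_ac)
    qed
  qed
qed

end

theorem theorem2p1:
  fixes M :: "'w measure" and W :: "real \<times> real \<Rightarrow> 'w \<Rightarrow> real"
    and a1 b1 a2 b2 :: real
  assumes "-1 < a1" "-1 < b1" "b1 \<le> 1" "\<bar>b1\<bar> \<le> 1 + a1"
    and "-1 < a2" "-1 < b2" "b2 \<le> 1" "\<bar>b2\<bar> \<le> 1 + a2"
    and "weighted_fB_sheet M a1 b1 a2 b2 W"
  shows "(\<forall>h>0. \<forall>k>0.
         process_law M quadrant (\<lambda>(s, t). W (h * s, k * t)) =
         process_law M quadrant
           (\<lambda>(s, t) \<omega>. h powr ((1 + a1 + b1) / 2) * k powr ((1 + a2 + b2) / 2) * W (s, t) \<omega>)) \<and>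
    (stationary_increments M W \<longleftrightarrow> a1 = 0 \<and> a2 = 0) \<and>
    (\<forall>s t s' t' p r p' r'.
         0 \<le> s \<and> 0 \<le> t \<and> s < s' \<and> t < t' \<and> s' \<le> p \<and> t' \<le> r \<and> p < p' \<and> r < r' \<longrightarrow>
           incr_cov M W (s, t) (s', t') (p, r) (p', r') =
             (LBINT u:{s..s'}. u powr a1 * ((p' - u) powr b1 - (p - u) powr b1)) *
             (LBINT v:{t..t'}. v powr a2 * ((r' - v) powr b2 - (r - v) powr b2)) \<and>
           (b1 * b2 > 0 \<longrightarrow> incr_cov M W (s, t) (s', t') (p, r) (p', r') > 0) \<and>
           (b1 * b2 = 0 \<longrightarrow> incr_cov M W (s, t) (s', t') (p, r) (p', r') = 0) \<and>
           (b1 * b2 < 0 \<longrightarrow> incr_cov M W (s, t) (s', t') (p, r) (p', r') < 0)) \<and>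
    (\<forall>t\<ge>0. \<exists>c Y. weighted_fBm M a1 b1 Y \<and> (\<forall>s\<ge>0. AE \<omega> in M. W (s, t) \<omega> = c * Y s \<omega>)) \<and>
    (\<forall>s\<ge>0. \<exists>c Y. weighted_fBm M a2 b2 Y \<and> (\<forall>t\<ge>0. AE \<omega> in M. W (s, t) \<omega> = c * Y t \<omega>)) \<and>
    (\<forall>s t s' t'. 0 \<le> s \<and> 0 \<le> t \<and> s < s' \<and> t < t' \<longrightarrow>
         (\<integral>\<omega>. (rect_incr W (s, t) (s', t') \<omega>)\<^sup>2 \<partial>M) =
           4 * (LBINT u:{s..s'}. u powr a1 * (s' - u) powr b1) *
               (LBINT v:{t..t'}. v powr a2 * (t' - v) powr b2)) \<and>
    (\<forall>s>0. \<forall>t>0.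
         ((\<lambda>(\<epsilon>, \<delta>). \<epsilon> powr (- b1 - 1) * \<delta> powr (- b2 - 1) *
              (\<integral>\<omega>. (rect_incr W (s, t) (s + \<epsilon>, t + \<delta>) \<omega>)\<^sup>2 \<partial>M))
           \<longlongrightarrow> 4 / ((1 + b1) * (1 + b2)) * s powr a1 * t powr a2)
         (at_right 0 \<times>\<^sub>F at_right 0)) \<and>
    (\<forall>s\<ge>0. \<forall>t\<ge>0.
         ((\<lambda>(S, T). S powr (- (1 + a1 + b1)) * T powr (- (1 + a2 + b2)) *
              (\<integral>\<omega>. (rect_incr W (s, t) (s + S, t + T) \<omega>)\<^sup>2 \<partial>M))
           \<longlongrightarrow> 4 * (LBINT u:{0..1}. u powr a1 * (1 - u) powr b1) *
                   (LBINT v:{0..1}. v powr a2 * (1 - v) powr b2))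
         (at_top \<times>\<^sub>F at_top)) \<and>
    (asymp_stationary_increments M W quadrant (at_top \<times>\<^sub>F at_top)) \<and>
    (a1 \<noteq> 0 \<and> a2 \<noteq> 0 \<longrightarrow>
         \<not> asymp_stationary_increments M W ({0<..} \<times> {0<..}) (at_right 0 \<times>\<^sub>F at_right 0)) \<and>
    (\<forall>(N :: 'v measure) B. fB_sheet N ((1 + b1) / 2) ((1 + b2) / 2) B \<longrightarrow>
         fdd_converges M quadrant
           (\<lambda>(S, T) (s, t) \<omega>. S powr (- a1 / 2) * T powr (- a2 / 2) *
              rect_incr W (S, T) (s + S, t + T) \<omega>)
           N (\<lambda>(s, t) \<omega>. 2 / sqrt ((1 + b1) * (1 + b2)) * B (s, t) \<omega>)
           (at_top \<times>\<^sub>F at_top)) \<and>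
    (\<forall>s t s' t' p u p' u'.
         0 \<le> s \<and> 0 \<le> t \<and> s < s' \<and> t < t' \<and> 0 \<le> p \<and> 0 \<le> u \<and> p < p' \<and> u < u' \<longrightarrow>
         ((\<lambda>(\<tau>, \<kappa>). \<tau> powr (1 - b1) * \<kappa> powr (1 - b2) *
              incr_cov M W (s, t) (s', t') (p + \<tau>, u + \<kappa>) (p' + \<tau>, u' + \<kappa>))
           \<longlongrightarrow> b1 * b2 / ((1 + a1) * (1 + a2)) *
                 (p' - p) * (s' powr (1 + a1) - s powr (1 + a1)) *
                 (u' - u) * (t' powr (1 + a2) - t powr (1 + a2)))
         (at_top \<times>\<^sub>F at_top)) \<and>
    (\<forall>\<theta>>0. \<not> (b1 = 0 \<and> b2 = 0) \<longrightarrow> \<not> (\<exists>a b. weighted_fBm M a b (\<lambda>t. W (t, \<theta> * t)))) \<and>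
    (\<forall>\<theta>>0. 0 \<le> b1 \<and> b1 < 1 \<and> 0 \<le> b2 \<and> b2 < 1 \<and> \<not> (b1 = 0 \<and> b2 = 0) \<longrightarrow>
         (\<forall>u v s t. 0 \<le> u \<and> u < v \<and> 0 \<le> s \<and> s < t \<longrightarrow>
           ((\<lambda>\<tau>. \<tau> powr (1 - (b1 + b2)) *
                covariance M (\<lambda>\<omega>. W (v, \<theta> * v) \<omega> - W (u, \<theta> * u) \<omega>)
                  (\<lambda>\<omega>. W (t + \<tau>, \<theta> * (t + \<tau>)) \<omega> - W (s + \<tau>, \<theta> * (s + \<tau>)) \<omega>))
             \<longlongrightarrow> (if b1 = 0 \<or> b2 = 0 then 2 else 1) *
                   (\<theta> powr (1 + a2 + b2) * (b1 + b2) / ((1 + a1) * (1 + a2)) *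
                    (v powr (2 + a1 + a2) - u powr (2 + a1 + a2)) * (t - s)))
           at_top))"
proof -
  interpret wfb_sheet M a1 b1 a2 b2 W by unfold_locales fact
  show ?thesis
  proof (intro conjI, goal_cases)
    case 1 show ?case by (intro allI impI self_similar)
  next
    case 2 show ?case by (rule stationary_increments_iff)
  next
    case 3 show ?case by (intro allI impI conjI; elim conjE; rule incr_cov_ordered)
  next
    case 4 show ?case by (intro allI impI section_fst)
  next
    case 5 show ?case by (intro allI impI section_snd)
  next
    case 6 show ?case by (intro allI impI; elim conjE) (simp only: rect_incr_square kint_def less_imp_le)
  next
    case 7 show ?case by (intro allI impI tendsto_short_increments)
  next
    case 8 show ?case by (intro allI impI tendsto_long_increments[unfolded kint_def])
  next
    case 9 show ?case by (rule asymp_stationary_long)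
  next
    case 10 show ?case by (intro impI not_asymp_stationary_short) (rule conjunct1)
  next
    case 11 show ?case by (intro allI impI fdd_converges_fB_sheet)
  next
    case 12 show ?case by (intro allI impI; elim conjE; rule tendsto_incr_cov_far)
  next
    case 13 show ?case using ray_not_wfBm by blast
  next
    case 14 show ?case by (intro allI impI; elim conjE; rule tendsto_ray_cov; assumption?; simp)
  qed
qed

end
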